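(* Let $n>m\ge 1$. Let $G$ be a finite nonabelian $2$-group with a central subgroup $N\cong\mathbb{Z}_{2^n}\times\mathbb{Z}_{2^m}$ such that $G/N$ is an elementary abelian $2$-group, and with $G'=\langle c\rangle\cong\mathbb{Z}_2$. Suppose that the center of $G$ is $$\zeta G=\langle z_1\rangle\times\langle z_2\rangle\times\cdots\times\langle z_r\rangle\cong\mathbb{Z}_{2^n}\times\mathbb{Z}_{2^m}\times\underbrace{\mathbb{Z}_2\times\cdots\times\mathbb{Z}_2}_{r-2},\qquad N=\langle z_1\rangle\times\langle z_2\rangle$$ (with $|z_1|=2^n$, $|z_2|=2^m$), and that $c\in\langle z_2\rangle$. Then $G$ is isomorphic to one of the following groups, for an integer $k$ in the indicated range, where $\mathbb{Z}_2^{(r-2)}$ is the direct product of $r-2$ copies of $\mathbb{Z}_2$: (i) $\bigl(M_2(m+1,n+1)\mathbin{\mathsf Y}D_8^{\mathsf Y(k-1)}\bigr)\times\mathbb{Z}_2^{(r-2)}$, $k\ge1$; (ii) $\bigl(M_2(m+1,n+1)\mathbin{\mathsf Y}Q_8\mathbin{\mathsf Y}D_8^{\mathsf Y(k-2)}\bigr)\times\mathbb{Z}_2^{(r-2)}$, $k\ge2$; (iii) $\bigl(M_2(n+1,1,1)\mathbin{\mathsf Y}M_2(m+1,1)\mathbin{\mathsf Y}D_8^{\mathsf Y(k-2)}\bigr)\times\mathbb{Z}_2^{(r-2)}$, $k\ge2$; (iv) $\bigl(M_2(n+1,1,1)\mathbin{\mathsf Y}M_2(m+1,1)\mathbin{\mathsf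 Y}Q_8\mathbin{\mathsf Y}D_8^{\mathsf Y(k-3)}\bigr)\times\mathbb{Z}_2^{(r-2)}$, $k\ge3$; (v) $\bigl(M_2(n+1,1,1)\mathbin{\mathsf Y}D_8^{\mathsf Y(k-1)}\mathbin{\mathsf Y}\mathbb{Z}_{2^m}\bigr)\times\mathbb{Z}_2^{(r-2)}$, $k\ge1$; (vi) $\bigl(M_2(n+1,1,1)\mathbin{\mathsf Y}Q_8\mathbin{\mathsf Y}D_8^{\mathsf Y(k-2)}\mathbin{\mathsf Y}\mathbb{Z}_{2^m}\bigr)\times\mathbb{Z}_2^{(r-2)}$, $k\ge2$; (vii) $\bigl(M_2(m+1,1)\mathbin{\mathsf Y}D_8^{\mathsf Y(k-1)}\bigr)\times\mathbb{Z}_{2^n}\times\mathbb{Z}_2^{(r-2)}$, $k\ge1$; (viii) $\bigl(M_2(m+1,1)\mathbin{\mathsf Y}Q_8\mathbin{\mathsf Y}D_8^{\mathsf Y(k-2)}\bigr)\times\mathbb{Z}_{2^n}\times\mathbb{Z}_2^{(r-2)}$, $k\ge2$; (ix) $\bigl(D_8^{\mathsf Y k}\mathbin{\mathsf Y}\mathbb{Z}_{2^m}\bigr)\times\mathbb{Z}_{2^n}\times\mathbb{Z}_2^{(r-2)}$, $k\ge1$; (x) $\bigl(Q_8\mathbin{\mathsf Y}D_8^{\mathsf Y(k-1)}\mathbin{\mathsf Y}\mathbb{Z}_{2^m}\bigr)\times\mathbb{Z}_{2^n}\times\mathbb{Z}_2^{(r-2)}$, $k\ge1$.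
   Context: $D_8$, $Q_8$ are the dihedral and quaternion groups of order $8$. $M_2(u,v)=\langle a,b\mid a^{2^u}=b^{2^v}=1,\ a^b=a^{1+2^{u-1}}\rangle$ for $u\ge2$, $v\ge1$. $M_2(w,1,1)=\langle a,b,d\mid a^{2^w}=b^{2}=d^2=1,\ [a,b]=d,\ [d,a]=[d,b]=1\rangle$ for $w\ge1$. $H\mathbin{\mathsf Y}K$ denotes the central product (a group $HK$ with $[H,K]=1$). In all the central products listed, the derived subgroups (of order $2$) of the nonabelian factors and the unique subgroup of order $2$ of a cyclic central factor are all identified with one common subgroup $\langle c\rangle$ of order $2$, and factors intersect exactly in $\langle c\rangle$. $D_8^{\mathsf Y j}$ is the central product of $j$ copies of $D_8$ (omitted if $j=0$). *)

theory Defs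
  imports "HOL-Algebra.Algebra"
begin

section \<open>Centers, elementary abelian groups, internal direct products\<close>

definition center :: "('a, 'b) monoid_scheme \<Rightarrow> 'a set" where
  "center G = {x \<in> carrier G. \<forall>y \<in> carrier G. x \<otimes>\<^bsub>G\<^esub> y = y \<otimes>\<^bsub>G\<^esub> x}"

definition elementary_abelian :: "nat \<Rightarrow> ('a, 'b) monoid_scheme \<Rightarrow> bool" where
  "elementary_abelian p G \<longleftrightarrow>
     comm_group G \<and> (\<forall>x \<in> carrier G. x [^]\<^bsub>G\<^esub> p = \<one>\<^bsub>G\<^esub>)"

definition internal_direct_product ::
    "('a, 'b) monoid_scheme \<Rightarrow> 'i set \<Rightarrow> ('i \<Rightarrow> 'a set) \<Rightarrow> 'a set \<Rightarrow> bool" where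
  "internal_direct_product G I H K \<longleftrightarrow>
     (\<forall>i\<in>I. subgroup (H i) G) \<and>
     (\<forall>i\<in>I. \<forall>j\<in>I. i \<noteq> j \<longrightarrow>
        (\<forall>x \<in> H i. \<forall>y \<in> H j. x \<otimes>\<^bsub>G\<^esub> y = y \<otimes>\<^bsub>G\<^esub> x)) \<and>
     (\<forall>i\<in>I. H i \<inter> generate G (\<Union>j \<in> I - {i}. H j) = {\<one>\<^bsub>G\<^esub>}) \<and>
     K = generate G (\<Union>i\<in>I. H i)"

section \<open>Groups given by generators and relations\<close>

text \<open>A letter \<open>(x, True)\<close> stands for the generator \<open>x\<close>, and \<open>(x, False)\<close> for its
  formal inverse.  Words over \<open>S\<close> represent the same element of \<open>\<langle>S | R\<rangle>\<close> iff they
  are related by the least congruence on words over \<open>S\<close> that contains the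
  relations \<open>u = v\<close>, for \<open>(u, v) \<in> R\<close>, and the free cancellations.\<close>

type_synonym 'g gword = "('g \<times> bool) list"

inductive pres_eq :: "'g set \<Rightarrow> ('g gword \<times> 'g gword) set \<Rightarrow> 'g gword \<Rightarrow> 'g gword \<Rightarrow> bool"
  for S :: "'g set" and R :: "('g gword \<times> 'g gword) set" where
  refl: "w \<in> lists (S \<times> UNIV) \<Longrightarrow> pres_eq S R w w"
| sym: "pres_eq S R u v \<Longrightarrow> pres_eq S R v u"
| trans: "pres_eq S R u v \<Longrightarrow> pres_eq S R v w \<Longrightarrow> pres_eq S R u w"
| append: "pres_eq S R u v \<Longrightarrow> pres_eq S R u' v' \<Longrightarrow> pres_eq S R (u @ u') (v @ v')"
| cancel: "x \<in> S \<Longrightarrow> pres_eq S R [(x, s), (x, \<not> s)] []"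
| relation: "(u, v) \<in> R \<Longrightarrow> u \<in> lists (S \<times> UNIV) \<Longrightarrow> v \<in> lists (S \<times> UNIV) \<Longrightarrow> pres_eq S R u v"

definition presented_group ::
    "'g set \<Rightarrow> ('g gword \<times> 'g gword) set \<Rightarrow> 'g gword set monoid" where
  "presented_group S R =
     \<lparr>carrier = lists (S \<times> UNIV) // {(u, v). pres_eq S R u v},
      monoid.mult = (\<lambda>A B. {w. \<exists>u \<in> A. \<exists>v \<in> B. pres_eq S R (u @ v) w}),
      one = {w. pres_eq S R [] w}\<rparr>"

definition gpow :: "'g \<Rightarrow> nat \<Rightarrow> 'g gword" where
  "gpow x k = replicate k (x, True)"

definition ginv :: "'g gword \<Rightarrow> 'g gword" where
  "ginv w = rev (map (\<lambda>(x, s). (x, \<not> s)) w)"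

definition gconj :: "'g gword \<Rightarrow> 'g gword \<Rightarrow> 'g gword" where
  "gconj u v = ginv v @ u @ v"

definition gcomm :: "'g gword \<Rightarrow> 'g gword \<Rightarrow> 'g gword" where
  "gcomm u v = ginv u @ ginv v @ u @ v"

datatype gen = Ga | Gb | Gd

abbreviation "wa \<equiv> gpow Ga 1"
abbreviation "wb \<equiv> gpow Gb 1"
abbreviation "wd \<equiv> gpow Gd 1"

definition D8 :: "gen gword set monoid" where
  "D8 = presented_group {Ga, Gb}
     {(gpow Ga 4, []), (gpow Gb 2, []), (gconj wa wb, ginv wa)}"

definition Q8 :: "gen gword set monoid" where
  "Q8 = presented_group {Ga, Gb}
     {(gpow Ga 4, []), (gpow Gb 2, gpow Ga 2), (gconj wa wb, ginv wa)}"

text \<open>\<open>Cyc k\<close> is a copy of \<open>integer_mod_group k\<close> whose carrier type is that of the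
  other factors of the central products.\<close>

definition Cyc :: "nat \<Rightarrow> gen gword set monoid" where
  "Cyc k = presented_group {Ga} {(gpow Ga k, [])}"

definition M2 :: "nat \<Rightarrow> nat \<Rightarrow> gen gword set monoid" where
  "M2 u v = presented_group {Ga, Gb}
     {(gpow Ga (2 ^ u), []), (gpow Gb (2 ^ v), []),
      (gconj wa wb, gpow Ga (1 + 2 ^ (u - 1)))}"

definition M2_11 :: "nat \<Rightarrow> gen gword set monoid"  \<comment> \<open>\<open>M\<^sub>2(w,1,1)\<close>\<close> where
  "M2_11 w = presented_group {Ga, Gb, Gd}
     {(gpow Ga (2 ^ w), []), (gpow Gb 2, []), (gpow Gd 2, []),
      (gcomm wa wb, wd), (gcomm wd wa, []), (gcomm wd wb, [])}"

section \<open>Central products\<close>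

text \<open>The subgroup along which a factor is amalgamated: the derived subgroup of a
  nonabelian factor, the subgroup of order 2 of a cyclic factor of even order.\<close>

definition amalgamated_subgroup :: "('a, 'b) monoid_scheme \<Rightarrow> 'a set" where
  "amalgamated_subgroup G =
     (if comm_group G then {x \<in> carrier G. x \<otimes>\<^bsub>G\<^esub> x = \<one>\<^bsub>G\<^esub>}
      else derived G (carrier G))"

definition factor_embedding :: "'a monoid list \<Rightarrow> nat \<Rightarrow> 'a \<Rightarrow> (nat \<Rightarrow> 'a)" where
  "factor_embedding Gs i x = (\<lambda>l \<in> {..<length Gs}. if l = i then x else \<one>\<^bsub>Gs ! l\<^esub>)"

text \<open>The central product is the quotient of the external direct product by the
  subgroup that identifies the generators of the amalgamated subgroups (each of
  order 2) with one another.  Only this subgroup is divided out, so the images of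
  the factors commute, generate the quotient, and each of them meets the product of
  the others in the common subgroup of order 2.\<close>

definition central_product :: "'a monoid list \<Rightarrow> (nat \<Rightarrow> 'a) set monoid" where
  "central_product Gs =
     (let P = product_group {..<length Gs} (\<lambda>i. Gs ! i)
      in P Mod generate P
           {factor_embedding Gs i x \<otimes>\<^bsub>P\<^esub> inv\<^bsub>P\<^esub> (factor_embedding Gs j y) | i j x y.
              i < length Gs \<and> j < length Gs \<and>
              x \<in> amalgamated_subgroup (Gs ! i) - {\<one>\<^bsub>Gs ! i\<^esub>} \<and>
              y \<in> amalgamated_subgroup (Gs ! j) - {\<one>\<^bsub>Gs ! j\<^esub>}})"

definition Z2_power :: "nat \<Rightarrow> (nat \<Rightarrow> int) monoid" where
  "Z2_power j = product_group {..<j} (\<lambda>_. integer_mod_group 2)"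

end

(*
  Since G' = {1, c} with c central of order 2, commuting is a nondegenerate symplectic form with values
  in Z_2 on the elementary abelian group G / Z(G). Whether x^2 has odd exponent at z1 is an additive
  function of x that vanishes on the centre, so it is represented by some u: the exponent is odd iff x
  does not commute with u. For m > 1 the same holds for the exponent at z2; for m = 1 the element z2 is c
  itself and that exponent is a quadratic form. After splitting off one or two noncommuting pairs that
  absorb these functions (they generate M_2(n+1,1,1), M_2(m+1,1) or M_2(m+1,n+1)), every coset x Z(G) of
  their centralizer has a representative with square 1 or c. Such a group splits into pairs generating
  D_8, with at most one Q_8: a Q_8 pair is needed only if no noncentral involution is left, and then its
  centralizer is central, because the product of a third noncentral element with a member of the pair
  would be such an involution.
*)
theory Submission
  imports Defs
begin

section \<open>Presented groups\<close>

text \<open>The orders of presented groups are never counted. A map onto the subgroup of a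
  noncommuting pair x, y exists once the relations hold. A kernel element is a word a^i b^j d^e,
  with d sent to c; its image commutes with x and y, so i and j are even, and only relations among
  the central elements x^2, y^2 and c remain to be compared.

  The choice between the large families is made by the square of u itself. As u commutes with
  itself, its exponent at z_1 is even. If the exponent at z_2 is even too, a central multiple of u
  is an involution, and with a noncommuting partner it generates M_2(n+1,1,1); otherwise a central
  multiple has square z_2, and M_2(m+1,n+1) arises. The square of the partner is normalized only to
  z_1 z_2^l: because n > m, this element still has order 2^n and meets the group of z_2 trivially,
  so it can take the place of z_1.

  The central product obtained in this way meets the centre in the group of z_2 or in that of z_1
  and z_2. A complement inside the centre supplies the abelian direct factors.\<close>

definition word_class :: "'g set \<Rightarrow> ('g gword \<times> 'g gword) set \<Rightarrow> 'g gword \<Rightarrow> 'g gword set" where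
  "word_class S R w = {v. pres_eq S R w v}"

definition word_value :: "('a, 'b) monoid_scheme \<Rightarrow> ('g \<Rightarrow> 'a) \<Rightarrow> 'g gword \<Rightarrow> 'a" where
  "word_value G h w =
     foldr (\<lambda>(x, s) a. (if s then h x else inv\<^bsub>G\<^esub> (h x)) \<otimes>\<^bsub>G\<^esub> a) w \<one>\<^bsub>G\<^esub>"

lemma word_value_Nil [simp]: "word_value G h [] = \<one>\<^bsub>G\<^esub>"
  by (simp add: word_value_def)

lemma word_value_Cons [simp]:
  "word_value G h ((x, s) # w) = (if s then h x else inv\<^bsub>G\<^esub> (h x)) \<otimes>\<^bsub>G\<^esub> word_value G h w"
  by (simp add: word_value_def)

lemma pres_eq_lists:
  assumes "pres_eq S R u v"
  shows "u \<in> lists (S \<times> UNIV)" "v \<in> lists (S \<times> UNIV)"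
  using assms by (induction) auto

lemma word_class_eq_iff:
  assumes "u \<in> lists (S \<times> UNIV)"
  shows "word_class S R u = word_class S R v \<longleftrightarrow> pres_eq S R u v"
  using assms unfolding word_class_def
  by (auto intro: pres_eq.refl pres_eq.sym pres_eq.trans)

lemma carrier_presented_group:
  "carrier (presented_group S R) = word_class S R ` lists (S \<times> UNIV)"
  by (auto simp: presented_group_def word_class_def quotient_def)

lemma one_presented_group: "\<one>\<^bsub>presented_group S R\<^esub> = word_class S R []"
  by (simp add: presented_group_def word_class_def)

lemma mult_presented_group:
  assumes "u \<in> lists (S \<times> UNIV)" "v \<in> lists (S \<times> UNIV)"
  shows "word_class S R u \<otimes>\<^bsub>presented_group S R\<^esub> word_class S R v = word_class S R (u @ v)"
proof -
  have "pres_eq S R u u" "pres_eq S R v v"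
    using assms by (auto intro: pres_eq.refl)
  then show ?thesis
    unfolding presented_group_def word_class_def
    by (auto intro: pres_eq.trans pres_eq.append)
qed

lemma ginv_in_lists: "u \<in> lists (S \<times> UNIV) \<Longrightarrow> ginv u \<in> lists (S \<times> UNIV)"
  by (auto simp: ginv_def lists_eq_set)

text \<open>Cancellation starts at the seam: the last letter of \<open>ginv (a # u)\<close> is the
  formal inverse of \<open>a\<close>.\<close>

lemma pres_eq_ginv_append:
  assumes "u \<in> lists (S \<times> UNIV)"
  shows "pres_eq S R (ginv u @ u) []"
  using assms
proof (induction u rule: list.induct)
  case Nil
  then show ?case by (simp add: ginv_def pres_eq.refl)
next
  case (Cons a u)
  obtain x s where a: "a = (x, s)" by (cases a)
  have xS: "x \<in> S" and u: "u \<in> lists (S \<times> UNIV)" using Cons.prems a by auto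
  have "pres_eq S R ([(x, \<not> s), (x, \<not> \<not> s)] @ u) ([] @ u)"
    by (rule pres_eq.append[OF pres_eq.cancel[OF xS] pres_eq.refl[OF u]])
  then have "pres_eq S R (ginv u @ ([(x, \<not> s), (x, \<not> \<not> s)] @ u)) (ginv u @ ([] @ u))"
    by (rule pres_eq.append[OF pres_eq.refl[OF ginv_in_lists[OF u]]])
  moreover have "ginv (a # u) @ a # u = ginv u @ ([(x, \<not> s), (x, \<not> \<not> s)] @ u)"
    by (simp add: ginv_def a)
  ultimately show ?case using Cons.IH[OF u] by (metis pres_eq.trans append_Nil)
qed

lemma group_presented_group: "group (presented_group S R)"
proof (rule groupI)
  fix x y z
  assume "x \<in> carrier (presented_group S R)" "y \<in> carrier (presented_group S R)"
    "z \<in> carrier (presented_group S R)"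
  then show "x \<otimes>\<^bsub>presented_group S R\<^esub> y \<otimes>\<^bsub>presented_group S R\<^esub> z =
      x \<otimes>\<^bsub>presented_group S R\<^esub> (y \<otimes>\<^bsub>presented_group S R\<^esub> z)"
    unfolding carrier_presented_group
    by (elim imageE) (simp add: mult_presented_group)
next
  fix x assume "x \<in> carrier (presented_group S R)"
  then obtain u where u: "u \<in> lists (S \<times> UNIV)" "x = word_class S R u"
    by (auto simp: carrier_presented_group)
  have "word_class S R (ginv u) \<otimes>\<^bsub>presented_group S R\<^esub> x = \<one>\<^bsub>presented_group S R\<^esub>"
    using pres_eq_ginv_append[OF u(1)] ginv_in_lists[OF u(1)] u
    by (simp add: mult_presented_group one_presented_group word_class_eq_iff)
  moreover have "word_class S R (ginv u) \<in> carrier (presented_group S R)"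
    unfolding carrier_presented_group using ginv_in_lists[OF u(1)] by (rule imageI)
  ultimately show "\<exists>y\<in>carrier (presented_group S R).
      y \<otimes>\<^bsub>presented_group S R\<^esub> x = \<one>\<^bsub>presented_group S R\<^esub>" by blast
next
  fix x y
  assume "x \<in> carrier (presented_group S R)" "y \<in> carrier (presented_group S R)"
  then show "x \<otimes>\<^bsub>presented_group S R\<^esub> y \<in> carrier (presented_group S R)"
    unfolding carrier_presented_group
    by (elim imageE) (simp add: mult_presented_group imageI)
next
  show "\<one>\<^bsub>presented_group S R\<^esub> \<in> carrier (presented_group S R)"
    by (simp add: carrier_presented_group one_presented_group)
next
  fix x assume "x \<in> carrier (presented_group S R)"
  then show "\<one>\<^bsub>presented_group S R\<^esub> \<otimes>\<^bsub>presented_group S R\<^esub> x = x"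
    unfolding carrier_presented_group one_presented_group
    by (elim imageE) (simp add: mult_presented_group)
qed

section \<open>Evaluation of words and the universal property of a presentation\<close>

context group
begin

lemma word_value_closed:
  "\<lbrakk>h \<in> S \<rightarrow> carrier G; w \<in> lists (S \<times> UNIV)\<rbrakk> \<Longrightarrow> word_value G h w \<in> carrier G"
  by (induction w) (auto simp: Pi_iff)

lemma word_value_append:
  "\<lbrakk>h \<in> S \<rightarrow> carrier G; u \<in> lists (S \<times> UNIV); v \<in> lists (S \<times> UNIV)\<rbrakk>
    \<Longrightarrow> word_value G h (u @ v) = word_value G h u \<otimes> word_value G h v"
proof (induction u rule: list.induct)
  case Nil
  then show ?case by (simp add: word_value_closed)
next
  case (Cons a u)
  then show ?case
    by (cases a) (auto simp: Pi_iff m_assoc word_value_closed)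
qed

lemma word_value_gpow:
  assumes "h x \<in> carrier G"
  shows "word_value G h (gpow x k) = h x [^] k"
proof (induction k)
  case (Suc k)
  then show ?case unfolding gpow_def using assms nat_pow_Suc2 by simp
qed (simp add: gpow_def)

lemma word_value_cong_pres_eq:
  assumes h: "h \<in> S \<rightarrow> carrier G"
    and R: "\<And>u v. (u, v) \<in> R \<Longrightarrow> word_value G h u = word_value G h v"
    and "pres_eq S R u v"
  shows "word_value G h u = word_value G h v"
  using assms(3)
proof induction
  case (append u v u' v')
  then show ?case using pres_eq_lists[of S R] by (simp add: word_value_append[OF h])
next
  case (cancel x s)
  then show ?case using h by (auto simp: Pi_iff)
next
  case (relation u v)
  then show ?case by (intro R)
qed simp_all

text \<open>Von Dyck's theorem. The map evaluates an arbitrary representative of a class, and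
  \<open>word_value_cong_pres_eq\<close> makes the value independent of the choice.\<close>

lemma presented_group_hom:
  assumes h: "h \<in> S \<rightarrow> carrier G"
    and R: "\<And>u v. (u, v) \<in> R \<Longrightarrow> word_value G h u = word_value G h v"
  obtains \<phi> where "\<phi> \<in> hom (presented_group S R) G"
    and "\<And>w. w \<in> lists (S \<times> UNIV) \<Longrightarrow> \<phi> (word_class S R w) = word_value G h w"
proof -
  define \<phi> where "\<phi> W = word_value G h (SOME w. w \<in> W)" for W
  have \<phi>: "\<phi> (word_class S R w) = word_value G h w" if "w \<in> lists (S \<times> UNIV)" for w
  proof -
    have "w \<in> word_class S R w" using that by (simp add: word_class_def pres_eq.refl)
    then have "(SOME v. v \<in> word_class S R w) \<in> word_class S R w" by (rule someI)
    then show ?thesis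
      using word_value_cong_pres_eq[OF h R] unfolding \<phi>_def word_class_def by auto
  qed
  moreover have "\<phi> \<in> hom (presented_group S R) G"
    by (rule homI; unfold carrier_presented_group; elim imageE)
      (simp_all add: mult_presented_group \<phi> word_value_closed[OF h] word_value_append[OF h])
  ultimately show ?thesis using that by blast
qed

end

lemma word_class_generator_closed:
  "x \<in> S \<Longrightarrow> word_class S R [(x, s)] \<in> carrier (presented_group S R)"
  unfolding carrier_presented_group by (auto intro!: imageI)

text \<open>Evaluation at the group's own generators. It turns a relation between words into an
  equation between elements of the presented group, where group calculus applies.\<close>

lemma word_class_eq_word_value:
  assumes "w \<in> lists (S \<times> UNIV)"
  shows "word_class S R w =
    word_value (presented_group S R) (\<lambda>x. word_class S R [(x, True)]) w"
  using assms
proof (induction w rule: list.induct)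
  case Nil
  then show ?case by (simp add: one_presented_group)
next
  case (Cons a w)
  obtain x s where a: "a = (x, s)" by (cases a)
  have x: "x \<in> S" and w: "w \<in> lists (S \<times> UNIV)" using Cons.prems a by auto
  interpret K: group "presented_group S R" by (rule group_presented_group)
  have "inv\<^bsub>presented_group S R\<^esub> (word_class S R [(x, True)]) = word_class S R [(x, False)]"
  proof (rule K.inv_equality)
    have "pres_eq S R [(x, False), (x, True)] []" using pres_eq.cancel[OF x, of _ False] by simp
    then show "word_class S R [(x, False)] \<otimes>\<^bsub>presented_group S R\<^esub> word_class S R [(x, True)] =
        \<one>\<^bsub>presented_group S R\<^esub>"
      using x by (simp add: mult_presented_group one_presented_group word_class_eq_iff)
  qed (use x in \<open>auto intro: word_class_generator_closed\<close>)
  moreover have "word_class S R (a # w) =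
      word_class S R [(x, s)] \<otimes>\<^bsub>presented_group S R\<^esub> word_class S R w"
    using x w a by (simp add: mult_presented_group)
  ultimately show ?case using Cons.IH[OF w] a by simp
qed

lemma presented_group_relation:
  assumes "(u, v) \<in> R" "u \<in> lists (S \<times> UNIV)" "v \<in> lists (S \<times> UNIV)"
  shows "word_value (presented_group S R) (\<lambda>x. word_class S R [(x, True)]) u =
    word_value (presented_group S R) (\<lambda>x. word_class S R [(x, True)]) v"
  using assms pres_eq.relation[OF assms]
  by (simp add: word_class_eq_iff flip: word_class_eq_word_value)

lemma presented_group_generate:
  "carrier (presented_group S R) =
    generate (presented_group S R) ((\<lambda>x. word_class S R [(x, True)]) ` S)" (is "_ = ?g")
proof -
  interpret K: group "presented_group S R" by (rule group_presented_group)
  have sub: "(\<lambda>x. word_class S R [(x, True)]) ` S \<subseteq> carrier (presented_group S R)"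
    by (auto intro: word_class_generator_closed)
  have "word_value (presented_group S R) (\<lambda>x. word_class S R [(x, True)]) w \<in> ?g"
    if "w \<in> lists (S \<times> UNIV)" for w
    using that
  proof (induction w rule: list.induct)
    case (Cons a w)
    then show ?case
      by (cases a) (auto intro!: generate.eng intro: generate.incl generate.inv)
  qed (simp add: generate.one)
  then have "carrier (presented_group S R) \<subseteq> ?g"
    unfolding carrier_presented_group
    by (intro image_subsetI, subst word_class_eq_word_value)
  then show ?thesis using K.generate_in_carrier[OF sub] by blast
qed

section \<open>Class two groups with derived subgroup of order two\<close>

text \<open>Normalizing with \<open>m_assoc\<close> nests products to the right and hides such
  cancellations; these rules recover them.\<close>

lemma (in group) inv_cancel_left [simp]:
  assumes "x \<in> carrier G" "y \<in> carrier G"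
  shows "x \<otimes> (inv x \<otimes> y) = y" "inv x \<otimes> (x \<otimes> y) = y"
  using assms by (simp_all flip: m_assoc)

lemma (in group) conj_int_pow:
  assumes "x \<in> carrier G" "y \<in> carrier G"
  shows "inv y \<otimes> x [^] (i::int) \<otimes> y = (inv y \<otimes> x \<otimes> y) [^] i"
proof -
  have "(\<lambda>g. inv y \<otimes> g \<otimes> y) \<in> hom G G"
  proof (rule homI)
    fix a b assume "a \<in> carrier G" "b \<in> carrier G"
    then show "inv y \<otimes> (a \<otimes> b) \<otimes> y = inv y \<otimes> a \<otimes> y \<otimes> (inv y \<otimes> b \<otimes> y)"
      using assms by (simp add: m_assoc)
  qed (use assms in auto)
  from hom_int_pow[OF this assms(1) is_group is_group] show ?thesis by simp
qed

text \<open>Kept apart from \<open>class_two\<close> because the normal form calculus also runs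
  inside the presented groups, where it is not known beforehand that the central element is
  nontrivial.\<close>

locale central_involution = group G for G (structure) +
  fixes c
  assumes c_closed [simp, intro]: "c \<in> carrier G"
    and c_comm: "x \<in> carrier G \<Longrightarrow> c \<otimes> x = x \<otimes> c"
    and c_sq: "c \<otimes> c = \<one>"
begin

section \<open>Powers of the central involution and the subgroup of a noncommuting pair\<close>

lemma c_sq_right: "y \<in> carrier G \<Longrightarrow> y \<otimes> c \<otimes> c = y"
  by (simp add: m_assoc c_sq)

lemma c_int_pow: "c [^] (e::int) = (if even e then \<one> else c)"
proof -
  have 2: "c [^] (2::int) = \<one>"
    using int_pow_mult[OF c_closed, of 1 1] by (simp add: c_sq)
  show ?thesis
  proof (cases "even e")
    case True
    then obtain k where "e = 2 * k" by auto
    then show ?thesis using int_pow_pow[OF c_closed, of 2 k] 2 by simp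
  next
    case False
    then obtain k where "e = 2 * k + 1" by (auto elim: oddE)
    then show ?thesis using int_pow_pow[OF c_closed, of 2 k] 2 int_pow_mult[OF c_closed, of "2*k" 1] by simp
  qed
qed

lemma c_int_pow_comm: "x \<in> carrier G \<Longrightarrow> c [^] (e::int) \<otimes> x = x \<otimes> c [^] e"
  by (simp add: c_int_pow c_comm)

text \<open>Conjugation by \<open>y\<close> is an endomorphism that sends \<open>x\<close> to
  \<open>x \<otimes> c [^] k\<close>, and the central factor can be pulled out of the power.\<close>

lemma int_pow_comm_c:
  assumes "x \<in> carrier G" "y \<in> carrier G" "x \<otimes> y = y \<otimes> x \<otimes> c [^] (k::int)"
  shows "x [^] (i::int) \<otimes> y = y \<otimes> x [^] i \<otimes> c [^] (k * i)"
proof -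
  have "inv y \<otimes> x \<otimes> y = x \<otimes> c [^] k"
    using assms by (metis inv_closed m_assoc m_closed c_closed int_pow_closed l_inv l_one)
  then have "inv y \<otimes> x [^] i \<otimes> y = x [^] i \<otimes> c [^] (k * i)"
    using conj_int_pow[OF assms(1,2), of i] int_pow_mult_distrib[of x "c [^] k" i] assms
    by (simp add: c_int_pow_comm int_pow_pow)
  then show ?thesis
    using assms by (metis inv_closed m_assoc m_closed c_closed int_pow_closed r_inv l_one)
qed

lemma int_pow_int_pow_comm_c:
  assumes "x \<in> carrier G" "y \<in> carrier G" "x \<otimes> y = y \<otimes> x \<otimes> c"
  shows "y [^] (j::int) \<otimes> x [^] (i::int) = x [^] i \<otimes> y [^] j \<otimes> c [^] (i * j)"
proof -
  have "x [^] i \<otimes> y = y \<otimes> x [^] i \<otimes> c [^] i"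
    using int_pow_comm_c[of x y 1 i] assms by simp
  \<comment> \<open>A power of \<open>c\<close> is its own inverse, so it changes sides without a
    sign; the previous lemma then applies with the roles exchanged.\<close>
  then have "y \<otimes> x [^] i = x [^] i \<otimes> y \<otimes> c [^] i"
    using assms by (simp add: m_assoc c_int_pow c_sq)
  from int_pow_comm_c[OF _ _ this, of j] show ?thesis using assms by simp
qed

text \<open>If the commutator of \<open>x\<close> and \<open>y\<close> is \<open>c\<close>, this is
  the subgroup that they generate. The normal form keeps the exponents visible, and all injectivity
  arguments read off their parities.\<close>

definition span :: "'a \<Rightarrow> 'a \<Rightarrow> 'a set" where
  "span x y = {x [^] i \<otimes> y [^] j \<otimes> c [^] e | (i::int) (j::int) (e::int). True}"

text \<open>The multiplication of the integral Heisenberg group: exponents add, and moving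
  \<open>x [^] k\<close> to the left across \<open>y [^] j\<close> costs
  \<open>c [^] (k * j)\<close>.\<close>

lemma span_mult:
  assumes "x \<in> carrier G" "y \<in> carrier G" "x \<otimes> y = y \<otimes> x \<otimes> c"
  shows "(x [^] (i::int) \<otimes> y [^] (j::int) \<otimes> c [^] (e::int)) \<otimes> (x [^] (k::int) \<otimes> y [^] (l::int) \<otimes> c [^] (f::int))
    = x [^] (i + k) \<otimes> y [^] (j + l) \<otimes> c [^] (e + f + k * j)"
proof -
  \<comment> \<open>The regrouping is done for arbitrary elements, so that rewriting with
    associativity does not interfere with the laws of powers.\<close>
  have *: "(a \<otimes> b \<otimes> p) \<otimes> (d \<otimes> g \<otimes> q) = (a \<otimes> d) \<otimes> (b \<otimes> g) \<otimes> (p \<otimes> q \<otimes> r)"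
    if "a \<in> carrier G" "b \<in> carrier G" "d \<in> carrier G" "g \<in> carrier G"
      "p \<in> carrier G" "q \<in> carrier G" "r \<in> carrier G"
      and bd: "b \<otimes> d = d \<otimes> b \<otimes> r" and p: "p \<otimes> (d \<otimes> g) = d \<otimes> g \<otimes> p"
      and r: "r \<otimes> (g \<otimes> (p \<otimes> q)) = g \<otimes> (p \<otimes> q) \<otimes> r" for a b d g p q r
  proof -
    have "(a \<otimes> b \<otimes> p) \<otimes> (d \<otimes> g \<otimes> q) = a \<otimes> b \<otimes> (p \<otimes> (d \<otimes> g)) \<otimes> q"
      using that(1-7) by (simp add: m_assoc)
    also have "\<dots> = a \<otimes> (b \<otimes> d) \<otimes> (g \<otimes> (p \<otimes> q))"
      unfolding p using that(1-7) by (simp add: m_assoc)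
    also have "\<dots> = a \<otimes> (d \<otimes> b) \<otimes> (r \<otimes> (g \<otimes> (p \<otimes> q)))"
      unfolding bd using that(1-7) by (simp add: m_assoc)
    also have "\<dots> = (a \<otimes> d) \<otimes> (b \<otimes> g) \<otimes> (p \<otimes> q \<otimes> r)"
      unfolding r using that(1-7) by (simp add: m_assoc)
    finally show ?thesis .
  qed
  have "(x [^] i \<otimes> y [^] j \<otimes> c [^] e) \<otimes> (x [^] k \<otimes> y [^] l \<otimes> c [^] f)
      = (x [^] i \<otimes> x [^] k) \<otimes> (y [^] j \<otimes> y [^] l) \<otimes> (c [^] e \<otimes> c [^] f \<otimes> c [^] (k * j))"
    using assms(1,2)
    by (intro * int_pow_int_pow_comm_c[OF assms] c_int_pow_comm) (simp_all)
  then show ?thesis using assms by (simp add: int_pow_mult)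
qed

lemma spanI: "x [^] (i::int) \<otimes> y [^] (j::int) \<otimes> c [^] (e::int) \<in> span x y"
  unfolding span_def by blast

lemma subgroup_span:
  assumes "x \<in> carrier G" "y \<in> carrier G" "x \<otimes> y = y \<otimes> x \<otimes> c"
  shows "subgroup (span x y) G"
proof (rule subgroupI)
  show "span x y \<subseteq> carrier G" using assms by (auto simp: span_def)
  show "span x y \<noteq> {}" by (auto simp: span_def)
next
  fix a b assume "a \<in> span x y" "b \<in> span x y"
  then show "a \<otimes> b \<in> span x y"
    unfolding span_def using span_mult[OF assms] by clarsimp blast
next
  fix a assume "a \<in> span x y"
  then obtain i j e :: int where a: "a = x [^] i \<otimes> y [^] j \<otimes> c [^] e"
    by (auto simp: span_def)
  \<comment> \<open>The summand \<open>i * j\<close> cancels the correction \<open>i * (- j)\<close>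
    in the multiplication law.\<close>
  have "(x [^] (- i) \<otimes> y [^] (- j) \<otimes> c [^] (- e + i * j)) \<otimes> a = \<one>"
    unfolding a span_mult[OF assms] by simp
  then have "inv a = x [^] (- i) \<otimes> y [^] (- j) \<otimes> c [^] (- e + i * j)"
    by (rule inv_equality) (use assms a in auto)
  then show "inv a \<in> span x y" using spanI by metis
qed

text \<open>Only the factor \<open>x [^] i\<close> fails to commute with \<open>y\<close>. If
  \<open>c\<close> is nontrivial, commuting with \<open>y\<close> therefore detects the parity of
  \<open>i\<close>, and commuting with \<open>x\<close> that of \<open>j\<close>.\<close>

lemma span_commute_right:
  assumes "x \<in> carrier G" "y \<in> carrier G" "x \<otimes> y = y \<otimes> x \<otimes> c"
  shows "x [^] (i::int) \<otimes> y [^] (j::int) \<otimes> c [^] (e::int) \<otimes> y =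
    y \<otimes> (x [^] i \<otimes> y [^] j \<otimes> c [^] e) \<otimes> c [^] i" (is "?w \<otimes> y = _")
proof -
  have "y [^] j \<otimes> y = y \<otimes> y [^] j"
    using int_pow_mult[OF assms(2), of j 1] int_pow_mult[OF assms(2), of 1 j] assms(2)
    by (simp add: add.commute)
  then have "y [^] j \<otimes> c [^] e \<otimes> y = y \<otimes> (y [^] j \<otimes> c [^] e)"
    using assms by (simp add: m_assoc c_int_pow_comm) (simp flip: m_assoc)
  then have "?w \<otimes> y = (x [^] i \<otimes> y) \<otimes> (y [^] j \<otimes> c [^] e)"
    using assms by (simp add: m_assoc)
  also have "\<dots> = y \<otimes> x [^] i \<otimes> (c [^] i \<otimes> (y [^] j \<otimes> c [^] e))"
    using int_pow_comm_c[of x y 1 i] assms by (simp add: m_assoc)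
  also have "\<dots> = y \<otimes> ?w \<otimes> c [^] i"
    using assms c_int_pow_comm[of "y [^] j \<otimes> c [^] e" i] by (simp add: m_assoc)
  finally show ?thesis .
qed

lemma span_commute_left:
  assumes "x \<in> carrier G" "y \<in> carrier G" "x \<otimes> y = y \<otimes> x \<otimes> c"
  shows "x \<otimes> (x [^] (i::int) \<otimes> y [^] (j::int) \<otimes> c [^] (e::int)) =
    x [^] i \<otimes> y [^] j \<otimes> c [^] e \<otimes> x \<otimes> c [^] j" (is "x \<otimes> ?w = _")
proof -
  have x: "x [^] i \<otimes> x = x \<otimes> x [^] i"
    using int_pow_mult[OF assms(1), of i 1] int_pow_mult[OF assms(1), of 1 i] assms(1)
    by (simp add: add.commute)
  have "y [^] j \<otimes> x = x \<otimes> y [^] j \<otimes> c [^] j"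
    using int_pow_int_pow_comm_c[OF assms, of j 1] assms by simp
  then have "y [^] j \<otimes> (c [^] e \<otimes> (x \<otimes> c [^] j)) = x \<otimes> (y [^] j \<otimes> c [^] e)"
    using assms c_comm[of x] by (cases "even j"; cases "even e")
      (simp_all add: c_int_pow m_assoc c_sq, simp_all add: c_sq_right flip: m_assoc)
  then have "?w \<otimes> x \<otimes> c [^] j = x [^] i \<otimes> (x \<otimes> (y [^] j \<otimes> c [^] e))"
    using assms by (simp add: m_assoc)
  also have "\<dots> = x \<otimes> ?w" using x assms by (simp flip: m_assoc)
  finally show ?thesis ..
qed

lemma generators_in_span:
  assumes "x \<in> carrier G" "y \<in> carrier G"
  shows "x \<in> span x y" "y \<in> span x y" "c \<in> span x y" "\<one> \<in> span x y"
  using spanI[of x 1 y 0 0] spanI[of x 0 y 1 0] spanI[of x 0 y 0 1] spanI[of x 0 y 0 0] assms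
  by simp_all

lemma generate_subset_span:
  assumes "x \<in> carrier G" "y \<in> carrier G" "x \<otimes> y = y \<otimes> x \<otimes> c"
  shows "generate G {x, y} \<subseteq> span x y"
  by (rule generate_subgroup_incl[OF _ subgroup_span]) (use assms generators_in_span in auto)

end

locale class_two = central_involution +
  assumes c_not_one: "c \<noteq> \<one>"
    and comm_or: "\<lbrakk>x \<in> carrier G; y \<in> carrier G\<rbrakk> \<Longrightarrow> x \<otimes> y = y \<otimes> x \<or> x \<otimes> y = y \<otimes> x \<otimes> c"
begin

lemma c_int_pow_eq_one_iff: "c [^] (e::int) = \<one> \<longleftrightarrow> even e"
  by (simp add: c_int_pow c_not_one)

lemma commutator_eq_c:
  assumes "x \<in> carrier G" "y \<in> carrier G" "x \<otimes> y = y \<otimes> x \<otimes> c"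
  shows "x \<otimes> y \<otimes> inv x \<otimes> inv y = c"
proof -
  have "x \<otimes> y \<otimes> inv x \<otimes> inv y = y \<otimes> x \<otimes> (c \<otimes> (inv x \<otimes> inv y))"
    using assms by (simp add: m_assoc)
  also have "\<dots> = c"
    using assms c_comm[of "inv x \<otimes> inv y"] by (simp add: m_assoc)
  finally show ?thesis .
qed

lemma derived_subset: "derived G (carrier G) \<subseteq> {\<one>, c}"
proof -
  have "subgroup {\<one>, c} G"
    by (rule subgroupI) (auto simp: c_sq inv_equality)
  moreover have "x \<otimes> y \<otimes> inv x \<otimes> inv y \<in> {\<one>, c}" if "x \<in> carrier G" "y \<in> carrier G" for x y
    using comm_or[OF that]
  proof
    assume "x \<otimes> y = y \<otimes> x"
    then show ?thesis using that by (simp add: m_assoc)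
  next
    assume "x \<otimes> y = y \<otimes> x \<otimes> c"
    then show ?thesis using that commutator_eq_c by simp
  qed
  ultimately show ?thesis
    unfolding derived_def by (intro generate_subgroup_incl) auto
qed

text \<open>The last condition makes every factor contribute the same subgroup of order two, which
  is the identification that \<open>central_product\<close> imposes on abstract factors.\<close>

definition central_factor :: "('k, 'l) monoid_scheme \<Rightarrow> 'a set \<Rightarrow> bool" where
  "central_factor K A \<longleftrightarrow> group K \<and> (\<exists>f \<in> hom K G. inj_on f (carrier K) \<and> f ` carrier K = A
     \<and> f ` amalgamated_subgroup K = {\<one>, c})"

text \<open>A kernel element in normal form maps to the identity, which commutes with
  \<open>x\<close> and \<open>y\<close>, so both outer exponents are even. This is why
  \<open>ker\<close> is demanded for even exponents only: there the images are products of central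
  elements.\<close>

lemma central_factorI:
  assumes K: "central_involution K C"
    and A: "A \<in> carrier K" and B: "B \<in> carrier K" and gen: "carrier K \<subseteq> generate K {A, B}"
    and AB: "A \<otimes>\<^bsub>K\<^esub> B = B \<otimes>\<^bsub>K\<^esub> A \<otimes>\<^bsub>K\<^esub> C"
    and f: "f \<in> hom K G" and xy: "x \<otimes> y \<noteq> y \<otimes> x" and fA: "f A = x" and fB: "f B = y"
    and ker: "\<And>(i::int) (j::int) (e::int). x [^] (2 * i) \<otimes> y [^] (2 * j) \<otimes> c [^] e = \<one> \<Longrightarrow>
      A [^]\<^bsub>K\<^esub> (2 * i) \<otimes>\<^bsub>K\<^esub> B [^]\<^bsub>K\<^esub> (2 * j) \<otimes>\<^bsub>K\<^esub> C [^]\<^bsub>K\<^esub> e = \<one>\<^bsub>K\<^esub>"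
  shows "central_factor K (span x y)"
proof -
  interpret K: central_involution K C by (rule K)
  interpret f: group_hom K G f
    by (simp add: group_hom_def group_hom_axioms_def f K.is_group is_group)
  have x: "x \<in> carrier G" and y: "y \<in> carrier G" using A B fA fB by auto
  have xyc: "x \<otimes> y = y \<otimes> x \<otimes> c" using comm_or[OF x y] xy by auto
  have "x \<otimes> y = y \<otimes> x \<otimes> f C"
    using arg_cong[OF AB, of f] A B fA fB by simp
  then have fC: "f C = c" using xyc x y by simp
  have carr: "carrier K = K.span A B"
    using gen K.generate_subset_span[OF A B AB] subgroup.subset[OF K.subgroup_span[OF A B AB]] by blast
  have feq: "f (A [^]\<^bsub>K\<^esub> i \<otimes>\<^bsub>K\<^esub> B [^]\<^bsub>K\<^esub> j \<otimes>\<^bsub>K\<^esub> C [^]\<^bsub>K\<^esub> e) =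
      x [^] i \<otimes> y [^] j \<otimes> c [^] e" for i j e :: int
    using A B fA fB fC by (simp add: f.hom_int_pow)
  have img: "f ` carrier K = span x y"
  proof -
    have "f ` carrier K = {f (A [^]\<^bsub>K\<^esub> i \<otimes>\<^bsub>K\<^esub> B [^]\<^bsub>K\<^esub> j \<otimes>\<^bsub>K\<^esub> C [^]\<^bsub>K\<^esub> e) |
        (i::int) (j::int) (e::int). True}"
      unfolding carr K.span_def by blast
    then show ?thesis unfolding feq span_def .
  qed
  have inj: "inj_on f (carrier K)"
  proof -
    have "g = \<one>\<^bsub>K\<^esub>" if g: "g \<in> carrier K" "f g = \<one>" for g
    proof -
      obtain i j e :: int where ge: "g = A [^]\<^bsub>K\<^esub> i \<otimes>\<^bsub>K\<^esub> B [^]\<^bsub>K\<^esub> j \<otimes>\<^bsub>K\<^esub> C [^]\<^bsub>K\<^esub> e"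
        using g(1) unfolding carr K.span_def by auto
      have one: "x [^] i \<otimes> y [^] j \<otimes> c [^] e = \<one>" using g(2) feq ge by simp
      have j: "even j" and i: "even i"
        using span_commute_left[OF x y xyc, of i j e, unfolded one]
          span_commute_right[OF x y xyc, of i j e, unfolded one] x y
        by (simp_all add: c_int_pow_eq_one_iff)
      show ?thesis using ker[of "i div 2" "j div 2" e] one i j ge by simp
    qed
    then show ?thesis using f.inj_iff_trivial_ker by (auto simp: kernel_def)
  qed
  have noncomm: "\<not> comm_group K"
  proof
    assume "comm_group K"
    then interpret comm_group K .
    show False using m_comm[OF A B] fA fB xy A B f.hom_mult by metis
  qed
  have sub: "subgroup (span x y) G" using subgroup_span[OF x y xyc] .
  have "f ` amalgamated_subgroup K = derived G (span x y)"
    using noncomm f.derived_img[of "carrier K"] img by (simp add: amalgamated_subgroup_def)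
  moreover have "derived G (span x y) \<subseteq> {\<one>, c}"
    using mono_derived[OF subgroup.subset[OF sub]] derived_subset by (rule subset_trans)
  moreover have "\<one> \<in> derived G (span x y)" unfolding derived_def by (rule generate.one)
  moreover have "c \<in> derived G (span x y)"
  proof -
    have "c = x \<otimes> y \<otimes> inv x \<otimes> inv y"
      by (simp add: commutator_eq_c[OF x y xyc])
    then have "c \<in> derived_set G (span x y)" using generators_in_span[OF x y] by fastforce
    then show ?thesis unfolding derived_def by (rule generate.incl)
  qed
  ultimately show ?thesis
    unfolding central_factor_def using img inj f K.is_group by blast
qed

end

abbreviation gen_class :: "'g set \<Rightarrow> ('g gword \<times> 'g gword) set \<Rightarrow> 'g \<Rightarrow> 'g gword set" where
  "gen_class S R g \<equiv> word_class S R [(g, True)]"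

context group
begin

lemma commute_inv:
  assumes "d \<in> carrier G" "h \<in> carrier G" "d \<otimes> h = h \<otimes> d"
  shows "d \<otimes> inv h = inv h \<otimes> d"
  using assms by (metis inv_closed inv_solve_left' inv_solve_right m_assoc m_closed)

lemma generate_commute:
  assumes "S \<subseteq> carrier G" "d \<in> carrier G" "\<And>s. s \<in> S \<Longrightarrow> d \<otimes> s = s \<otimes> d"
    and "g \<in> generate G S"
  shows "d \<otimes> g = g \<otimes> d"
  using assms(4)
proof induction
  case (inv h)
  then show ?case using assms by (intro commute_inv) auto
next
  case (eng h1 h2)
  then have "h1 \<in> carrier G" "h2 \<in> carrier G" using generate_in_carrier[OF assms(1)] by auto
  then show ?case using eng assms(2) by (metis m_assoc)
qed (use assms in auto)

lemma int_pow_eq_one_if_dvd: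
  assumes "x \<in> carrier G" "x [^] (n::nat) = \<one>" "int n dvd k"
  shows "x [^] (k::int) = \<one>"
proof -
  from assms(3) obtain l where "k = int n * l" by (auto simp: dvd_def)
  moreover have "x [^] int n = \<one>" using assms(2) by (simp add: int_pow_int)
  ultimately show ?thesis using int_pow_pow[OF assms(1), of "int n" l] by simp
qed

lemma nat_pow_double: "x \<in> carrier G \<Longrightarrow> x [^] (2 * k) = (x \<otimes> x) [^] (k::nat)"
  using nat_pow_pow[of x 2 k] by (simp add: numeral_eq_Suc)

lemma int_pow_double: "x \<in> carrier G \<Longrightarrow> x [^] (2 * i) = (x \<otimes> x) [^] (i::int)"
  using int_pow_pow[of x 2 i] int_pow_mult[of x 1 1] by simp

end

section \<open>Recognizing the factors of the list inside the group\<close>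

context class_two
begin

text \<open>The presentation may have a third generator, as \<open>M2_11\<close> does with
  \<open>Gd\<close>; it only has to lie in the subgroup of the first two, so that the normal form
  still covers everything.\<close>

lemma central_factor_presentedI:
  fixes S R
  defines "K \<equiv> presented_group S R" and "A \<equiv> gen_class S R Ga" and "B \<equiv> gen_class S R Gb"
  assumes S: "Ga \<in> S" "Gb \<in> S" and h: "h \<in> S \<rightarrow> carrier G"
    and R: "\<And>u v. (u, v) \<in> R \<Longrightarrow> word_value G h u = word_value G h v"
    and xy: "h Ga \<otimes> h Gb \<noteq> h Gb \<otimes> h Ga"
    and gen: "\<And>g. g \<in> S \<Longrightarrow> gen_class S R g \<in> generate K {A, B}"
    and C: "C \<in> carrier K" and CA: "C \<otimes>\<^bsub>K\<^esub> A = A \<otimes>\<^bsub>K\<^esub> C" and CB: "C \<otimes>\<^bsub>K\<^esub> B = B \<otimes>\<^bsub>K\<^esub> C"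
    and CC: "C \<otimes>\<^bsub>K\<^esub> C = \<one>\<^bsub>K\<^esub>" and AB: "A \<otimes>\<^bsub>K\<^esub> B = B \<otimes>\<^bsub>K\<^esub> A \<otimes>\<^bsub>K\<^esub> C"
    and ker: "\<And>(i::int) (j::int) (e::int).
      h Ga [^] (2 * i) \<otimes> h Gb [^] (2 * j) \<otimes> c [^] e = \<one> \<Longrightarrow>
      A [^]\<^bsub>K\<^esub> (2 * i) \<otimes>\<^bsub>K\<^esub> B [^]\<^bsub>K\<^esub> (2 * j) \<otimes>\<^bsub>K\<^esub> C [^]\<^bsub>K\<^esub> e = \<one>\<^bsub>K\<^esub>"
  shows "central_factor K (span (h Ga) (h Gb))"
proof -
  interpret K: group K unfolding K_def by (rule group_presented_group)
  have A: "A \<in> carrier K" and B: "B \<in> carrier K"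
    unfolding A_def B_def K_def by (simp_all add: word_class_generator_closed S)
  have gen: "carrier K \<subseteq> generate K {A, B}"
  proof -
    have "generate K (gen_class S R ` S) \<subseteq> generate K {A, B}"
      by (intro K.generate_subgroup_incl K.generate_is_subgroup image_subsetI gen)
        (simp_all add: A B)
    then show ?thesis unfolding K_def using presented_group_generate by blast
  qed
  have "central_involution K C"
  proof unfold_locales
    fix g assume "g \<in> carrier K"
    then show "C \<otimes>\<^bsub>K\<^esub> g = g \<otimes>\<^bsub>K\<^esub> C"
      using K.generate_commute[of "{A, B}" C g] A B C CA CB gen by blast
  qed (rule C CC)+
  moreover obtain f where f: "f \<in> hom K G"
    "\<And>w. w \<in> lists (S \<times> UNIV) \<Longrightarrow> f (word_class S R w) = word_value G h w"
    using presented_group_hom[OF h R] unfolding K_def by metis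
  moreover have "f A = h Ga" "f B = h Gb"
    using f(2) S h by (auto simp: A_def B_def Pi_iff)
  ultimately show ?thesis using central_factorI[of K C A B f] A B gen AB xy ker by blast
qed

text \<open>Covers all relations of the shape a^b = a^(1+t): \<open>t\<close> is -2 for
  \<open>D8\<close> and \<open>Q8\<close>, and a power of two for \<open>M2\<close>. The commutator
  is a^t. The first condition in \<open>t\<close> makes it an involution; the second makes it
  commute with b, since conjugation by b sends a^t to a^(t+t*t).\<close>

lemma central_factor_metacyclicI:
  fixes R and t :: int
  defines "K \<equiv> presented_group {Ga, Gb} R"
    and "A \<equiv> gen_class {Ga, Gb} R Ga" and "B \<equiv> gen_class {Ga, Gb} R Gb"
  assumes xy: "x \<in> carrier G" "y \<in> carrier G" "x \<otimes> y \<noteq> y \<otimes> x"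
    and R: "\<And>u v. (u, v) \<in> R \<Longrightarrow>
      word_value G (\<lambda>g. if g = Ga then x else y) u = word_value G (\<lambda>g. if g = Ga then x else y) v"
    and AB: "inv\<^bsub>K\<^esub> B \<otimes>\<^bsub>K\<^esub> (A \<otimes>\<^bsub>K\<^esub> B) = A [^]\<^bsub>K\<^esub> (1 + t)"
    and t: "A [^]\<^bsub>K\<^esub> (2 * t) = \<one>\<^bsub>K\<^esub>" "A [^]\<^bsub>K\<^esub> (t * t) = \<one>\<^bsub>K\<^esub>"
    and ker: "\<And>(i::int) (j::int) (e::int). x [^] (2 * i) \<otimes> y [^] (2 * j) \<otimes> c [^] e = \<one> \<Longrightarrow>
      A [^]\<^bsub>K\<^esub> (2 * i) \<otimes>\<^bsub>K\<^esub> B [^]\<^bsub>K\<^esub> (2 * j) \<otimes>\<^bsub>K\<^esub> A [^]\<^bsub>K\<^esub> (t * e) = \<one>\<^bsub>K\<^esub>"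
  shows "central_factor K (span x y)"
proof -
  let ?h = "\<lambda>g. if g = Ga then x else y"
  interpret K: group K unfolding K_def by (rule group_presented_group)
  have A: "A \<in> carrier K" and B: "B \<in> carrier K"
    unfolding A_def B_def K_def by (simp_all add: word_class_generator_closed)
  have "inv\<^bsub>K\<^esub> B \<otimes>\<^bsub>K\<^esub> A [^]\<^bsub>K\<^esub> t \<otimes>\<^bsub>K\<^esub> B = A [^]\<^bsub>K\<^esub> ((1 + t) * t)"
    using K.conj_int_pow[OF A B, of t] AB A B by (simp add: K.m_assoc K.int_pow_pow)
  also have "\<dots> = A [^]\<^bsub>K\<^esub> t"
    using t(2) A by (simp add: distrib_right K.int_pow_mult)
  finally have "B \<otimes>\<^bsub>K\<^esub> (inv\<^bsub>K\<^esub> B \<otimes>\<^bsub>K\<^esub> A [^]\<^bsub>K\<^esub> t \<otimes>\<^bsub>K\<^esub> B) = B \<otimes>\<^bsub>K\<^esub> A [^]\<^bsub>K\<^esub> t" by simp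
  then have CB: "A [^]\<^bsub>K\<^esub> t \<otimes>\<^bsub>K\<^esub> B = B \<otimes>\<^bsub>K\<^esub> A [^]\<^bsub>K\<^esub> t"
    using A B by (simp add: K.m_assoc)
  have "B \<otimes>\<^bsub>K\<^esub> (inv\<^bsub>K\<^esub> B \<otimes>\<^bsub>K\<^esub> (A \<otimes>\<^bsub>K\<^esub> B)) = B \<otimes>\<^bsub>K\<^esub> (A \<otimes>\<^bsub>K\<^esub> A [^]\<^bsub>K\<^esub> t)"
    unfolding AB using A by (simp add: K.int_pow_mult)
  then have AB': "A \<otimes>\<^bsub>K\<^esub> B = B \<otimes>\<^bsub>K\<^esub> A \<otimes>\<^bsub>K\<^esub> A [^]\<^bsub>K\<^esub> t"
    using A B by (simp add: K.m_assoc)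
  have CA: "A [^]\<^bsub>K\<^esub> t \<otimes>\<^bsub>K\<^esub> A = A \<otimes>\<^bsub>K\<^esub> A [^]\<^bsub>K\<^esub> t"
    by (metis A K.int_pow_1 K.int_pow_mult add.commute)
  have CC: "A [^]\<^bsub>K\<^esub> t \<otimes>\<^bsub>K\<^esub> A [^]\<^bsub>K\<^esub> t = \<one>\<^bsub>K\<^esub>"
    using K.int_pow_mult[OF A, of t t] t(1) by simp
  have "central_factor K (span (?h Ga) (?h Gb))"
  proof (rule central_factor_presentedI[of "{Ga, Gb}" ?h R "A [^]\<^bsub>K\<^esub> t",
        folded K_def A_def B_def, OF _ _ _ _ _ _ _ CA CB CC AB'])
    show "gen_class {Ga, Gb} R g \<in> generate K {A, B}" if "g \<in> {Ga, Gb}" for g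
      using that by (auto simp: A_def B_def intro: generate.incl)
    show "word_value G ?h u = word_value G ?h v" if "(u, v) \<in> R" for u v
      using that by (rule R)
    show "A [^]\<^bsub>K\<^esub> (2 * i) \<otimes>\<^bsub>K\<^esub> B [^]\<^bsub>K\<^esub> (2 * j) \<otimes>\<^bsub>K\<^esub> (A [^]\<^bsub>K\<^esub> t) [^]\<^bsub>K\<^esub> e = \<one>\<^bsub>K\<^esub>"
      if "?h Ga [^] (2 * i) \<otimes> ?h Gb [^] (2 * j) \<otimes> c [^] e = \<one>" for i j e :: int
      using ker[of i j e] that A by (simp add: K.int_pow_pow)
  qed (use xy A in \<open>auto simp del: K.int_pow_1\<close>)
  then show ?thesis by simp
qed

lemma conj_relation:
  assumes "x \<in> carrier G" "y \<in> carrier G" "x \<otimes> y \<noteq> y \<otimes> x"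
  shows "inv y \<otimes> (x \<otimes> y) = x \<otimes> c"
  using comm_or[OF assms(1,2)] assms by (auto simp: m_assoc)

text \<open>A uniform treatment: \<open>q = 0\<close> gives \<open>D8\<close>, because
  \<open>gpow Ga 0\<close> is the empty word, and \<open>q = 1\<close> gives
  \<open>Q8\<close>.\<close>

lemma central_factor_order_8:
  fixes q :: nat
  assumes xy: "x \<in> carrier G" "y \<in> carrier G" "x \<otimes> y \<noteq> y \<otimes> x"
    and sq: "x \<otimes> x = c" "y \<otimes> y = c [^] q"
  shows "central_factor (presented_group {Ga, Gb}
    {(gpow Ga 4, []), (gpow Gb 2, gpow Ga (2 * q)), (gconj wa wb, ginv wa)}) (span x y)"
proof -
  define R :: "(gen gword \<times> gen gword) set"
    where "R = {(gpow Ga 4, []), (gpow Gb 2, gpow Ga (2 * q)), (gconj wa wb, ginv wa)}"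
  define K where "K = presented_group {Ga, Gb} R"
  define E where "E g = gen_class {Ga, Gb} R g" for g
  interpret K: group K unfolding K_def by (rule group_presented_group)
  have A: "E Ga \<in> carrier K" and B: "E Gb \<in> carrier K"
    unfolding E_def K_def by (simp_all add: word_class_generator_closed)
  have rel: "word_value K E u = word_value K E v" if "(u, v) \<in> R" for u v
    by (rule presented_group_relation[of u v R "{Ga, Gb}", folded K_def E_def])
      (use that in \<open>auto simp: R_def gpow_def ginv_def gconj_def\<close>)
  have a4: "E Ga [^]\<^bsub>K\<^esub> (4::nat) = \<one>\<^bsub>K\<^esub>"
    using rel[of "gpow Ga 4" "[]"] A by (simp add: R_def K.word_value_gpow)
  have "E Gb [^]\<^bsub>K\<^esub> (2::nat) = E Ga [^]\<^bsub>K\<^esub> (2 * q)"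
    using rel[of "gpow Gb 2" "gpow Ga (2 * q)"] A B by (simp add: R_def K.word_value_gpow)
  then have "E Gb [^]\<^bsub>K\<^esub> int 2 = E Ga [^]\<^bsub>K\<^esub> int (2 * q)" by (simp only: int_pow_int)
  then have b2: "E Gb [^]\<^bsub>K\<^esub> (2 * j) = E Ga [^]\<^bsub>K\<^esub> (2 * int q * j)" for j :: int
    using K.int_pow_pow[OF A, of "2 * int q" j] K.int_pow_pow[OF B, of 2 j] by simp
  have AB: "inv\<^bsub>K\<^esub> E Gb \<otimes>\<^bsub>K\<^esub> (E Ga \<otimes>\<^bsub>K\<^esub> E Gb) = E Ga [^]\<^bsub>K\<^esub> (1 + -2::int)"
    using rel[of "gconj wa wb" "ginv wa"] A B
    by (simp add: R_def gpow_def ginv_def gconj_def K.int_pow_neg)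
  have "central_factor K (span x y)"
  proof (rule central_factor_metacyclicI[of x y R "-2", folded K_def E_def, OF xy _ AB], goal_cases)
    case (1 u v)
    have "x [^] (4::nat) = \<one>"
      using nat_pow_double[of x 2] sq xy by (simp add: numeral_eq_Suc c_sq)
    moreover have "y [^] (2::nat) = x [^] (2 * q)"
      using sq xy nat_pow_double[OF xy(1), of q] by (simp add: numeral_eq_Suc)
    moreover have "x \<otimes> c \<otimes> x = \<one>"
      by (metis c_closed c_comm c_sq m_assoc sq(1) xy(1))
    then have "inv y \<otimes> (x \<otimes> y) = inv x"
      unfolding conj_relation[OF xy] using xy(1) by (simp add: inv_equality)
    ultimately show ?case
      using 1 xy unfolding R_def by (auto simp: word_value_gpow) (simp add: gconj_def ginv_def gpow_def)
  next
    case (4 i j e)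
    have "(y \<otimes> y) [^] j = c [^] (int q * j)"
      using sq(2) int_pow_pow[OF c_closed, of "int q" j] by (simp add: int_pow_int)
    then have "c [^] (i + int q * j + e) = \<one>"
      using 4 xy sq(1) by (simp add: int_pow_double int_pow_mult)
    then have "even (i + int q * j + e)" by (simp add: c_int_pow_eq_one_iff)
    \<comment> \<open>The sign of \<open>e\<close> is flipped because the commutator of the
      presented group is written as a^(-2); the parity does not notice.\<close>
    then have "even (i + int q * j - e)" by simp
    then have "int 4 dvd 2 * (i + int q * j - e)"
      using mult_dvd_mono[of 2 2 2 "i + int q * j - e"] by simp
    then have "E Ga [^]\<^bsub>K\<^esub> (2 * (i + int q * j - e)) = \<one>\<^bsub>K\<^esub>"
      by (rule K.int_pow_eq_one_if_dvd[OF A a4])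
    then have "E Ga [^]\<^bsub>K\<^esub> (2 * i + 2 * int q * j + - 2 * e) = \<one>\<^bsub>K\<^esub>"
      by (simp add: algebra_simps)
    then show ?case
      using A by (simp add: b2 flip: K.int_pow_mult)
  qed (use K.int_pow_eq_one_if_dvd[OF A a4] in simp_all)
  then show ?thesis unfolding K_def R_def .
qed

lemma central_factor_D8:
  assumes "x \<in> carrier G" "y \<in> carrier G" "x \<otimes> y \<noteq> y \<otimes> x" "x \<otimes> x = c" "y \<otimes> y = \<one>"
  shows "central_factor D8 (span x y)"
  using central_factor_order_8[of x y 0] assms by (simp add: D8_def gpow_def)

lemma central_factor_Q8:
  assumes "x \<in> carrier G" "y \<in> carrier G" "x \<otimes> y \<noteq> y \<otimes> x" "x \<otimes> x = c" "y \<otimes> y = c"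
  shows "central_factor Q8 (span x y)"
  using central_factor_order_8[of x y 1] assms by (simp add: Q8_def)

text \<open>Everything is phrased in the central elements \<open>x \<otimes> x\<close> and
  \<open>y \<otimes> y\<close>. The last hypothesis says that the groups they generate meet
  trivially, which separates the two exponents of a kernel element. The applications are
  \<open>v = 0\<close>, where \<open>y\<close> is an involution, and \<open>v = n\<close>.\<close>

lemma central_factor_M2:
  assumes xy: "x \<in> carrier G" "y \<in> carrier G" "x \<otimes> y \<noteq> y \<otimes> x"
    and m: "1 \<le> m"
    and ord: "ord (x \<otimes> x) = 2 ^ m" "ord (y \<otimes> y) = 2 ^ v"
    and c: "c = (x \<otimes> x) [^] (2 ^ (m - 1) :: nat)"
    and indep: "\<And>(i::int) (j::int). (x \<otimes> x) [^] i = (y \<otimes> y) [^] j \<Longrightarrow> (x \<otimes> x) [^] i = \<one>"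
  shows "central_factor (M2 (m + 1) (v + 1)) (span x y)"
proof -
  define R :: "(gen gword \<times> gen gword) set"
    where "R = {(gpow Ga (2 ^ (m + 1)), []), (gpow Gb (2 ^ (v + 1)), []),
      (gconj wa wb, gpow Ga (1 + 2 ^ (m + 1 - 1)))}"
  define K where "K = presented_group {Ga, Gb} R"
  define E where "E g = gen_class {Ga, Gb} R g" for g
  interpret K: group K unfolding K_def by (rule group_presented_group)
  have A: "E Ga \<in> carrier K" and B: "E Gb \<in> carrier K"
    unfolding E_def K_def by (simp_all add: word_class_generator_closed)
  have rel: "word_value K E u = word_value K E v" if "(u, v) \<in> R" for u v
    by (rule presented_group_relation[of u v R "{Ga, Gb}", folded K_def E_def])
      (use that in \<open>auto simp: R_def gpow_def ginv_def gconj_def\<close>)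
  have a: "E Ga [^]\<^bsub>K\<^esub> (2 ^ (m + 1) :: nat) = \<one>\<^bsub>K\<^esub>"
    using rel[of "gpow Ga (2 ^ (m + 1))" "[]"] A by (simp add: R_def K.word_value_gpow)
  have b: "E Gb [^]\<^bsub>K\<^esub> (2 ^ (v + 1) :: nat) = \<one>\<^bsub>K\<^esub>"
    using rel[of "gpow Gb (2 ^ (v + 1))" "[]"] B by (simp add: R_def K.word_value_gpow)
  have "inv\<^bsub>K\<^esub> E Gb \<otimes>\<^bsub>K\<^esub> (E Ga \<otimes>\<^bsub>K\<^esub> E Gb) = E Ga [^]\<^bsub>K\<^esub> (1 + 2 ^ m :: nat)"
    using rel[of "gconj wa wb" "gpow Ga (1 + 2 ^ m)"] A B
    by (simp add: R_def K.word_value_gpow) (simp add: gpow_def ginv_def gconj_def)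
  then have AB: "inv\<^bsub>K\<^esub> E Gb \<otimes>\<^bsub>K\<^esub> (E Ga \<otimes>\<^bsub>K\<^esub> E Gb) = E Ga [^]\<^bsub>K\<^esub> (1 + 2 ^ m :: int)"
    using int_pow_int[of K "E Ga" "1 + 2 ^ m"] by simp
  have xx: "x \<otimes> x \<in> carrier G" and yy: "y \<otimes> y \<in> carrier G" using xy by auto
  have "central_factor K (span x y)"
  proof (rule central_factor_metacyclicI[of x y R "2 ^ m", folded K_def E_def, OF xy _ AB], goal_cases)
    case (1 u w)
    have "x [^] (2 ^ (m + 1) :: nat) = \<one>"
      using nat_pow_double[OF xy(1), of "2 ^ m"] pow_ord_eq_1[OF xx] ord by simp
    moreover have "y [^] (2 ^ (v + 1) :: nat) = \<one>"
      using nat_pow_double[OF xy(2), of "2 ^ v"] pow_ord_eq_1[OF yy] ord by simp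
    moreover have "inv y \<otimes> (x \<otimes> y) = x [^] (1 + 2 ^ m :: nat)"
    proof -
      have "x [^] (2 ^ m :: nat) = c"
        using nat_pow_double[OF xy(1), of "2 ^ (m - 1)"] c m by (simp flip: power_Suc)
      then show ?thesis using conj_relation[OF xy] xy c_comm[of x] by (simp flip: nat_pow_mult)
    qed
    ultimately show ?case
      using 1 xy unfolding R_def by (auto simp: word_value_gpow) (simp add: gconj_def ginv_def gpow_def)
  next
    case 2
    show ?case using K.int_pow_eq_one_if_dvd[OF A a] by simp
  next
    case 3
    \<comment> \<open>The exponent on the right is \<open>2 * m\<close>, which is at least
      \<open>m + 1\<close> because \<open>m\<close> is positive.\<close>
    have "int (2 ^ (m + 1)) dvd 2 ^ m * 2 ^ m"
      using m by (cases m) auto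
    then show ?case by (rule K.int_pow_eq_one_if_dvd[OF A a])
  next
    case (4 i j e)
    \<comment> \<open>As \<open>c\<close> is a power of \<open>x \<otimes> x\<close>, the kernel
      relation equates a power of \<open>x \<otimes> x\<close> with one of
      \<open>y \<otimes> y\<close>; independence makes both trivial, and the orders then give
      divisibility.\<close>
    have "c [^] e = (x \<otimes> x) [^] (2 ^ (m - 1) * e)"
      using int_pow_pow[OF xx, of "2 ^ (m - 1)" e] int_pow_int[of G "x \<otimes> x" "2 ^ (m - 1)"] c by simp
    then have "(x \<otimes> x) [^] i \<otimes> ((y \<otimes> y) [^] j \<otimes> (x \<otimes> x) [^] (2 ^ (m - 1) * e)) = \<one>"
      using 4 xy by (simp add: int_pow_double m_assoc)
    moreover have "(y \<otimes> y) [^] j \<otimes> (x \<otimes> x) [^] (2 ^ (m - 1) * e) =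
        (x \<otimes> x) [^] (2 ^ (m - 1) * e) \<otimes> (y \<otimes> y) [^] j"
      using c_int_pow_comm[of "(y \<otimes> y) [^] j" e] yy \<open>c [^] e = _\<close> by simp
    ultimately have one: "(x \<otimes> x) [^] (i + 2 ^ (m - 1) * e) \<otimes> (y \<otimes> y) [^] j = \<one>"
      using xx yy by (simp add: int_pow_mult m_assoc)
    then have "(x \<otimes> x) [^] (i + 2 ^ (m - 1) * e) = (y \<otimes> y) [^] (- j)"
      using xx yy by (simp add: int_pow_neg inv_equality)
    then have 1: "(x \<otimes> x) [^] (i + 2 ^ (m - 1) * e) = \<one>" by (rule indep)
    then have "(y \<otimes> y) [^] j = \<one>" using one yy by simp
    then have "2 ^ v dvd j" using int_pow_eq_id[OF yy, of j] ord by simp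
    then have "int (2 ^ (v + 1)) dvd 2 * j" by simp
    then have j: "E Gb [^]\<^bsub>K\<^esub> (2 * j) = \<one>\<^bsub>K\<^esub>" by (rule K.int_pow_eq_one_if_dvd[OF B b])
    have "2 ^ m dvd i + 2 ^ (m - 1) * e" using 1 int_pow_eq_id[OF xx] ord by simp
    then have "2 * 2 ^ m dvd 2 * (i + 2 ^ (m - 1) * e)" by (rule mult_dvd_mono[OF dvd_refl])
    also have "2 * (i + 2 ^ (m - 1) * e) = 2 * i + 2 ^ m * e"
      using m power_Suc[of "2::int" "m - 1"] by (simp add: distrib_left)
    finally have "E Ga [^]\<^bsub>K\<^esub> (2 * i + 2 ^ m * e) = \<one>\<^bsub>K\<^esub>"
      by (intro K.int_pow_eq_one_if_dvd[OF A a]) simp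
    then show ?case using A j by (simp add: K.int_pow_mult)
  qed
  then show ?thesis unfolding K_def R_def M2_def .
qed

text \<open>Here \<open>c\<close> lies outside the group generated by \<open>x \<otimes> x\<close>,
  so the commutator needs the separate generator \<open>Gd\<close>. A kernel element with odd
  \<open>e\<close> would express \<open>c\<close> as a power of
  \<open>x \<otimes> x\<close>.\<close>

lemma central_factor_M2_11:
  assumes xy: "x \<in> carrier G" "y \<in> carrier G" "x \<otimes> y \<noteq> y \<otimes> x"
    and ord: "ord (x \<otimes> x) = 2 ^ n" and sq: "y \<otimes> y = \<one>"
    and indep: "\<And>i::int. (x \<otimes> x) [^] i \<noteq> c"
  shows "central_factor (M2_11 (n + 1)) (span x y)"
proof -
  define R :: "(gen gword \<times> gen gword) set"
    where "R = {(gpow Ga (2 ^ (n + 1)), []), (gpow Gb 2, []), (gpow Gd 2, []),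
      (gcomm wa wb, wd), (gcomm wd wa, []), (gcomm wd wb, [])}"
  define S where "S = {Ga, Gb, Gd}"
  define K where "K = presented_group S R"
  define E where "E g = gen_class S R g" for g
  define h where "h g = (case g of Ga \<Rightarrow> x | Gb \<Rightarrow> y | Gd \<Rightarrow> c)" for g
  interpret K: group K unfolding K_def by (rule group_presented_group)
  have A: "E Ga \<in> carrier K" and B: "E Gb \<in> carrier K" and D: "E Gd \<in> carrier K"
    unfolding E_def K_def by (simp_all add: word_class_generator_closed S_def)
  have rel: "word_value K E u = word_value K E v" if "(u, v) \<in> R" for u v
    by (rule presented_group_relation[of u v R S, folded K_def E_def])
      (use that in \<open>auto simp: R_def S_def gpow_def ginv_def gcomm_def\<close>)
  have a: "E Ga [^]\<^bsub>K\<^esub> (2 ^ (n + 1) :: nat) = \<one>\<^bsub>K\<^esub>"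
    using rel[of "gpow Ga (2 ^ (n + 1))" "[]"] A by (simp add: R_def K.word_value_gpow)
  have b: "E Gb [^]\<^bsub>K\<^esub> (2::nat) = \<one>\<^bsub>K\<^esub>"
    using rel[of "gpow Gb 2" "[]"] B by (simp add: R_def K.word_value_gpow)
  have d: "E Gd [^]\<^bsub>K\<^esub> (2::nat) = \<one>\<^bsub>K\<^esub>"
    using rel[of "gpow Gd 2" "[]"] D by (simp add: R_def K.word_value_gpow)
  have ab: "inv\<^bsub>K\<^esub> E Ga \<otimes>\<^bsub>K\<^esub> (inv\<^bsub>K\<^esub> E Gb \<otimes>\<^bsub>K\<^esub> (E Ga \<otimes>\<^bsub>K\<^esub> E Gb)) = E Gd"
    using rel[of "gcomm wa wb" wd] A B D by (simp add: R_def gpow_def ginv_def gcomm_def)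
  have comm: "E Gd \<otimes>\<^bsub>K\<^esub> E g = E g \<otimes>\<^bsub>K\<^esub> E Gd" if "(gcomm wd (gpow g 1), []) \<in> R" "E g \<in> carrier K" for g
  proof -
    have "inv\<^bsub>K\<^esub> E Gd \<otimes>\<^bsub>K\<^esub> (inv\<^bsub>K\<^esub> E g \<otimes>\<^bsub>K\<^esub> (E Gd \<otimes>\<^bsub>K\<^esub> E g)) = \<one>\<^bsub>K\<^esub>"
      using rel[OF that(1)] that(2) D by (simp add: gpow_def ginv_def gcomm_def)
    then have "E g \<otimes>\<^bsub>K\<^esub> (E Gd \<otimes>\<^bsub>K\<^esub> (inv\<^bsub>K\<^esub> E Gd \<otimes>\<^bsub>K\<^esub> (inv\<^bsub>K\<^esub> E g \<otimes>\<^bsub>K\<^esub> (E Gd \<otimes>\<^bsub>K\<^esub> E g)))) =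
        E g \<otimes>\<^bsub>K\<^esub> (E Gd \<otimes>\<^bsub>K\<^esub> \<one>\<^bsub>K\<^esub>)" by simp
    then show ?thesis using that(2) D by simp
  qed
  have CA: "E Gd \<otimes>\<^bsub>K\<^esub> E Ga = E Ga \<otimes>\<^bsub>K\<^esub> E Gd" and CB: "E Gd \<otimes>\<^bsub>K\<^esub> E Gb = E Gb \<otimes>\<^bsub>K\<^esub> E Gd"
    by (rule comm; simp add: R_def A B)+
  have CC: "E Gd \<otimes>\<^bsub>K\<^esub> E Gd = \<one>\<^bsub>K\<^esub>"
    using d D by (simp add: numeral_eq_Suc)
  have AB: "E Ga \<otimes>\<^bsub>K\<^esub> E Gb = E Gb \<otimes>\<^bsub>K\<^esub> E Ga \<otimes>\<^bsub>K\<^esub> E Gd"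
    unfolding ab[symmetric] using A B by (simp add: K.m_assoc)
  have "central_factor K (span (h Ga) (h Gb))"
  proof (rule central_factor_presentedI[of S h R "E Gd", folded K_def E_def,
        OF _ _ _ _ _ _ D CA CB CC AB], goal_cases)
    case (4 u v)
    have "x [^] (2 ^ (n + 1) :: nat) = \<one>"
      using nat_pow_double[OF xy(1), of "2 ^ n"] pow_ord_eq_1[of "x \<otimes> x"] xy ord by simp
    moreover have "y [^] (2::nat) = \<one>" "c [^] (2::nat) = \<one>"
      using sq xy c_sq by (simp_all add: numeral_eq_Suc)
    moreover have "inv x \<otimes> (inv y \<otimes> (x \<otimes> y)) = c"
      unfolding conj_relation[OF xy] using xy by simp
    moreover have "inv c \<otimes> (inv g \<otimes> (c \<otimes> g)) = \<one>" if "g \<in> carrier G" for g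
      using that by (simp add: c_comm)
    ultimately show ?case
      using 4 xy unfolding R_def
      by (auto simp: word_value_gpow h_def) (simp_all add: gcomm_def ginv_def gpow_def h_def)
  next
    case (6 g)
    \<comment> \<open>The third generator is the commutator of the other two.\<close>
    have "E Gd \<in> generate K {E Ga, E Gb}"
      unfolding ab[symmetric] by (intro generate.eng) (auto intro: generate.incl generate.inv)
    then show ?case using 6 by (auto simp: S_def intro: generate.incl)
  next
    case (7 i j e)
    have 1: "(x \<otimes> x) [^] i \<otimes> c [^] e = \<one>"
      using 7 xy sq by (simp add: h_def int_pow_double)
    have e: "even e"
    proof (rule ccontr)
      assume "odd e"
      then have "(x \<otimes> x) [^] i = inv c"
        using 1 xy by (simp add: c_int_pow inv_equality)
      also have "inv c = c" using c_sq by (simp add: inv_equality)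
      finally show False using indep by blast
    qed
    then have "(x \<otimes> x) [^] i = \<one>" using 1 xy by (simp add: c_int_pow)
    then have "2 ^ n dvd i" using int_pow_eq_id[of "x \<otimes> x" i] xy ord by simp
    then have "int (2 ^ (n + 1)) dvd 2 * i" by simp
    then have "E Ga [^]\<^bsub>K\<^esub> (2 * i) = \<one>\<^bsub>K\<^esub>" by (rule K.int_pow_eq_one_if_dvd[OF A a])
    moreover have "E Gb [^]\<^bsub>K\<^esub> (2 * j) = \<one>\<^bsub>K\<^esub>" using K.int_pow_eq_one_if_dvd[OF B b] by simp
    moreover have "E Gd [^]\<^bsub>K\<^esub> e = \<one>\<^bsub>K\<^esub>" using K.int_pow_eq_one_if_dvd[OF D d] e by simp
    ultimately show ?case by simp
  qed (use xy in \<open>auto simp: S_def h_def\<close>)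
  then show ?thesis unfolding K_def R_def S_def M2_11_def h_def by simp
qed

text \<open>The criterion for noncommuting pairs does not reach an abelian factor. Its amalgamated
  subgroup consists of the elements with square one, which in a cyclic group of order
  \<open>2 ^ m\<close> are the powers of the element of exponent \<open>2 ^ (m - 1)\<close>.\<close>

lemma central_factor_Cyc:
  assumes z: "z \<in> carrier G" and m: "1 \<le> m" and ord: "ord z = 2 ^ m"
    and c: "c = z [^] (2 ^ (m - 1) :: nat)"
  shows "central_factor (Cyc (2 ^ m)) (generate G {z})"
proof -
  define R :: "(gen gword \<times> gen gword) set" where "R = {(gpow Ga (2 ^ m), [])}"
  define K where "K = presented_group {Ga} R"
  define E where "E g = gen_class {Ga} R g" for g
  interpret K: group K unfolding K_def by (rule group_presented_group)
  have A: "E Ga \<in> carrier K"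
    unfolding E_def K_def by (simp_all add: word_class_generator_closed)
  have rel: "word_value K E u = word_value K E v" if "(u, v) \<in> R" for u v
    by (rule presented_group_relation[of u v R "{Ga}", folded K_def E_def])
      (use that in \<open>auto simp: R_def gpow_def\<close>)
  have a: "E Ga [^]\<^bsub>K\<^esub> (2 ^ m :: nat) = \<one>\<^bsub>K\<^esub>"
    using rel[of "gpow Ga (2 ^ m)" "[]"] A by (simp add: R_def K.word_value_gpow)
  have "carrier K = generate K {E Ga}"
    unfolding K_def E_def using presented_group_generate[of "{Ga}" R] by simp
  then have carr: "carrier K = range (\<lambda>k::int. E Ga [^]\<^bsub>K\<^esub> k)"
    using K.generate_pow[OF A] by auto
  obtain f where f: "f \<in> hom K G"
    "\<And>w. w \<in> lists ({Ga} \<times> UNIV) \<Longrightarrow> f (word_class {Ga} R w) = word_value G (\<lambda>_. z) w"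
  proof (rule presented_group_hom[of "\<lambda>_. z" "{Ga}" R])
    show "word_value G (\<lambda>_. z) u = word_value G (\<lambda>_. z) v" if "(u, v) \<in> R" for u v
      using that z pow_ord_eq_1[OF z] ord by (auto simp: R_def word_value_gpow)
  qed (use z in \<open>auto simp: K_def\<close>)
  interpret f: group_hom K G f
    by (simp add: group_hom_def group_hom_axioms_def f(1) K.is_group is_group)
  have fA: "f (E Ga) = z" using f(2)[of "[(Ga, True)]"] z by (simp add: E_def)
  have fpow: "f (E Ga [^]\<^bsub>K\<^esub> k) = z [^] k" for k :: int
    using A fA by (simp add: f.hom_int_pow)
  have img: "f ` carrier K = generate G {z}"
    unfolding carr generate_pow[OF z] by (auto simp: fpow image_image)
  have "g = \<one>\<^bsub>K\<^esub>" if g: "g \<in> carrier K" "f g = \<one>" for g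
  proof -
    obtain k :: int where k: "g = E Ga [^]\<^bsub>K\<^esub> k" using g(1) carr by auto
    then have "int (2 ^ m) dvd k" using g(2) fpow int_pow_eq_id[OF z] ord by simp
    then show ?thesis unfolding k by (rule K.int_pow_eq_one_if_dvd[OF A a])
  qed
  then have inj: "inj_on f (carrier K)"
    using f.inj_iff_trivial_ker by (auto simp: kernel_def)
  have "comm_group K"
  proof (rule K.group_comm_groupI)
    fix x y assume "x \<in> carrier K" "y \<in> carrier K"
    then obtain k l :: int where "x = E Ga [^]\<^bsub>K\<^esub> k" "y = E Ga [^]\<^bsub>K\<^esub> l"
      unfolding carr by blast
    then show "x \<otimes>\<^bsub>K\<^esub> y = y \<otimes>\<^bsub>K\<^esub> x"
      by (metis A K.int_pow_mult add.commute)
  qed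
  then have "f ` amalgamated_subgroup K = {g \<in> f ` carrier K. g \<otimes> g = \<one>}"
  proof -
    have "x \<otimes>\<^bsub>K\<^esub> x = \<one>\<^bsub>K\<^esub> \<longleftrightarrow> f x \<otimes> f x = \<one>" if "x \<in> carrier K" for x
      using inj_on_eq_iff[OF inj, of "x \<otimes>\<^bsub>K\<^esub> x" "\<one>\<^bsub>K\<^esub>"] that by simp
    then show ?thesis using \<open>comm_group K\<close> by (auto simp: amalgamated_subgroup_def)
  qed
  also have "\<dots> = {\<one>, c}"
  proof -
    have "z [^] k \<in> {\<one>, c}" if "z [^] k \<otimes> z [^] k = \<one>" for k :: int
    proof -
      have "z [^] (2 * k) = \<one>" using that int_pow_mult[OF z, of k k] by simp
      then have "2 * 2 ^ (m - 1) dvd 2 * k"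
        using int_pow_eq_id[OF z] ord m power_Suc[of "2::int" "m - 1"] by simp
      then obtain l where l: "k = 2 ^ (m - 1) * l" by (auto simp: dvd_def)
      have "z [^] k = c [^] l"
        using int_pow_pow[OF z, of "2 ^ (m - 1)" l] int_pow_int[of G z "2 ^ (m - 1)"] c l by simp
      then show ?thesis by (simp add: c_int_pow)
    qed
    then have "{g \<in> f ` carrier K. g \<otimes> g = \<one>} \<subseteq> {\<one>, c}"
      unfolding img generate_pow[OF z] by blast
    moreover have "c \<in> f ` carrier K"
      unfolding img generate_pow[OF z] using int_pow_int[of G z "2 ^ (m - 1)"] c
      by (metis (mono_tags, lifting) UNIV_I mem_Collect_eq)
    moreover have "\<one> \<in> f ` carrier K"
      unfolding img by (rule generate.one)
    ultimately show ?thesis using c_sq l_one[OF one_closed] by blast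
  qed
  finally have "central_factor K (generate G {z})"
    unfolding central_factor_def using K.is_group inj img f(1) by blast
  then show ?thesis unfolding K_def R_def Cyc_def .
qed

end

section \<open>Central decompositions\<close>

abbreviation factor_product :: "'k monoid list \<Rightarrow> (nat \<Rightarrow> 'k) monoid" where
  "factor_product L \<equiv> product_group {..<length L} (\<lambda>i. L ! i)"

definition identifications :: "'k monoid list \<Rightarrow> (nat \<Rightarrow> 'k) set" where
  "identifications L =
     {factor_embedding L i x \<otimes>\<^bsub>factor_product L\<^esub> inv\<^bsub>factor_product L\<^esub> (factor_embedding L j y) | i j x y.
        i < length L \<and> j < length L \<and>
        x \<in> amalgamated_subgroup (L ! i) - {\<one>\<^bsub>L ! i\<^esub>} \<and>
        y \<in> amalgamated_subgroup (L ! j) - {\<one>\<^bsub>L ! j\<^esub>}}"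

lemma central_product_eq:
  "central_product L = factor_product L Mod generate (factor_product L) (identifications L)"
  unfolding central_product_def identifications_def Let_def ..

lemma group_factor_product:
  "(\<And>K. K \<in> set L \<Longrightarrow> group K) \<Longrightarrow> group (factor_product L)"
  by (intro product_group) auto

lemma product_group_memD:
  "\<lbrakk>g \<in> carrier (product_group I G); i \<in> I\<rbrakk> \<Longrightarrow> g i \<in> carrier (G i)"
  by auto

lemma factor_embedding_closed:
  assumes "\<And>K. K \<in> set L \<Longrightarrow> group K" "i < length L" "x \<in> carrier (L ! i)"
  shows "factor_embedding L i x \<in> carrier (factor_product L)"
  using assms by (auto simp: factor_embedding_def group.is_monoid)

text \<open>The product over \<open>L\<close> becomes the tail of the product over
  \<open>K # L\<close>. This permits induction along the list although \<open>product_group\<close>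
  is indexed by positions.\<close>

definition shift :: "'k monoid \<Rightarrow> 'k monoid list \<Rightarrow> (nat \<Rightarrow> 'k) \<Rightarrow> nat \<Rightarrow> 'k" where
  "shift K L g = (\<lambda>i\<in>{..<Suc (length L)}. case i of 0 \<Rightarrow> \<one>\<^bsub>K\<^esub> | Suc j \<Rightarrow> g j)"

lemma shift_hom:
  assumes "group K"
  shows "shift K L \<in> hom (factor_product L) (factor_product (K # L))"
proof -
  interpret K: group K by fact
  show ?thesis
    by (rule homI) (auto simp: shift_def PiE_iff extensional_def restrict_def fun_eq_iff split: nat.split)
qed

lemma shift_factor_embedding:
  "i < length L \<Longrightarrow> shift K L (factor_embedding L i x) = factor_embedding (K # L) (Suc i) x"
  by (auto simp: shift_def factor_embedding_def restrict_def fun_eq_iff split: nat.split)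

lemma factor_product_Cons:
  assumes "\<And>H. H \<in> set (K # L) \<Longrightarrow> group H" and g: "g \<in> carrier (factor_product (K # L))"
  shows "g = factor_embedding (K # L) 0 (g 0) \<otimes>\<^bsub>factor_product (K # L)\<^esub>
    shift K L (\<lambda>i\<in>{..<length L}. g (Suc i))"
proof
  fix i
  have 0: "g 0 \<in> carrier K" using product_group_memD[OF g, of 0] by simp
  have S: "g (Suc j) \<in> carrier (L ! j)" if "j < length L" for j
    using product_group_memD[OF g, of "Suc j"] that by simp
  have K: "group K" and L: "group (L ! j)" if "j < length L" for j using assms(1) that by auto
  interpret K: group K using assms(1) by auto
  have 1: "g i = undefined" if "\<not> i < Suc (length L)" using g that by (auto simp: PiE_iff extensional_def)
  show "g i = (factor_embedding (K # L) 0 (g 0) \<otimes>\<^bsub>factor_product (K # L)\<^esub>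
    shift K L (\<lambda>i\<in>{..<length L}. g (Suc i))) i"
    using 0 S 1 group.is_monoid[OF L]
    by (cases i) (auto simp: shift_def factor_embedding_def monoid.l_one)
qed

text \<open>Positions rise by one, so a generator of the amalgamating subgroup for \<open>L\<close>
  becomes one for \<open>K # L\<close>.\<close>

lemma shift_identifications:
  assumes "\<And>H. H \<in> set (K # L) \<Longrightarrow> group H"
    and "g \<in> generate (factor_product L) (identifications L)"
    and sub: "\<And>H. H \<in> set L \<Longrightarrow> amalgamated_subgroup H \<subseteq> carrier H"
  shows "shift K L g \<in> generate (factor_product (K # L)) (identifications (K # L))"
proof -
  let ?P = "factor_product L" and ?Q = "factor_product (K # L)"
  have P: "group ?P" and Q: "group ?Q"
    by (intro group_factor_product; use assms(1) in auto)+
  interpret shift: group_hom ?P ?Q "shift K L"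
    using shift_hom[of K L] assms(1) P Q by (simp add: group_hom_def group_hom_axioms_def)
  have emb: "factor_embedding L i x \<in> carrier ?P"
    if "i < length L" "x \<in> amalgamated_subgroup (L ! i)" for i x
    using that sub assms(1) by (intro factor_embedding_closed) (auto dest: nth_mem)
  have id: "identifications L \<subseteq> carrier ?P"
    unfolding identifications_def using emb
    by (auto simp del: carrier_product_group mult_product_group inv_product_group)
  have "shift K L ` identifications L \<subseteq> identifications (K # L)"
  proof (rule image_subsetI)
    fix h assume "h \<in> identifications L"
    then obtain i j x y where h: "h = factor_embedding L i x \<otimes>\<^bsub>?P\<^esub> inv\<^bsub>?P\<^esub> (factor_embedding L j y)"
      and ij: "i < length L" "j < length L"
      and x: "x \<in> amalgamated_subgroup (L ! i) - {\<one>\<^bsub>L ! i\<^esub>}"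
      and y: "y \<in> amalgamated_subgroup (L ! j) - {\<one>\<^bsub>L ! j\<^esub>}"
      unfolding identifications_def by blast
    have "shift K L h = factor_embedding (K # L) (Suc i) x \<otimes>\<^bsub>?Q\<^esub> inv\<^bsub>?Q\<^esub> (factor_embedding (K # L) (Suc j) y)"
      unfolding h using emb ij x y
      by (simp add: shift_factor_embedding del: carrier_product_group mult_product_group inv_product_group)
    then show "shift K L h \<in> identifications (K # L)"
      unfolding identifications_def using ij x y
      by (intro CollectI exI[of _ "Suc i"] exI[of _ "Suc j"] exI[of _ x] exI[of _ y]) simp
  qed
  then have "generate ?Q (shift K L ` identifications L) \<subseteq> generate ?Q (identifications (K # L))"
    by (rule group.mono_generate[OF Q])
  then show ?thesis using shift.generate_img[OF id] assms(2) by blast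
qed

lemma set_multI: "\<lbrakk>a \<in> A; b \<in> B; a \<otimes>\<^bsub>G\<^esub> b = g\<rbrakk> \<Longrightarrow> g \<in> A <#>\<^bsub>G\<^esub> B"
  by (auto simp: set_mult_def)

lemma (in group) subgroup_set_mult_commuting:
  assumes A: "subgroup A G" and T: "subgroup T G"
    and comm: "\<And>a t. \<lbrakk>a \<in> A; t \<in> T\<rbrakk> \<Longrightarrow> a \<otimes> t = t \<otimes> a"
  shows "subgroup (A <#> T) G"
proof (rule subgroupI)
  have sub: "A \<subseteq> carrier G" "T \<subseteq> carrier G" using A T by (auto dest: subgroup.subset)
  then show "A <#> T \<subseteq> carrier G" by (rule set_mult_closed)
  show "A <#> T \<noteq> {}"
    using subgroup.one_closed[OF A] subgroup.one_closed[OF T] unfolding set_mult_def by blast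
  fix g assume "g \<in> A <#> T"
  then obtain a t where at: "a \<in> A" "t \<in> T" "g = a \<otimes> t" unfolding set_mult_def by blast
  have inv: "inv a \<in> A" "inv t \<in> T" using at A T by (simp_all add: subgroup.m_inv_closed)
  have "inv g = inv a \<otimes> inv t"
    using at sub comm[OF inv] by (simp add: inv_mult_group subsetD)
  then show "inv g \<in> A <#> T" unfolding set_mult_def using inv by blast
  fix h assume "h \<in> A <#> T"
  then obtain b u where bu: "b \<in> A" "u \<in> T" "h = b \<otimes> u" unfolding set_mult_def by blast
  have carr: "a \<in> carrier G" "t \<in> carrier G" "b \<in> carrier G" "u \<in> carrier G"
    using at bu sub by auto
  have "g \<otimes> h = a \<otimes> (t \<otimes> b) \<otimes> u" using at bu carr by (simp add: m_assoc)
  also have "\<dots> = (a \<otimes> b) \<otimes> (t \<otimes> u)"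
    unfolding comm[OF bu(1) at(2), symmetric] using carr by (simp add: m_assoc)
  finally show "g \<otimes> h \<in> A <#> T"
    unfolding set_mult_def using subgroup.m_closed[OF A at(1) bu(1)] subgroup.m_closed[OF T at(2) bu(2)] by blast
qed

section \<open>Internal central decompositions and their comparison with the external central
  product\<close>

context class_two
begin

text \<open>Starting from \<open>{\<one>, c}\<close> puts \<open>c\<close> into every
  \<open>T\<close>. A new factor, which contains \<open>c\<close> as well, then meets
  \<open>T\<close> exactly in \<open>{\<one>, c}\<close>.\<close>

inductive central_decomp :: "'k monoid list \<Rightarrow> 'a set \<Rightarrow> bool" where
  Nil: "central_decomp [] {\<one>, c}"
| Cons: "\<lbrakk>central_factor K A; central_decomp L T; \<And>a t. \<lbrakk>a \<in> A; t \<in> T\<rbrakk> \<Longrightarrow> a \<otimes> t = t \<otimes> a;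
    A \<inter> T \<subseteq> {\<one>, c}\<rbrakk> \<Longrightarrow> central_decomp (K # L) (A <#> T)"

lemma amalgamated_subgroup_subset: "group K \<Longrightarrow> amalgamated_subgroup K \<subseteq> carrier K"
  using group.derived_in_carrier[of K "carrier K"] by (auto simp: amalgamated_subgroup_def)

lemma central_factor_subgroup:
  assumes "central_factor K A"
  shows "subgroup A G" "c \<in> A"
proof -
  obtain f where K: "group K" and f: "f \<in> hom K G" "f ` carrier K = A"
    and c: "f ` amalgamated_subgroup K = {\<one>, c}"
    using assms unfolding central_factor_def by blast
  interpret f: group_hom K G f
    by (simp add: group_hom_def group_hom_axioms_def f(1) K is_group)
  show "subgroup A G" using f.img_is_subgroup f(2) by simp
  show "c \<in> A" using c f(2) amalgamated_subgroup_subset[OF K] by blast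
qed

lemma central_decomp_subgroup:
  assumes "central_decomp L T"
  shows "subgroup T G \<and> c \<in> T"
  using assms
proof induction
  case Nil
  show ?case using c_sq by (auto intro!: subgroupI simp: inv_equality)
next
  case (Cons K A L T)
  have "\<one> \<otimes> c \<in> A <#> T"
    unfolding set_mult_def
    using subgroup.one_closed[OF central_factor_subgroup(1)[OF Cons.hyps(1)]] Cons.IH by blast
  then show ?case
    using subgroup_set_mult_commuting[of A T] central_factor_subgroup[OF Cons.hyps(1)] Cons by auto
qed

text \<open>The second part of the union only matters for the empty list, where \<open>T\<close> is
  \<open>{\<one>, c}\<close> although the product is trivial.\<close>

lemma central_decomp_hom:
  assumes "central_decomp L T"
  shows "(\<forall>K \<in> set L. group K) \<and>
    (\<exists>F \<in> hom (factor_product L) G.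
      T = F ` carrier (factor_product L) \<union> (\<lambda>g. F g \<otimes> c) ` carrier (factor_product L) \<and>
      kernel (factor_product L) G F \<subseteq> generate (factor_product L) (identifications L) \<and>
      (\<forall>i < length L. amalgamated_subgroup (L ! i) - {\<one>\<^bsub>L ! i\<^esub>} \<noteq> {} \<and>
        (\<forall>x \<in> amalgamated_subgroup (L ! i) - {\<one>\<^bsub>L ! i\<^esub>}. F (factor_embedding L i x) = c)))"
  using assms
proof induction
  case Nil
  have "(\<lambda>_. \<one>) \<in> hom (factor_product []) G" by (rule homI) auto
  moreover have "kernel (factor_product []) G (\<lambda>_. \<one>) \<subseteq>
      generate (factor_product []) (identifications [])"
    using generate.one[of "factor_product []" "identifications []"]
    by (auto simp: kernel_def restrict_def)
  ultimately show ?case by (intro conjI bexI[of _ "\<lambda>_. \<one>"]) auto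
next
  case (Cons K A L T)
  let ?P = "factor_product L" and ?Q = "factor_product (K # L)"
  obtain F where Lgroup: "\<forall>H \<in> set L. group H" and F: "F \<in> hom ?P G"
    and FT: "T = F ` carrier ?P \<union> (\<lambda>g. F g \<otimes> c) ` carrier ?P"
    and Fker: "kernel ?P G F \<subseteq> generate ?P (identifications L)"
    and amne: "\<And>i. i < length L \<Longrightarrow> amalgamated_subgroup (L ! i) - {\<one>\<^bsub>L ! i\<^esub>} \<noteq> {}"
    and Fam: "\<And>i x. \<lbrakk>i < length L; x \<in> amalgamated_subgroup (L ! i) - {\<one>\<^bsub>L ! i\<^esub>}\<rbrakk>
        \<Longrightarrow> F (factor_embedding L i x) = c"
    using Cons.IH by blast
  obtain f where Kgroup: "group K" and f: "f \<in> hom K G" and inj: "inj_on f (carrier K)"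
    and fA: "f ` carrier K = A" and fam: "f ` amalgamated_subgroup K = {\<one>, c}"
    using Cons.hyps(1) unfolding central_factor_def by blast
  interpret P: group ?P by (rule group_factor_product) (use Lgroup in auto)
  interpret Q: group ?Q by (rule group_factor_product) (use Lgroup Kgroup in auto)
  interpret f: group_hom K G f
    by (simp add: group_hom_def group_hom_axioms_def f Kgroup is_group)
  interpret F: group_hom ?P G F
    by (simp add: group_hom_def group_hom_axioms_def F P.is_group is_group)
  interpret shift: group_hom ?P ?Q "shift K L"
    by (intro group_hom.intro group_hom_axioms.intro P.is_group Q.is_group shift_hom Kgroup)
  define tl' where "tl' g = (\<lambda>i\<in>{..<length L}. g (Suc i))" for g :: "nat \<Rightarrow> 'c"
  \<comment> \<open>The head passes through the embedding of \<open>K\<close> and the tail through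
    the map of the induction hypothesis; the product is a homomorphism because \<open>A\<close> and
    \<open>T\<close> commute elementwise.\<close>
  define F' where "F' g = f (g 0) \<otimes> F (tl' g)" for g
  have g0: "g 0 \<in> carrier K" if "g \<in> carrier ?Q" for g
    using product_group_memD[OF that, of 0] by simp
  have gS: "tl' g \<in> carrier ?P" if "g \<in> carrier ?Q" for g
    using product_group_memD[OF that, of "Suc _"] by (auto simp: tl'_def)
  have comm: "f x \<otimes> F g = F g \<otimes> f x" if "x \<in> carrier K" "g \<in> carrier ?P" for x g
    using Cons.hyps(3)[of "f x" "F g"] that fA FT by blast
  have F': "F' \<in> hom ?Q G"
  proof (rule homI)
    fix g h assume gh: "g \<in> carrier ?Q" "h \<in> carrier ?Q"
    have "tl' (g \<otimes>\<^bsub>?Q\<^esub> h) = tl' g \<otimes>\<^bsub>?P\<^esub> tl' h"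
      unfolding tl'_def by auto
    moreover have "(g \<otimes>\<^bsub>?Q\<^esub> h) 0 = g 0 \<otimes>\<^bsub>K\<^esub> h 0" by simp
    ultimately have "F' (g \<otimes>\<^bsub>?Q\<^esub> h) = f (g 0) \<otimes> (f (h 0) \<otimes> F (tl' g)) \<otimes> F (tl' h)"
      unfolding F'_def using gh[THEN g0] gh[THEN gS]
      by (simp add: m_assoc del: carrier_product_group mult_product_group)
    also have "\<dots> = F' g \<otimes> F' h"
      unfolding F'_def using gh[THEN g0] gh[THEN gS] comm[of "h 0" "tl' g"]
      by (simp add: m_assoc del: carrier_product_group mult_product_group)
    finally show "F' (g \<otimes>\<^bsub>?Q\<^esub> h) = F' g \<otimes> F' h" .
  qed (use g0 gS in \<open>simp add: F'_def del: carrier_product_group mult_product_group\<close>)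
  interpret F': group_hom ?Q G F'
    by (intro group_hom.intro group_hom_axioms.intro F' Q.is_group is_group)
  have embK: "factor_embedding (K # L) 0 x \<in> carrier ?Q" if "x \<in> carrier K" for x
    by (rule factor_embedding_closed) (use that Lgroup Kgroup in auto)
  have embL: "factor_embedding L i x \<in> carrier ?P" if "i < length L" "x \<in> carrier (L ! i)" for i x
    by (rule factor_embedding_closed) (use that Lgroup in auto)
  have F'K: "F' (factor_embedding (K # L) 0 x) = f x" if "x \<in> carrier K" for x
  proof -
    have "tl' (factor_embedding (K # L) 0 x) = \<one>\<^bsub>?P\<^esub>"
      by (auto simp: tl'_def factor_embedding_def)
    then have "F (tl' (factor_embedding (K # L) 0 x)) = \<one>" using F.hom_one by metis
    then show ?thesis using that by (simp add: F'_def factor_embedding_def)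
  qed
  have F'S: "F' (shift K L g) = F g" if "g \<in> carrier ?P" for g
  proof -
    have "tl' (shift K L g) = g"
      using that by (auto simp: tl'_def shift_def PiE_iff extensional_def)
    moreover have "shift K L g 0 = \<one>\<^bsub>K\<^esub>" by (simp add: shift_def)
    ultimately show ?thesis unfolding F'_def
      using that by (simp del: carrier_product_group mult_product_group)
  qed
  have am: "amalgamated_subgroup ((K # L) ! i) - {\<one>\<^bsub>(K # L) ! i\<^esub>} \<noteq> {} \<and>
      (\<forall>x \<in> amalgamated_subgroup ((K # L) ! i) - {\<one>\<^bsub>(K # L) ! i\<^esub>}. F' (factor_embedding (K # L) i x) = c)"
    if "i < length (K # L)" for i
  proof (cases i)
    case 0
    have "f x = c" if "x \<in> amalgamated_subgroup K - {\<one>\<^bsub>K\<^esub>}" for x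
    proof -
      have x: "x \<in> carrier K" using that amalgamated_subgroup_subset[OF Kgroup] by auto
      have "f x \<noteq> \<one>" using inj_on_eq_iff[OF inj x f.G.one_closed] that by simp
      then show ?thesis using that fam by blast
    qed
    moreover have "amalgamated_subgroup K - {\<one>\<^bsub>K\<^esub>} \<noteq> {}"
    proof -
      have "c \<in> f ` amalgamated_subgroup K" by (simp add: fam)
      then obtain x where "x \<in> amalgamated_subgroup K" "f x = c" by (metis imageE)
      then show ?thesis using c_not_one f.hom_one by auto
    qed
    moreover have "F' (factor_embedding (K # L) 0 x) = f x" if "x \<in> amalgamated_subgroup K" for x
      using F'K that amalgamated_subgroup_subset[OF Kgroup] by blast
    ultimately show ?thesis using 0 by simp
  next
    case (Suc j)
    then have j: "j < length L" using that by simp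
    then have "amalgamated_subgroup (L ! j) \<subseteq> carrier (L ! j)"
      using Lgroup by (intro amalgamated_subgroup_subset) simp
    then have "F' (factor_embedding (K # L) i x) = c"
      if "x \<in> amalgamated_subgroup (L ! j) - {\<one>\<^bsub>L ! j\<^esub>}" for x
      using that Fam[OF j that] F'S[OF embL[OF j]] shift_factor_embedding[OF j, of K] Suc by auto
    then show ?thesis using amne[OF j] Suc by simp
  qed
  have shift_gen: "shift K L g \<in> generate ?Q (identifications (K # L))" if "g \<in> carrier ?P" "F g = \<one>" for g
  proof (rule shift_identifications)
    show "g \<in> generate ?P (identifications L)" using that Fker by (auto simp: kernel_def)
  qed (use Lgroup Kgroup amalgamated_subgroup_subset in auto)
  have ker: "g \<in> generate ?Q (identifications (K # L))" if g: "g \<in> carrier ?Q" and F'g: "F' g = \<one>" for g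
  proof -
    have split: "g = factor_embedding (K # L) 0 (g 0) \<otimes>\<^bsub>?Q\<^esub> shift K L (tl' g)"
      using factor_product_Cons[of K L g] g Lgroup Kgroup unfolding tl'_def by auto
    \<comment> \<open>The two values are inverse to each other, so the value of the head lies in
      \<open>A\<close> and in \<open>T\<close> and is \<open>\<one>\<close> or \<open>c\<close>. In
      the first case \<open>g\<close> comes from the tail; in the second an identification reduces
      it to that case.\<close>
    have 1: "f (g 0) \<otimes> F (tl' g) = \<one>" using F'g by (simp add: F'_def)
    have "inv (F (tl' g)) = f (g 0)"
      by (rule inv_equality[OF 1 F.hom_closed[OF gS[OF g]] f.hom_closed[OF g0[OF g]]])
    moreover have "F (tl' g) \<in> T" unfolding FT by (rule UnI1[OF imageI[OF gS[OF g]]])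
    then have "inv (F (tl' g)) \<in> T"
      using central_decomp_subgroup[OF Cons.hyps(2)] by (metis subgroup.m_inv_closed)
    moreover have "f (g 0) \<in> A" using fA g0[OF g] by blast
    ultimately have "f (g 0) \<in> {\<one>, c}" using Cons.hyps(4) by (metis IntI subsetD)
    then consider "f (g 0) = \<one>" | "f (g 0) = c" by blast
    then show ?thesis
    proof cases
      case 1
      then have "g 0 = \<one>\<^bsub>K\<^esub>" using inj_on_eq_iff[OF inj g0[OF g] f.G.one_closed] by simp
      then have "factor_embedding (K # L) 0 (g 0) = \<one>\<^bsub>?Q\<^esub>"
        by (auto simp: factor_embedding_def)
      moreover have "F (tl' g) = \<one>"
        using \<open>f (g 0) \<otimes> F (tl' g) = \<one>\<close> 1 F.hom_closed[OF gS[OF g]] by simp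
      ultimately show ?thesis
        using split shift_gen[OF gS[OF g]] shift.hom_closed[OF gS[OF g]] Q.l_one by metis
    next
      case 2
      have "c \<otimes> F (tl' g) = c \<otimes> c" using 1 2 c_sq by simp
      then have Fc: "F (tl' g) = c"
        by (rule l_cancel[OF _ F.hom_closed[OF gS[OF g]] c_closed c_closed])
      \<comment> \<open>The empty product only takes the value \<open>\<one>\<close>, so a tail of
        value \<open>c\<close> provides a factor with which \<open>K\<close> can be
        identified.\<close>
      have "L \<noteq> []"
      proof
        assume "L = []"
        then have "tl' g = \<one>\<^bsub>?P\<^esub>" by (simp add: tl'_def restrict_def)
        then show False using Fc F.hom_one c_not_one by metis
      qed
      then obtain y where y: "y \<in> amalgamated_subgroup (L ! 0) - {\<one>\<^bsub>L ! 0\<^esub>}" using amne[of 0] by auto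
      have yc: "y \<in> carrier (L ! 0)"
        using y amalgamated_subgroup_subset[of "L ! 0"] Lgroup \<open>L \<noteq> []\<close> by auto
      let ?y = "factor_embedding L 0 y"
      have yP: "?y \<in> carrier ?P" using embL[OF _ yc] \<open>L \<noteq> []\<close> by simp
      have "c \<in> f ` amalgamated_subgroup K" by (simp add: fam)
      then obtain x where x: "x \<in> amalgamated_subgroup K" "f x = c" by (metis imageE)
      have "g 0 = x"
        using inj_on_eq_iff[OF inj g0[OF g], of x] x 2 amalgamated_subgroup_subset[OF Kgroup] by auto
      have xne: "x \<noteq> \<one>\<^bsub>K\<^esub>" using x c_not_one by auto
      \<comment> \<open>Dividing by this identification moves the involution from \<open>K\<close>
        into the first factor of \<open>L\<close>; there it combines with the tail to an element of
        the old kernel.\<close>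
      let ?r = "factor_embedding (K # L) 0 x \<otimes>\<^bsub>?Q\<^esub> inv\<^bsub>?Q\<^esub> (factor_embedding (K # L) 1 y)"
      have "?r \<in> identifications (K # L)"
        unfolding identifications_def using x y xne \<open>L \<noteq> []\<close>
        by (intro CollectI exI[of _ 0] exI[of _ 1] exI[of _ x] exI[of _ y]) auto
      then have r: "?r \<in> generate ?Q (identifications (K # L))" by (rule generate.incl)
      have y1: "factor_embedding (K # L) 1 y = shift K L ?y"
        using shift_factor_embedding[of 0 L K y] \<open>L \<noteq> []\<close> by simp
      have "F (?y \<otimes>\<^bsub>?P\<^esub> tl' g) = \<one>"
        using Fam[OF _ y] Fc c_sq yP gS[OF g] \<open>L \<noteq> []\<close> F.hom_mult by (metis length_greater_0_conv)
      then have s: "shift K L (?y \<otimes>\<^bsub>?P\<^esub> tl' g) \<in> generate ?Q (identifications (K # L))"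
        by (intro shift_gen P.m_closed yP gS[OF g])
      have "g = ?r \<otimes>\<^bsub>?Q\<^esub> shift K L (?y \<otimes>\<^bsub>?P\<^esub> tl' g)"
      proof -
        have "?r \<otimes>\<^bsub>?Q\<^esub> shift K L (?y \<otimes>\<^bsub>?P\<^esub> tl' g) =
          factor_embedding (K # L) 0 x \<otimes>\<^bsub>?Q\<^esub> (inv\<^bsub>?Q\<^esub> (shift K L ?y) \<otimes>\<^bsub>?Q\<^esub> (shift K L ?y \<otimes>\<^bsub>?Q\<^esub> shift K L (tl' g)))"
          unfolding y1 shift.hom_mult[OF yP gS[OF g]]
          using embK x amalgamated_subgroup_subset[OF Kgroup] shift.hom_closed[OF yP] shift.hom_closed[OF gS[OF g]]
          by (intro Q.m_assoc Q.m_closed Q.inv_closed) auto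
        also have "\<dots> = factor_embedding (K # L) 0 x \<otimes>\<^bsub>?Q\<^esub> shift K L (tl' g)"
          using Q.inv_cancel_left(2)[OF shift.hom_closed[OF yP] shift.hom_closed[OF gS[OF g]]] by argo
        finally show ?thesis using split \<open>g 0 = x\<close> by argo
      qed
      then show ?thesis using generate.eng[OF r s] by argo
    qed
  qed
  have "A <#> T = F' ` carrier ?Q \<union> (\<lambda>g. F' g \<otimes> c) ` carrier ?Q"
  proof
    show "F' ` carrier ?Q \<union> (\<lambda>g. F' g \<otimes> c) ` carrier ?Q \<subseteq> A <#> T"
    proof -
      have "F' g \<in> A <#> T" "F' g \<otimes> c \<in> A <#> T" if "g \<in> carrier ?Q" for g
      proof -
        have "f (g 0) \<in> A" using g0[OF that] fA by blast
        moreover have "F (tl' g) \<in> T" "F (tl' g) \<otimes> c \<in> T"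
          unfolding FT by (rule UnI1 UnI2, rule imageI[OF gS[OF that]])+
        moreover have "F' g \<otimes> c = f (g 0) \<otimes> (F (tl' g) \<otimes> c)"
          unfolding F'_def
          by (rule m_assoc[OF f.hom_closed[OF g0[OF that]] F.hom_closed[OF gS[OF that]] c_closed])
        ultimately show "F' g \<in> A <#> T" "F' g \<otimes> c \<in> A <#> T"
          unfolding set_mult_def F'_def by auto
      qed
      then show ?thesis by blast
    qed
    show "A <#> T \<subseteq> F' ` carrier ?Q \<union> (\<lambda>g. F' g \<otimes> c) ` carrier ?Q"
    proof
      fix w assume "w \<in> A <#> T"
      then obtain x g where x: "x \<in> carrier K" and g: "g \<in> carrier ?P"
        and w: "w = f x \<otimes> F g \<or> w = f x \<otimes> (F g \<otimes> c)"
        unfolding set_mult_def fA[symmetric] FT by blast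
      let ?h = "factor_embedding (K # L) 0 x \<otimes>\<^bsub>?Q\<^esub> shift K L g"
      have h: "?h \<in> carrier ?Q" by (intro Q.m_closed embK x shift.hom_closed g)
      have "F' ?h = f x \<otimes> F g"
        using F'.hom_mult[OF embK[OF x] shift.hom_closed[OF g]] F'K[OF x] F'S[OF g] by simp
      moreover have "f x \<otimes> (F g \<otimes> c) = f x \<otimes> F g \<otimes> c"
        by (rule m_assoc[OF f.hom_closed[OF x] F.hom_closed[OF g] c_closed, symmetric])
      ultimately have "w = F' ?h \<or> w = F' ?h \<otimes> c" using w by metis
      then show "w \<in> F' ` carrier ?Q \<union> (\<lambda>g. F' g \<otimes> c) ` carrier ?Q"
        using imageI[OF h, of F'] imageI[OF h, of "\<lambda>g. F' g \<otimes> c"] by blast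
    qed
  qed
  then show ?case
    using F' ker am Lgroup Kgroup by (intro conjI bexI[of _ F']) (auto simp: kernel_def)
qed

text \<open>First isomorphism theorem. Both nontrivial elements in an identification map to
  \<open>c\<close>, so the kernel is no smaller than the amalgamating subgroup. For a nonempty list
  \<open>c\<close> is itself a value of the map, and the additional coset by \<open>c\<close> is
  absorbed.\<close>

theorem central_decomp_iso:
  assumes "central_decomp L T" "L \<noteq> []"
  shows "G\<lparr>carrier := T\<rparr> \<cong> central_product L"
proof -
  let ?P = "factor_product L"
  obtain F where Lgroup: "\<forall>H \<in> set L. group H" and F: "F \<in> hom ?P G"
    and FT: "T = F ` carrier ?P \<union> (\<lambda>g. F g \<otimes> c) ` carrier ?P"
    and Fker: "kernel ?P G F \<subseteq> generate ?P (identifications L)"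
    and amne: "\<And>i. i < length L \<Longrightarrow> amalgamated_subgroup (L ! i) - {\<one>\<^bsub>L ! i\<^esub>} \<noteq> {}"
    and Fam: "\<And>i x. \<lbrakk>i < length L; x \<in> amalgamated_subgroup (L ! i) - {\<one>\<^bsub>L ! i\<^esub>}\<rbrakk>
        \<Longrightarrow> F (factor_embedding L i x) = c"
    using central_decomp_hom[OF assms(1)] by blast
  interpret P: group ?P by (rule group_factor_product) (use Lgroup in auto)
  interpret F: group_hom ?P G F
    by (simp add: group_hom_def group_hom_axioms_def F P.is_group is_group)
  have emb: "factor_embedding L i x \<in> carrier ?P"
    if "i < length L" "x \<in> amalgamated_subgroup (L ! i)" for i x
    by (rule factor_embedding_closed)
      (use that Lgroup amalgamated_subgroup_subset[of "L ! i"] in auto)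
  have "identifications L \<subseteq> kernel ?P G F"
  proof
    fix h assume "h \<in> identifications L"
    then obtain i j x y where h: "h = factor_embedding L i x \<otimes>\<^bsub>?P\<^esub> inv\<^bsub>?P\<^esub> (factor_embedding L j y)"
      and ij: "i < length L" "j < length L"
      and x: "x \<in> amalgamated_subgroup (L ! i) - {\<one>\<^bsub>L ! i\<^esub>}"
      and y: "y \<in> amalgamated_subgroup (L ! j) - {\<one>\<^bsub>L ! j\<^esub>}"
      unfolding identifications_def by blast
    have ex: "factor_embedding L i x \<in> carrier ?P" and ey: "factor_embedding L j y \<in> carrier ?P"
      using emb ij x y by blast+
    have "F h = c \<otimes> inv c"
      unfolding h F.hom_mult[OF ex P.inv_closed[OF ey]] F.hom_inv[OF ey]
      using Fam[OF ij(1) x] Fam[OF ij(2) y] by simp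
    moreover have "h \<in> carrier ?P" unfolding h by (intro P.m_closed P.inv_closed ex ey)
    ultimately show "h \<in> kernel ?P G F" by (simp add: kernel_def)
  qed
  then have ker: "kernel ?P G F = generate ?P (identifications L)"
    using Fker P.generate_subgroup_incl[OF _ F.subgroup_kernel] by blast
  have sub: "subgroup (F ` carrier ?P) G" by (rule F.img_is_subgroup)
  obtain x where x: "x \<in> amalgamated_subgroup (L ! 0) - {\<one>\<^bsub>L ! 0\<^esub>}"
    using amne[of 0] assms(2) by auto
  have "c \<in> F ` carrier ?P"
    using Fam[OF _ x] emb[of 0 x] x assms(2) by (metis DiffD1 image_eqI length_greater_0_conv)
  then have FT': "F ` carrier ?P = T"
    unfolding FT using subgroup.m_closed[OF sub] by blast
  have "F \<in> hom ?P (G\<lparr>carrier := T\<rparr>)"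
    using F FT' by (auto simp: hom_def)
  moreover have "group (G\<lparr>carrier := T\<rparr>)" using sub FT' subgroup_imp_group by auto
  ultimately interpret F': group_hom ?P "G\<lparr>carrier := T\<rparr>" F
    by (simp add: group_hom_def group_hom_axioms_def P.is_group)
  have "?P Mod kernel ?P (G\<lparr>carrier := T\<rparr>) F \<cong> G\<lparr>carrier := T\<rparr>"
    by (rule F'.FactGroup_iso) (use FT' in simp)
  moreover have "kernel ?P (G\<lparr>carrier := T\<rparr>) F = kernel ?P G F" by (simp add: kernel_def)
  ultimately have "central_product L \<cong> G\<lparr>carrier := T\<rparr>"
    unfolding central_product_eq ker by simp
  moreover have "group (central_product L)"
    unfolding central_product_eq using normal.factorgroup_is_group[OF F.normal_kernel] ker by simp
  ultimately show ?thesis by (rule group.iso_sym[rotated])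
qed

end

section \<open>The commutator form\<close>

context class_two
begin

definition commute :: "'a \<Rightarrow> 'a \<Rightarrow> bool" where
  "commute x y \<longleftrightarrow> x \<otimes> y = y \<otimes> x"

lemma commute_sym: "commute x y \<longleftrightarrow> commute y x"
  by (auto simp: commute_def)

lemma commute_refl [simp]: "commute x x"
  by (simp add: commute_def)

lemma commute_one [simp]: "x \<in> carrier G \<Longrightarrow> commute \<one> x" "x \<in> carrier G \<Longrightarrow> commute x \<one>"
  by (simp_all add: commute_def)

lemma not_commuteD:
  "\<lbrakk>x \<in> carrier G; y \<in> carrier G; \<not> commute x y\<rbrakk> \<Longrightarrow> x \<otimes> y = y \<otimes> x \<otimes> c"
  using comm_or unfolding commute_def by blast

lemma commute_if_eq:
  assumes "x \<in> carrier G" "y \<in> carrier G"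
  shows "x \<otimes> y = y \<otimes> x \<otimes> (if commute x y then \<one> else c)"
  using not_commuteD[OF assms] assms by (auto simp: commute_def)

text \<open>Bilinearity of the commutator form: addition modulo two of "does not commute" is
  equivalence of "commutes".\<close>

lemma commute_mult_left:
  assumes "x \<in> carrier G" "y \<in> carrier G" "w \<in> carrier G"
  shows "commute (x \<otimes> y) w \<longleftrightarrow> (commute x w \<longleftrightarrow> commute y w)"
proof -
  define a where "a = (if commute x w then \<one> else c)"
  define b where "b = (if commute y w then \<one> else c)"
  have ab: "a \<in> carrier G" "b \<in> carrier G" by (auto simp: a_def b_def)
  have ay: "a \<otimes> y = y \<otimes> a" using assms c_comm by (simp add: a_def)
  have "x \<otimes> y \<otimes> w = x \<otimes> (w \<otimes> y \<otimes> b)"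
    using commute_if_eq[of y w] assms by (simp add: b_def m_assoc)
  also have "\<dots> = (x \<otimes> w) \<otimes> (y \<otimes> b)" using assms ab by (simp add: m_assoc)
  also have "x \<otimes> w = w \<otimes> x \<otimes> a"
    using commute_if_eq[of x w] assms by (simp add: a_def)
  also have "w \<otimes> x \<otimes> a \<otimes> (y \<otimes> b) = w \<otimes> x \<otimes> (a \<otimes> y) \<otimes> b" using assms ab by (simp add: m_assoc)
  also have "\<dots> = w \<otimes> (x \<otimes> y) \<otimes> (a \<otimes> b)" unfolding ay using assms ab by (simp add: m_assoc)
  finally have "commute (x \<otimes> y) w \<longleftrightarrow> w \<otimes> (x \<otimes> y) \<otimes> (a \<otimes> b) = w \<otimes> (x \<otimes> y)"
    by (simp add: commute_def)
  also have "\<dots> \<longleftrightarrow> a \<otimes> b = \<one>"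
    using assms ab by (metis m_closed l_cancel_one')
  also have "\<dots> \<longleftrightarrow> (commute x w \<longleftrightarrow> commute y w)"
    using c_not_one by (simp add: a_def b_def c_sq)
  finally show ?thesis .
qed

lemma commute_mult_right:
  assumes "x \<in> carrier G" "y \<in> carrier G" "w \<in> carrier G"
  shows "commute w (x \<otimes> y) \<longleftrightarrow> (commute w x \<longleftrightarrow> commute w y)"
  using commute_mult_left[OF assms] by (simp add: commute_sym)

lemma commute_inv_left:
  assumes "x \<in> carrier G" "w \<in> carrier G"
  shows "commute (inv x) w \<longleftrightarrow> commute x w"
  using commute_mult_left[of "inv x" x w] assms by simp

text \<open>Squaring behaves as a quadratic form whose polarization is the commutator form; all
  later computations with exponents of squares rest on this.\<close>

lemma square_mult:
  assumes "x \<in> carrier G" "y \<in> carrier G"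
  shows "(x \<otimes> y) \<otimes> (x \<otimes> y) = (x \<otimes> x) \<otimes> (y \<otimes> y) \<otimes> (if commute x y then \<one> else c)"
proof -
  define a where "a = (if commute y x then \<one> else c)"
  have a: "a \<in> carrier G" by (simp add: a_def)
  have ay: "a \<otimes> y = y \<otimes> a" using assms c_comm by (simp add: a_def)
  have "(x \<otimes> y) \<otimes> (x \<otimes> y) = x \<otimes> (y \<otimes> x) \<otimes> y" using assms by (simp add: m_assoc)
  also have "\<dots> = x \<otimes> (x \<otimes> y \<otimes> a) \<otimes> y"
    using commute_if_eq[of y x] assms by (simp add: a_def)
  also have "\<dots> = x \<otimes> (x \<otimes> (y \<otimes> (a \<otimes> y)))" using assms a by (simp add: m_assoc)
  also have "\<dots> = (x \<otimes> x) \<otimes> (y \<otimes> y) \<otimes> a" unfolding ay using assms a by (simp add: m_assoc)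
  finally show ?thesis by (simp add: a_def commute_sym)
qed

section \<open>The centre as radical, nondegenerate subgroups and orthogonal complements\<close>

lemma in_center_iff: "z \<in> center G \<longleftrightarrow> z \<in> carrier G \<and> (\<forall>y \<in> carrier G. commute z y)"
  by (simp add: center_def commute_def)

lemma subgroup_center: "subgroup (center G) G"
proof (rule subgroupI)
  have "\<one> \<in> center G" by (simp add: in_center_iff)
  then show "center G \<noteq> {}" by blast
qed (auto simp: in_center_iff commute_mult_left commute_inv_left)

lemma center_closed: "z \<in> center G \<Longrightarrow> z \<in> carrier G"
  by (simp add: in_center_iff)

lemma commute_center: "\<lbrakk>z \<in> center G; y \<in> carrier G\<rbrakk> \<Longrightarrow> commute z y \<and> commute y z"
  using commute_sym in_center_iff by blast

lemma c_in_center: "c \<in> center G"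
  by (simp add: center_def c_comm)

text \<open>By bilinearity the form takes twice the same value on a square, hence zero.\<close>

lemma square_in_center: "x \<in> carrier G \<Longrightarrow> x \<otimes> x \<in> center G"
  by (simp add: in_center_iff commute_mult_left)

lemma square_mult_center:
  assumes "x \<in> carrier G" "z \<in> center G"
  shows "(x \<otimes> z) \<otimes> (x \<otimes> z) = (x \<otimes> x) \<otimes> (z \<otimes> z)"
  using square_mult[of x z] assms commute_center center_closed by simp

lemma commute_mult_center:
  assumes "x \<in> carrier G" "w \<in> carrier G" "z \<in> center G"
  shows "commute (x \<otimes> z) w \<longleftrightarrow> commute x w" "commute w (x \<otimes> z) \<longleftrightarrow> commute w x"
  using assms commute_center[OF assms(3,2)] center_closed
  by (simp_all add: commute_mult_left commute_mult_right)

text \<open>Such an \<open>H\<close> is the preimage of a subspace of \<open>G / center G\<close> on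
  which the commutator form is nondegenerate. The radical is compared with the centre of all of
  \<open>G\<close>, so the notion survives passage to centralizers of pairs.\<close>

definition nondegenerate :: "'a set \<Rightarrow> bool" where
  "nondegenerate H \<longleftrightarrow> subgroup H G \<and> center G \<subseteq> H \<and>
     (\<forall>x \<in> H. (\<forall>y \<in> H. commute x y) \<longrightarrow> x \<in> center G)"

text \<open>For a noncommuting pair this is the orthogonal complement of their plane in
  \<open>H\<close>.\<close>

definition pair_centralizer :: "'a set \<Rightarrow> 'a \<Rightarrow> 'a \<Rightarrow> 'a set" where
  "pair_centralizer H x y = {w \<in> H. commute w x \<and> commute w y}"

lemma nondegenerate_carrier: "nondegenerate (carrier G)"
  using subgroup_self by (auto simp: nondegenerate_def in_center_iff)

context
  fixes H
  assumes H: "nondegenerate H"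
begin

lemma nondegenerate_closed: "x \<in> H \<Longrightarrow> x \<in> carrier G"
  using H subgroup.mem_carrier unfolding nondegenerate_def by metis

lemma nondegenerate_subgroup: "subgroup H G"
  using H unfolding nondegenerate_def by simp

lemma nondegenerate_center: "z \<in> center G \<Longrightarrow> z \<in> H"
  using H unfolding nondegenerate_def by blast

lemma nondegenerate_partner: "\<lbrakk>x \<in> H; x \<notin> center G\<rbrakk> \<Longrightarrow> \<exists>y \<in> H. \<not> commute x y"
  using H unfolding nondegenerate_def by blast

lemma nondegenerate_mult: "\<lbrakk>x \<in> H; y \<in> H\<rbrakk> \<Longrightarrow> x \<otimes> y \<in> H"
  using nondegenerate_subgroup by (simp add: subgroup.m_closed)

text \<open>Orthogonal projection to the plane of \<open>x\<close> and \<open>y\<close>. Failure to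
  commute with \<open>x\<close> is repaired by a factor \<open>y\<close> and vice versa, so
  \<open>a\<close> has the same form values as \<open>h\<close> on both.\<close>

lemma pair_centralizer_split:
  assumes xy: "x \<in> H" "y \<in> H" "\<not> commute x y" and h: "h \<in> H"
  shows "\<exists>a \<in> {\<one>, x, y, x \<otimes> y}. \<exists>w \<in> pair_centralizer H x y. h = a \<otimes> w"
proof -
  note cl = nondegenerate_closed
  have yx: "\<not> commute y x" using xy(3) commute_sym by blast
  define a where "a = (if commute h x then (if commute h y then \<one> else x)
    else (if commute h y then y else x \<otimes> y))"
  have a: "a \<in> {\<one>, x, y, x \<otimes> y}" by (auto simp: a_def)
  then have aH: "a \<in> H"
    using xy nondegenerate_mult subgroup.one_closed[OF nondegenerate_subgroup] by auto
  have ax: "commute a x \<longleftrightarrow> commute h x" and ay: "commute a y \<longleftrightarrow> commute h y"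
    using xy yx cl by (auto simp: a_def commute_mult_left)
  have "inv a \<otimes> h \<in> H"
    using aH h nondegenerate_mult subgroup.m_inv_closed[OF nondegenerate_subgroup] by blast
  moreover have "commute (inv a \<otimes> h) x" "commute (inv a \<otimes> h) y"
    using ax ay aH h xy cl by (simp_all add: commute_mult_left commute_inv_left)
  moreover have "h = a \<otimes> (inv a \<otimes> h)"
    using aH h cl by simp
  ultimately show ?thesis using a unfolding pair_centralizer_def by blast
qed

text \<open>An element of the complement orthogonal to the whole complement is also orthogonal to
  \<open>x\<close> and \<open>y\<close>, and by the splitting to all of \<open>H\<close>.\<close>

lemma nondegenerate_pair_centralizer:
  assumes xy: "x \<in> H" "y \<in> H" "\<not> commute x y"
  shows "nondegenerate (pair_centralizer H x y)"
  unfolding nondegenerate_def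
proof (intro conjI ballI impI)
  note cl = nondegenerate_closed
  show "subgroup (pair_centralizer H x y) G"
    unfolding pair_centralizer_def
    by (rule subgroupI) (use xy cl nondegenerate_mult subgroup.one_closed[OF nondegenerate_subgroup]
        subgroup.m_inv_closed[OF nondegenerate_subgroup] in
        \<open>auto simp: commute_mult_left commute_inv_left intro!: exI[of _ \<one>]\<close>)
  show "center G \<subseteq> pair_centralizer H x y"
    using nondegenerate_center commute_center xy cl by (auto simp: pair_centralizer_def)
  fix w assume w: "w \<in> pair_centralizer H x y" and comm: "\<forall>v \<in> pair_centralizer H x y. commute w v"
  have wH: "w \<in> H" "commute w x" "commute w y" using w by (auto simp: pair_centralizer_def)
  have "commute w h" if h: "h \<in> H" for h
  proof -
    obtain a v where a: "a \<in> {\<one>, x, y, x \<otimes> y}" and v: "v \<in> pair_centralizer H x y" "h = a \<otimes> v"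
      using pair_centralizer_split[OF xy h] by blast
    have "commute w a" using a wH xy cl by (auto simp: commute_mult_right)
    moreover have "v \<in> carrier G" "a \<in> carrier G"
      using v a xy cl by (auto simp: pair_centralizer_def)
    ultimately show ?thesis using v comm wH cl by (simp add: commute_mult_right)
  qed
  then show "w \<in> center G" using H wH(1) unfolding nondegenerate_def by blast
qed

lemma pair_centralizer_psubset:
  assumes "x \<in> H" "y \<in> H" "\<not> commute x y"
  shows "pair_centralizer H x y \<subset> H"
  using assms commute_refl by (auto simp: pair_centralizer_def)

end

text \<open>Riesz representation for a nondegenerate form: an additive function modulo the centre is
  pairing with some element. The induction splits off one plane at a time and corrects the
  representative of the complement on that plane.\<close>

lemma character_representation:
  assumes "finite H" "nondegenerate H"
    and "\<And>a b. \<lbrakk>a \<in> H; b \<in> H\<rbrakk> \<Longrightarrow> \<chi> (a \<otimes> b) \<longleftrightarrow> \<chi> a \<noteq> \<chi> b"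
    and "\<And>z. z \<in> center G \<Longrightarrow> \<not> \<chi> z"
  shows "\<exists>u \<in> H. \<forall>w \<in> H. \<chi> w \<longleftrightarrow> \<not> commute u w"
  using assms
proof (induction H rule: finite_psubset_induct)
  case (psubset H)
  note H = psubset.prems(1)
  note cl = nondegenerate_closed[OF H]
  show ?case
  proof (cases "H \<subseteq> center G")
    case True
    then show ?thesis
      using psubset.prems(3) subgroup.one_closed[OF nondegenerate_subgroup[OF H]] cl
      by (intro bexI[of _ \<one>]) auto
  next
    case False
    then obtain x y where xy: "x \<in> H" "y \<in> H" "\<not> commute x y"
      using nondegenerate_partner[OF H] by blast
    let ?C = "pair_centralizer H x y"
    have CH: "v \<in> ?C \<Longrightarrow> v \<in> H" for v by (simp add: pair_centralizer_def)
    have "\<exists>u \<in> ?C. \<forall>w \<in> ?C. \<chi> w \<longleftrightarrow> \<not> commute u w"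
      by (rule psubset.IH[OF pair_centralizer_psubset[OF H xy] nondegenerate_pair_centralizer[OF H xy]])
        (use CH psubset.prems(2,3) in auto)
    then obtain u where u: "u \<in> ?C" and uw: "\<And>w. w \<in> ?C \<Longrightarrow> \<chi> w \<longleftrightarrow> \<not> commute u w" by blast
    \<comment> \<open>Dual basis of the plane: \<open>y\<close> is detected by \<open>x\<close>
      alone and \<open>x\<close> by \<open>y\<close> alone, so the value at \<open>x\<close> decides
      about the factor \<open>y\<close> and conversely.\<close>
    define p where "p = (if \<chi> x then y else \<one>)"
    define q where "q = (if \<chi> y then x else \<one>)"
    have pq: "p \<in> H" "q \<in> H"
      using xy subgroup.one_closed[OF nondegenerate_subgroup[OF H]] by (auto simp: p_def q_def)
    have ux: "commute u x" "commute u y" and uH: "u \<in> H" using u by (auto simp: pair_centralizer_def)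
    have yx: "\<not> commute y x" using xy(3) commute_sym by blast
    define v where "v = u \<otimes> (p \<otimes> q)"
    have v: "v \<in> H" unfolding v_def by (intro nondegenerate_mult[OF H] uH pq)
    have vx: "\<chi> x \<longleftrightarrow> \<not> commute v x" and vy: "\<chi> y \<longleftrightarrow> \<not> commute v y"
      unfolding v_def using uH pq xy cl ux yx
      by (simp_all add: commute_mult_left) (auto simp: p_def q_def)
    have vw: "\<chi> w \<longleftrightarrow> \<not> commute v w" if "w \<in> ?C" for w
    proof -
      have "commute p w" "commute q w"
        using that xy cl by (auto simp: p_def q_def pair_centralizer_def commute_sym)
      then show ?thesis
        unfolding v_def using uw[OF that] CH[OF that] uH pq cl by (simp add: commute_mult_left)
    qed
    have one: "\<not> \<chi> \<one>" using psubset.prems(3) subgroup.one_closed[OF subgroup_center] by blast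
    have "\<chi> h \<longleftrightarrow> \<not> commute v h" if h: "h \<in> H" for h
    proof -
      obtain a w where a: "a \<in> {\<one>, x, y, x \<otimes> y}" and w: "w \<in> ?C" "h = a \<otimes> w"
        using pair_centralizer_split[OF H xy h] by blast
      have aH: "a \<in> H"
        using a xy nondegenerate_mult[OF H] subgroup.one_closed[OF nondegenerate_subgroup[OF H]] by auto
      have "\<chi> a \<longleftrightarrow> \<not> commute v a"
        using a one vx vy xy v cl psubset.prems(2)[of x y] by (auto simp: commute_mult_right)
      then show ?thesis
        using psubset.prems(2)[OF aH CH[OF w(1)]] vw[OF w(1)] w aH CH[OF w(1)] v cl
        by (auto simp: commute_mult_right)
    qed
    then show ?thesis using v by blast
  qed
qed

section \<open>Subgroups whose squares reduce to the values one and \<open>c\<close>\<close>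

definition flat :: "'a set \<Rightarrow> bool" where
  "flat H \<longleftrightarrow> (\<forall>x \<in> H. \<exists>z \<in> center G. (x \<otimes> z) \<otimes> (x \<otimes> z) \<in> {\<one>, c})"

text \<open>With \<open>x \<otimes> x = c\<close> and \<open>y \<otimes> y = \<one>\<close> the
  product has square one as well: the values of a hyperbolic plane over the field with two elements.
  A \<open>Q8\<close> pair has square \<open>c\<close> on all three elements, which is the
  anisotropic plane.\<close>

inductive hyperbolic :: "'a set \<Rightarrow> bool" where
  center: "hyperbolic (center G)"
| pair: "\<lbrakk>nondegenerate H; x \<in> H; y \<in> H; \<not> commute x y; x \<otimes> x = c; y \<otimes> y = \<one>;
    hyperbolic (pair_centralizer H x y)\<rbrakk> \<Longrightarrow> hyperbolic H"

lemma flat_representative: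
  assumes H: "nondegenerate H" and flat: "flat H" and x: "x \<in> H"
  obtains z where "z \<in> center G" "x \<otimes> z \<in> H" "(x \<otimes> z) \<otimes> (x \<otimes> z) \<in> {\<one>, c}"
  using flat x nondegenerate_mult[OF H x] nondegenerate_center[OF H] unfolding flat_def by blast

text \<open>The involution plays the part of \<open>y\<close>. A noncommuting partner of square
  \<open>c\<close> is taken as it is; one of square \<open>\<one>\<close> is multiplied by
  \<open>v\<close>, and the polarization term makes the square \<open>c\<close>.\<close>

lemma D8_pair:
  assumes H: "nondegenerate H" and flat: "flat H" and v: "v \<in> H" "v \<notin> center G" "v \<otimes> v = \<one>"
  obtains x y where "x \<in> H" "y \<in> H" "\<not> commute x y" "x \<otimes> x = c" "y \<otimes> y = \<one>"
proof -
  note cl = nondegenerate_closed[OF H]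
  obtain t where t: "t \<in> H" "\<not> commute v t" using nondegenerate_partner[OF H v(1,2)] by blast
  obtain z where z: "z \<in> center G" "t \<otimes> z \<in> H" "(t \<otimes> z) \<otimes> (t \<otimes> z) \<in> {\<one>, c}"
    using flat_representative[OF H flat t(1)] .
  define s where "s = t \<otimes> z"
  have s: "s \<in> H" "\<not> commute v s" "\<not> commute s v" and ss: "s \<otimes> s \<in> {\<one>, c}"
    using z t v cl by (auto simp: s_def commute_mult_center commute_sym)
  show thesis
  proof (cases "s \<otimes> s = c")
    case True
    then show ?thesis using that[of s v] s v by blast
  next
    case False
    then have "s \<otimes> s = \<one>" using ss by blast
    then have "(v \<otimes> s) \<otimes> (v \<otimes> s) = c"
      using square_mult[of v s] v s cl by simp
    moreover have "\<not> commute (v \<otimes> s) v" using v s cl by (simp add: commute_mult_left)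
    ultimately show ?thesis using that[of "v \<otimes> s" v] v s nondegenerate_mult[OF H] by blast
  qed
qed

lemma flat_cases:
  assumes "finite H" "nondegenerate H" "flat H"
  shows "hyperbolic H \<or> (\<exists>x \<in> H. \<exists>y \<in> H. \<not> commute x y \<and> x \<otimes> x = c \<and> y \<otimes> y = c \<and>
    hyperbolic (pair_centralizer H x y))"
  using assms
proof (induction H rule: finite_psubset_induct)
  case (psubset H)
  note H = psubset.prems(1) and flat = psubset.prems(2)
  note cl = nondegenerate_closed[OF H]
  show ?case
  proof (cases "\<exists>v \<in> H. v \<notin> center G \<and> v \<otimes> v = \<one>")
    case True
    then obtain x y where xy: "x \<in> H" "y \<in> H" "\<not> commute x y" and sq: "x \<otimes> x = c" "y \<otimes> y = \<one>"
      using D8_pair[OF H flat] by metis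
    let ?C = "pair_centralizer H x y"
    have "flat ?C" using flat by (auto simp: flat_def pair_centralizer_def)
    then consider "hyperbolic ?C"
      | u v where "u \<in> ?C" "v \<in> ?C" "\<not> commute u v" "u \<otimes> u = c" "v \<otimes> v = c"
        "hyperbolic (pair_centralizer ?C u v)"
      using psubset.IH[OF pair_centralizer_psubset[OF H xy] nondegenerate_pair_centralizer[OF H xy]] by blast
    then show ?thesis
    proof cases
      case 1
      then show ?thesis using hyperbolic.pair[OF H xy sq] by blast
    next
      case (2 u v)
      have uv: "u \<in> H" "v \<in> H" using 2 by (auto simp: pair_centralizer_def)
      \<comment> \<open>The two pairs commute with each other, so their order can be exchanged: the
        \<open>Q8\<close> pair found inside is split off from \<open>H\<close> first, and the
        \<open>D8\<close> pair joins the hyperbolic remainder.\<close>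
      have "pair_centralizer ?C u v = pair_centralizer (pair_centralizer H u v) x y"
        by (auto simp: pair_centralizer_def)
      moreover have "x \<in> pair_centralizer H u v" "y \<in> pair_centralizer H u v"
        using 2 xy commute_sym by (auto simp: pair_centralizer_def)
      ultimately have "hyperbolic (pair_centralizer H u v)"
        using hyperbolic.pair[OF nondegenerate_pair_centralizer[OF H uv 2(3)] _ _ xy(3) sq] 2(6) by simp
      then show ?thesis using uv 2 by blast
    qed
  next
    case False
    show ?thesis
    proof (cases "H \<subseteq> center G")
      case True
      then have "H = center G" using nondegenerate_center[OF H] by blast
      then show ?thesis using hyperbolic.center by simp
    next
      case nc: False
      \<comment> \<open>The representative given by flatness is noncentral together with
        \<open>x\<close>; as no noncentral involution exists here, its square must be
        \<open>c\<close>.\<close>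
      have ex: "\<exists>z \<in> center G. (x \<otimes> z) \<otimes> (x \<otimes> z) = c" if x: "x \<in> H" "x \<notin> center G" for x
      proof -
        obtain z where z: "z \<in> center G" "x \<otimes> z \<in> H" "(x \<otimes> z) \<otimes> (x \<otimes> z) \<in> {\<one>, c}"
          using flat_representative[OF H flat x(1)] .
        obtain t where t: "t \<in> H" "\<not> commute x t" using nondegenerate_partner[OF H x] by blast
        have "\<not> commute (x \<otimes> z) t" using t z x cl by (simp add: commute_mult_center)
        then have "x \<otimes> z \<notin> center G" using commute_center t cl by blast
        then show ?thesis using False z by blast
      qed
      obtain x' y' where xy': "x' \<in> H" "y' \<in> H" "\<not> commute x' y'"
        using nondegenerate_partner[OF H] nc by blast
      then have "x' \<notin> center G" "y' \<notin> center G" using commute_center cl by blast+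
      then obtain z w where z: "z \<in> center G" "w \<in> center G"
        and sq': "(x' \<otimes> z) \<otimes> (x' \<otimes> z) = c" "(y' \<otimes> w) \<otimes> (y' \<otimes> w) = c"
        using ex xy' by metis
      define x where "x = x' \<otimes> z"
      define y where "y = y' \<otimes> w"
      have xy: "x \<in> H" "y \<in> H" "\<not> commute x y"
        using xy' z cl nondegenerate_mult[OF H] nondegenerate_center[OF H]
        by (auto simp: x_def y_def commute_mult_center center_closed)
      have sq: "x \<otimes> x = c" "y \<otimes> y = c" using sq' by (auto simp: x_def y_def)
      let ?C = "pair_centralizer H x y"
      have "?C \<subseteq> center G"
      proof (rule ccontr)
        assume "\<not> ?C \<subseteq> center G"
        then obtain v' where v': "v' \<in> ?C" "v' \<notin> center G" by blast
        then obtain t where t: "t \<in> center G" "(v' \<otimes> t) \<otimes> (v' \<otimes> t) = c"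
          using ex by (auto simp: pair_centralizer_def)
        define v where "v = v' \<otimes> t"
        have v: "v \<in> H" "commute v x" "commute v y" "v \<otimes> v = c"
          using v' t xy cl nondegenerate_mult[OF H] nondegenerate_center[OF H]
          by (auto simp: v_def commute_mult_center pair_centralizer_def)
        have "(v \<otimes> x) \<otimes> (v \<otimes> x) = \<one>"
          using square_mult[of v x] v xy cl sq c_sq by simp
        moreover have "\<not> commute (v \<otimes> x) y" using v xy cl by (simp add: commute_mult_left)
        then have "v \<otimes> x \<notin> center G" using commute_center xy cl by blast
        ultimately show False using False nondegenerate_mult[OF H v(1) xy(1)] by blast
      qed
      then have "?C = center G"
        using nondegenerate_center[OF nondegenerate_pair_centralizer[OF H xy]] by blast
      then show ?thesis using xy sq hyperbolic.center by metis
    qed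
  qed
qed

text \<open>Commuting with both generators forces even exponents, and what is left is a product of
  central elements. This describes the part of the centre that a factor absorbs.\<close>

lemma span_inter_center:
  assumes xy: "x \<in> carrier G" "y \<in> carrier G" "\<not> commute x y"
    and g: "g \<in> span x y" "commute g x" "commute g y"
  shows "g \<in> center G \<and>
    (\<exists>(i::int) (j::int) (e::int). g = (x \<otimes> x) [^] i \<otimes> (y \<otimes> y) [^] j \<otimes> c [^] e)"
proof -
  have xyc: "x \<otimes> y = y \<otimes> x \<otimes> c" using not_commuteD[OF xy] .
  obtain i j e :: int where ge: "g = x [^] i \<otimes> y [^] j \<otimes> c [^] e"
    using g(1) by (auto simp: span_def)
  have gc: "g \<in> carrier G" using ge xy by simp
  have "g \<otimes> x = g \<otimes> x \<otimes> c [^] j"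
    using span_commute_left[OF xy(1,2) xyc, of i j e] g(2) by (simp add: commute_def flip: ge)
  then have "c [^] j = \<one>" using gc xy by (metis m_closed c_closed int_pow_closed l_cancel_one')
  moreover have "y \<otimes> g = y \<otimes> g \<otimes> c [^] i"
    using span_commute_right[OF xy(1,2) xyc, of i j e] g(3) by (simp add: commute_def flip: ge)
  then have "c [^] i = \<one>" using gc xy by (metis m_closed c_closed int_pow_closed l_cancel_one')
  ultimately obtain k l where "i = 2 * k" "j = 2 * l"
    by (auto simp: c_int_pow_eq_one_iff elim!: evenE)
  then have eq: "g = (x \<otimes> x) [^] k \<otimes> (y \<otimes> y) [^] l \<otimes> c [^] e"
    using ge xy by (simp add: int_pow_double)
  have "p [^] (k::int) \<in> center G" if "p \<in> center G" for p k
    by (rule subgroup_int_pow_closed[OF subgroup_center that])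
  then have "g \<in> center G"
    unfolding eq using square_in_center xy c_in_center by (intro subgroup.m_closed[OF subgroup_center]) auto
  then show ?thesis using eq by blast
qed

lemma span_commute:
  assumes "x \<in> carrier G" "y \<in> carrier G" "\<not> commute x y" "t \<in> carrier G" "commute t x" "commute t y"
    and "a \<in> span x y"
  shows "commute t a"
proof -
  have p: "commute t (p [^] (i::int))" if "p \<in> carrier G" "commute t p" for p i
  proof -
    have "p [^] i \<in> generate G {p}" using generate_pow[OF that(1)] by blast
    then have "t \<otimes> p [^] i = p [^] i \<otimes> t"
      using generate_commute[of "{p}" t] that assms(4) by (auto simp: commute_def)
    then show ?thesis by (simp add: commute_def)
  qed
  have "commute t c" using c_comm[OF assms(4)] by (simp add: commute_def)
  then show ?thesis using assms p by (auto simp: span_def commute_mult_right)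
qed

text \<open>One step of the assembly: a factor is placed in front of a decomposition of the
  centralizer of its generators. The central parts multiply because, for
  \<open>a \<otimes> t\<close> central, \<open>a\<close> commutes with \<open>x\<close> and
  \<open>y\<close>; it is then central by the preceding description, and so is
  \<open>t\<close>.\<close>

lemma central_decomp_span:
  assumes H: "nondegenerate H" and xy: "x \<in> H" "y \<in> H" "\<not> commute x y"
    and K: "central_factor K (span x y)" and L: "central_decomp L T"
    and TC: "T \<subseteq> pair_centralizer H x y" and CT: "pair_centralizer H x y \<subseteq> T <#> center G"
    and int: "span x y \<inter> center G \<inter> T \<subseteq> {\<one>, c}"
  shows "central_decomp (K # L) (span x y <#> T)"
    and "span x y <#> T \<subseteq> H" and "H \<subseteq> (span x y <#> T) <#> center G"
    and "(span x y <#> T) \<inter> center G = (span x y \<inter> center G) <#> (T \<inter> center G)"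
proof -
  note cl = nondegenerate_closed[OF H]
  have xc: "x \<in> carrier G" and yc: "y \<in> carrier G" using xy cl by auto
  have A: "subgroup (span x y) G" and T: "subgroup T G"
    using central_factor_subgroup(1)[OF K] central_decomp_subgroup[OF L] by auto
  have Tc: "t \<in> carrier G" "commute t x" "commute t y" "t \<in> H" if "t \<in> T" for t
    using that TC cl by (auto simp: pair_centralizer_def)
  have Ac: "a \<in> carrier G" if "a \<in> span x y" for a using subgroup.mem_carrier[OF A that] .
  show "central_decomp (K # L) (span x y <#> T)"
  proof (rule central_decomp.Cons[OF K L])
    fix a t assume "a \<in> span x y" "t \<in> T"
    then show "a \<otimes> t = t \<otimes> a"
      using span_commute[OF xc yc xy(3), of t a] Tc[of t] by (simp add: commute_def)
  next
    show "span x y \<inter> T \<subseteq> {\<one>, c}"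
      using int span_inter_center[OF xc yc xy(3)] Tc by blast
  qed
  have "span x y \<subseteq> H"
  proof
    fix a assume "a \<in> span x y"
    then obtain i j e :: int where a: "a = x [^] i \<otimes> y [^] j \<otimes> c [^] e"
      by (auto simp: span_def)
    have "p [^] (k::int) \<in> H" if "p \<in> H" for p k
      by (rule subgroup_int_pow_closed[OF nondegenerate_subgroup[OF H] that])
    then show "a \<in> H"
      unfolding a by (intro nondegenerate_mult[OF H]) (use xy nondegenerate_center[OF H c_in_center] in auto)
  qed
  then show "span x y <#> T \<subseteq> H"
    using Tc nondegenerate_mult[OF H] unfolding set_mult_def by blast
  show "H \<subseteq> (span x y <#> T) <#> center G"
  proof
    fix h assume "h \<in> H"
    then obtain a w where a: "a \<in> {\<one>, x, y, x \<otimes> y}" and w: "w \<in> pair_centralizer H x y" "h = a \<otimes> w"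
      using pair_centralizer_split[OF H xy] by blast
    have aA: "a \<in> span x y"
      using a generators_in_span[OF xc yc] subgroup.m_closed[OF A] by blast
    obtain t z where t: "t \<in> T" "z \<in> center G" "w = t \<otimes> z"
      using CT w(1) unfolding set_mult_def by blast
    have "h = (a \<otimes> t) \<otimes> z"
      using w t Ac[OF aA] Tc[OF t(1)] center_closed[OF t(2)] by (simp add: m_assoc)
    then show "h \<in> (span x y <#> T) <#> center G"
      unfolding set_mult_def using aA t by blast
  qed
  show "(span x y <#> T) \<inter> center G = (span x y \<inter> center G) <#> (T \<inter> center G)"
  proof
    show "(span x y <#> T) \<inter> center G \<subseteq> (span x y \<inter> center G) <#> (T \<inter> center G)"
    proof
      fix g assume g: "g \<in> (span x y <#> T) \<inter> center G"
      then obtain a t where at: "a \<in> span x y" "t \<in> T" "g = a \<otimes> t" unfolding set_mult_def by blast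
      have gx: "commute g x" "commute g y" using g commute_center xc yc by blast+
      then have "commute a x" "commute a y"
        using at Tc[OF at(2)] Ac[OF at(1)] xc yc by (simp_all add: commute_mult_left)
      then have az: "a \<in> center G" using span_inter_center[OF xc yc xy(3) at(1)] by blast
      have "t = inv a \<otimes> g" using at Ac[OF at(1)] Tc[OF at(2)] by simp
      then have "t \<in> center G"
        using az g subgroup.m_closed[OF subgroup_center] subgroup.m_inv_closed[OF subgroup_center] by blast
      then show "g \<in> (span x y \<inter> center G) <#> (T \<inter> center G)"
        unfolding set_mult_def using at az by blast
    qed
    show "(span x y \<inter> center G) <#> (T \<inter> center G) \<subseteq> (span x y <#> T) \<inter> center G"
      unfolding set_mult_def using subgroup.m_closed[OF subgroup_center] by blast
  qed
qed

end

section \<open>Direct products and recognition\<close>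

lemma (in group) internal_product_iso:
  assumes A: "subgroup A G" and D: "subgroup D G"
    and comm: "\<And>a d. \<lbrakk>a \<in> A; d \<in> D\<rbrakk> \<Longrightarrow> a \<otimes> d = d \<otimes> a" and int: "A \<inter> D \<subseteq> {\<one>}"
  shows "G\<lparr>carrier := A\<rparr> \<times>\<times> G\<lparr>carrier := D\<rparr> \<cong> G\<lparr>carrier := A <#> D\<rparr>"
proof -
  have cl: "a \<in> carrier G" if "a \<in> A" for a using subgroup.mem_carrier[OF A that] .
  have cl': "d \<in> carrier G" if "d \<in> D" for d using subgroup.mem_carrier[OF D that] .
  let ?f = "\<lambda>(a, d). a \<otimes> d"
  have "?f \<in> hom (G\<lparr>carrier := A\<rparr> \<times>\<times> G\<lparr>carrier := D\<rparr>) (G\<lparr>carrier := A <#> D\<rparr>)"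
  proof (rule homI)
    fix p q assume "p \<in> carrier (G\<lparr>carrier := A\<rparr> \<times>\<times> G\<lparr>carrier := D\<rparr>)"
      "q \<in> carrier (G\<lparr>carrier := A\<rparr> \<times>\<times> G\<lparr>carrier := D\<rparr>)"
    then obtain a d b e where pq: "p = (a, d)" "q = (b, e)" "a \<in> A" "b \<in> A" "d \<in> D" "e \<in> D" by auto
    have "a \<otimes> b \<otimes> (d \<otimes> e) = a \<otimes> (b \<otimes> d) \<otimes> e" using pq cl cl' by (simp add: m_assoc)
    also have "\<dots> = a \<otimes> d \<otimes> (b \<otimes> e)"
      unfolding comm[OF pq(4,5)] using pq cl cl' by (simp add: m_assoc)
    finally show "?f (p \<otimes>\<^bsub>G\<lparr>carrier := A\<rparr> \<times>\<times> G\<lparr>carrier := D\<rparr>\<^esub> q) =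
        ?f p \<otimes>\<^bsub>G\<lparr>carrier := A <#> D\<rparr>\<^esub> ?f q" using pq by simp
  qed (auto simp: set_mult_def)
  moreover have "inj_on ?f (A \<times> D)"
  proof (rule inj_onI, clarify)
    fix a d b e assume ad: "a \<in> A" "d \<in> D" "b \<in> A" "e \<in> D" and eq: "a \<otimes> d = b \<otimes> e"
    have "inv b \<otimes> a = inv b \<otimes> (a \<otimes> d) \<otimes> inv d"
      using ad cl cl' by (simp add: m_assoc)
    also have "\<dots> = e \<otimes> inv d" unfolding eq using ad cl cl' by (simp add: m_assoc)
    finally have "inv b \<otimes> a = e \<otimes> inv d" .
    moreover have "inv b \<otimes> a \<in> A" "e \<otimes> inv d \<in> D"
      using ad A D by (simp_all add: subgroup.m_closed subgroup.m_inv_closed)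
    ultimately have "inv b \<otimes> a = \<one>" "e \<otimes> inv d = \<one>" using int by auto
    then show "a = b \<and> d = e"
      using ad cl cl' by (metis inv_closed inv_equality inv_inv)
  qed
  ultimately have "?f \<in> iso (G\<lparr>carrier := A\<rparr> \<times>\<times> G\<lparr>carrier := D\<rparr>) (G\<lparr>carrier := A <#> D\<rparr>)"
    unfolding iso_def bij_betw_def by (auto simp: set_mult_def image_iff Bex_def)
  then show ?thesis by (rule is_isoI)
qed

lemma (in group) cyclic_subgroup_iso:
  assumes z: "z \<in> carrier G" and n: "ord z = n" "n > 0"
  shows "integer_mod_group n \<cong> G\<lparr>carrier := generate G {z}\<rparr>"
proof -
  let ?f = "\<lambda>k::int. z [^] k"
  have mod: "z [^] (k mod int n) = z [^] k" for k :: int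
    using int_pow_eq[OF z] n by (simp add: mod_eq_dvd_iff)
  have carr: "carrier (integer_mod_group n) = {0..<int n}" using n by (simp add: carrier_integer_mod_group)
  have "?f \<in> hom (integer_mod_group n) (G\<lparr>carrier := generate G {z}\<rparr>)"
    by (rule homI) (use z in \<open>auto simp: generate_pow mod int_pow_mult\<close>)
  moreover have "inj_on ?f {0..<int n}"
  proof (rule inj_onI)
    fix k l assume kl: "k \<in> {0..<int n}" "l \<in> {0..<int n}" and "z [^] k = z [^] l"
    then have "int n dvd l - k" using int_pow_eq[OF z] n by simp
    then have "l mod int n = k mod int n" by (simp add: mod_eq_dvd_iff)
    then show "k = l" using kl by simp
  qed
  moreover have "?f ` {0..<int n} = generate G {z}"
  proof
    show "generate G {z} \<subseteq> ?f ` {0..<int n}"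
    proof
      fix g assume "g \<in> generate G {z}"
      then obtain k :: int where "g = z [^] k" using generate_pow[OF z] by auto
      then have "g = z [^] (k mod int n)" using mod by simp
      then show "g \<in> ?f ` {0..<int n}" using n by (intro image_eqI) auto
    qed
  qed (use generate_pow[OF z] in auto)
  ultimately show ?thesis unfolding is_iso_def iso_def bij_betw_def carr by auto
qed

lemma Z2_power_Suc_iso: "Z2_power (Suc k) \<cong> Z2_power k \<times>\<times> integer_mod_group 2"
proof -
  let ?f = "\<lambda>g. (restrict g {..<k}, g k)"
  let ?g = "\<lambda>(g, a). (\<lambda>i\<in>{..<Suc k}. if i = k then a else g i)"
  have hom: "?f \<in> hom (Z2_power (Suc k)) (Z2_power k \<times>\<times> integer_mod_group 2)"
    by (rule homI) (auto simp: Z2_power_def PiE_iff carrier_integer_mod_group)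
  have inj: "inj_on ?f (carrier (Z2_power (Suc k)))"
  proof (rule inj_onI)
    fix g h assume gh: "g \<in> carrier (Z2_power (Suc k))" "h \<in> carrier (Z2_power (Suc k))" and eq: "?f g = ?f h"
    show "g = h"
    proof
      fix i
      have "restrict g {..<k} i = restrict h {..<k} i" using eq by simp
      then show "g i = h i"
        using gh eq by (cases "i < k"; cases "i = k") (auto simp: Z2_power_def PiE_iff extensional_def)
    qed
  qed
  have surj: "?f ` carrier (Z2_power (Suc k)) = carrier (Z2_power k \<times>\<times> integer_mod_group 2)"
  proof
    show "carrier (Z2_power k \<times>\<times> integer_mod_group 2) \<subseteq> ?f ` carrier (Z2_power (Suc k))"
    proof
      fix p assume p: "p \<in> carrier (Z2_power k \<times>\<times> integer_mod_group 2)"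
      obtain g a where ga: "p = (g, a)" by (cases p)
      have mem: "?g p \<in> carrier (Z2_power (Suc k))"
        using p ga by (auto simp: Z2_power_def PiE_iff)
      have inv: "?f (?g p) = p"
        using p ga by (auto simp: Z2_power_def PiE_iff extensional_def fun_eq_iff)
      show "p \<in> ?f ` carrier (Z2_power (Suc k))"
        using imageI[OF mem, of ?f] unfolding inv .
    qed
  qed (rule hom_carrier[OF hom])
  have "?f \<in> iso (Z2_power (Suc k)) (Z2_power k \<times>\<times> integer_mod_group 2)"
    unfolding iso_def bij_betw_def mem_Collect_eq by (intro conjI hom inj surj)
  then show ?thesis by (rule is_isoI)
qed

lemma group_Z2_power: "group (Z2_power k)"
  by (simp add: Z2_power_def)

text \<open>Independence from the earlier generators suffices, since the induction adjoins one
  cyclic direct factor at a time.\<close>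

lemma (in group) elementary_abelian_iso:
  assumes "\<And>i. i < k \<Longrightarrow> e i \<in> carrier G \<and> ord (e i) = 2"
    and "\<And>i j. \<lbrakk>i < k; j < k\<rbrakk> \<Longrightarrow> e i \<otimes> e j = e j \<otimes> e i"
    and "\<And>i. i < k \<Longrightarrow> generate G {e i} \<inter> generate G (e ` {..<i}) \<subseteq> {\<one>}"
  shows "Z2_power k \<cong> G\<lparr>carrier := generate G (e ` {..<k})\<rparr>"
  using assms
proof (induction k)
  case 0
  have "generate G {} = {\<one>}" by (rule generate_empty)
  then have "(\<lambda>_. \<one>) \<in> iso (Z2_power 0) (G\<lparr>carrier := generate G (e ` {..<0})\<rparr>)"
    by (auto simp: iso_def hom_def Z2_power_def bij_betw_def)
  then show ?case by (rule is_isoI)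
next
  case (Suc k)
  let ?E = "generate G (e ` {..<k})" and ?C = "generate G {e k}"
  have e: "e ` {..<k} \<subseteq> carrier G" "e k \<in> carrier G" using Suc.prems(1) by auto
  have E: "subgroup ?E G" and C: "subgroup ?C G" using e by (simp_all add: generate_is_subgroup)
  have ek: "e k \<otimes> g = g \<otimes> e k" if "g \<in> ?E" for g
    by (rule generate_commute[OF e _ that]) (use Suc.prems(2) in auto)
  have comm: "a \<otimes> d = d \<otimes> a" if "a \<in> ?E" "d \<in> ?C" for a d
    using generate_commute[of "{e k}" a d] that ek[OF that(1)] e subgroup.mem_carrier[OF E] by auto
  have "generate G (e ` {..<Suc k}) = ?E <#> ?C"
  proof
    have "e ` {..<Suc k} \<subseteq> ?E <#> ?C"
    proof
      fix g assume "g \<in> e ` {..<Suc k}"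
      then consider "g \<in> e ` {..<k}" | "g = e k" by (auto simp: less_Suc_eq)
      then show "g \<in> ?E <#> ?C"
      proof cases
        case 1
        then have "g \<in> ?E" "g = g \<otimes> \<one>" using e by (auto intro: generate.incl)
        then show ?thesis unfolding set_mult_def using generate.one[of G "{e k}"] by blast
      next
        case 2
        then have "g \<in> ?C" "g = \<one> \<otimes> g" using e by (auto intro: generate.incl)
        then show ?thesis unfolding set_mult_def using generate.one[of G "e ` {..<k}"] by blast
      qed
    qed
    then show "generate G (e ` {..<Suc k}) \<subseteq> ?E <#> ?C"
      using generate_subgroup_incl subgroup_set_mult_commuting[OF E C comm] by blast
    have "?E \<subseteq> generate G (e ` {..<Suc k})" "?C \<subseteq> generate G (e ` {..<Suc k})"
      by (rule mono_generate; auto)+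
    then show "?E <#> ?C \<subseteq> generate G (e ` {..<Suc k})"
      unfolding set_mult_def by (auto intro: generate.eng)
  qed
  moreover have "G\<lparr>carrier := ?E\<rparr> \<times>\<times> G\<lparr>carrier := ?C\<rparr> \<cong> G\<lparr>carrier := ?E <#> ?C\<rparr>"
    by (rule internal_product_iso[OF E C comm]) (use Suc.prems(3)[of k] in auto)
  moreover have "Z2_power k \<times>\<times> integer_mod_group 2 \<cong> G\<lparr>carrier := ?E\<rparr> \<times>\<times> G\<lparr>carrier := ?C\<rparr>"
    using Suc.IH Suc.prems cyclic_subgroup_iso[of "e k" 2]
    by (intro group.DirProd_iso_trans[OF group_Z2_power]) auto
  ultimately show ?case using iso_trans[OF iso_trans[OF Z2_power_Suc_iso]] by metis
qed

section \<open>Central products inside the group and complements in the centre\<close>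

context class_two
begin

text \<open>\<open>U\<close> is the part of the centre inside the central product \<open>T\<close>: a complement of \<open>U\<close> in
  the centre is a direct factor.\<close>

definition realizes :: "'k monoid list \<Rightarrow> 'a set \<Rightarrow> 'a set \<Rightarrow> 'a set \<Rightarrow> bool" where
  "realizes L T H U \<longleftrightarrow>
     central_decomp L T \<and> T \<subseteq> H \<and> H \<subseteq> T <#> center G \<and> T \<inter> center G = U"

lemma realizes_span:
  assumes H: "nondegenerate H" and xy: "x \<in> H" "y \<in> H" "\<not> commute x y"
    and K: "central_factor K (span x y)" and L: "realizes L T (pair_centralizer H x y) U"
    and int: "span x y \<inter> center G \<inter> U \<subseteq> {\<one>, c}"
  shows "realizes (K # L) (span x y <#> T) H ((span x y \<inter> center G) <#> U)"
  using central_decomp_span[OF H xy K, of L T] L int unfolding realizes_def by blast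

lemma span_inter_center_trivial:
  assumes xy: "x \<in> carrier G" "y \<in> carrier G" "\<not> commute x y"
    and sq: "x \<otimes> x \<in> {\<one>, c}" "y \<otimes> y \<in> {\<one>, c}"
  shows "span x y \<inter> center G = {\<one>, c}"
proof
  have p: "d [^] (i::int) \<in> {\<one>, c}" if "d \<in> {\<one>, c}" for d i
    using that by (auto simp: c_int_pow)
  have m: "d \<otimes> d' \<in> {\<one>, c}" if "d \<in> {\<one>, c}" "d' \<in> {\<one>, c}" for d d'
    using that by (auto simp: c_sq)
  show "span x y \<inter> center G \<subseteq> {\<one>, c}"
  proof
    fix g assume "g \<in> span x y \<inter> center G"
    then obtain i j e :: int where "g = (x \<otimes> x) [^] i \<otimes> (y \<otimes> y) [^] j \<otimes> c [^] e"
      using span_inter_center[OF xy, of g] commute_center xy by blast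
    then show "g \<in> {\<one>, c}" using m[OF m[OF p[OF sq(1)] p[OF sq(2)]] p[of c]] by simp
  qed
  show "{\<one>, c} \<subseteq> span x y \<inter> center G"
    using generators_in_span[OF xy(1,2)] c_in_center subgroup.one_closed[OF subgroup_center] by blast
qed

text \<open>Such a pair meets the centre in \<open>{\<one>, c}\<close> only, which already lies in
  \<open>U\<close>; the central part is unchanged.\<close>

lemma realizes_extraspecial:
  assumes H: "nondegenerate H" and xy: "x \<in> H" "y \<in> H" "\<not> commute x y"
    and sq: "x \<otimes> x \<in> {\<one>, c}" "y \<otimes> y \<in> {\<one>, c}"
    and K: "central_factor K (span x y)" and L: "realizes L T (pair_centralizer H x y) U"
  shows "realizes (K # L) (span x y <#> T) H U"
proof -
  have xyc: "x \<in> carrier G" "y \<in> carrier G" using xy nondegenerate_closed[OF H] by auto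
  note triv = span_inter_center_trivial[OF xyc xy(3) sq]
  have U: "subgroup U G" "c \<in> U"
    using L central_decomp_subgroup[of L T] subgroup_center c_in_center
      subgroups_Inter_pair[of T "center G"] unfolding realizes_def by auto
  have "{\<one>, c} <#> U = U"
  proof
    show "{\<one>, c} <#> U \<subseteq> U"
      unfolding set_mult_def using U subgroup.m_closed[OF U(1)] subgroup.mem_carrier[OF U(1)] by auto
    show "U \<subseteq> {\<one>, c} <#> U"
      unfolding set_mult_def using subgroup.mem_carrier[OF U(1)] l_one by fastforce
  qed
  then show ?thesis using realizes_span[OF H xy K L] triv by auto
qed

lemma realizes_center:
  assumes "central_decomp L T" "T \<subseteq> center G"
  shows "realizes L T (center G) T"
proof -
  have "\<one> \<in> T" using central_decomp_subgroup[OF assms(1)] subgroup.one_closed by blast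
  then have "center G \<subseteq> T <#> center G"
    unfolding set_mult_def using center_closed l_one by fastforce
  then show ?thesis using assms unfolding realizes_def by blast
qed

text \<open>The base \<open>L\<close> leaves room for a central cyclic factor at the end of the
  list. The statement about \<open>j = 0\<close> is carried along to rule out an empty product of
  \<open>D8\<close> factors when the whole group is noncommutative.\<close>

lemma hyperbolic_realizes:
  assumes "hyperbolic H" and base: "central_decomp L T0" "T0 \<subseteq> center G"
  shows "\<exists>j T. realizes (replicate j D8 @ L) T H T0 \<and> (j = 0 \<longrightarrow> H = center G)"
  using assms(1)
proof induction
  case center
  then show ?case using realizes_center[OF base] by (intro exI[of _ 0] exI[of _ T0]) simp
next
  case (pair H x y)
  then obtain j T where "realizes (replicate j D8 @ L) T (pair_centralizer H x y) T0" by blast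
  moreover have "central_factor D8 (span x y)"
    using pair.hyps nondegenerate_closed[OF pair.hyps(1)]
    by (intro central_factor_D8) (auto simp: commute_def)
  ultimately have "realizes (D8 # replicate j D8 @ L) (span x y <#> T) H T0"
    using pair.hyps by (intro realizes_extraspecial) auto
  then show ?case by (intro exI[of _ "Suc j"] exI[of _ "span x y <#> T"]) simp
qed

lemma flat_realizes:
  assumes H: "finite H" "nondegenerate H" "flat H" and base: "central_decomp L T0" "T0 \<subseteq> center G"
  shows "\<exists>j T. (realizes (replicate j D8 @ L) T H T0 \<and> (j = 0 \<longrightarrow> H = center G)) \<or>
    realizes (Q8 # replicate j D8 @ L) T H T0"
proof (cases "hyperbolic H")
  case True
  then show ?thesis using hyperbolic_realizes[OF _ base] by blast
next
  case False
  then obtain x y where xy: "x \<in> H" "y \<in> H" "\<not> commute x y" and sq: "x \<otimes> x = c" "y \<otimes> y = c"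
    and hyp: "hyperbolic (pair_centralizer H x y)" using flat_cases[OF H] by blast
  obtain j T where T: "realizes (replicate j D8 @ L) T (pair_centralizer H x y) T0"
    using hyperbolic_realizes[OF hyp base] by blast
  have "central_factor Q8 (span x y)"
    using xy sq nondegenerate_closed[OF H(2)]
    by (intro central_factor_Q8) (auto simp: commute_def)
  then have "realizes (Q8 # replicate j D8 @ L) (span x y <#> T) H T0"
    using realizes_extraspecial[OF H(2) xy _ _ _ T] sq by blast
  then show ?thesis by blast
qed

text \<open>\<open>T\<close> and the centre exhaust \<open>G\<close>, and the centre is
  \<open>U\<close> times \<open>D\<close>, so \<open>T\<close> and \<open>D\<close> exhaust
  \<open>G\<close>. As \<open>D\<close> is central, \<open>T\<close> meets it inside
  \<open>U \<inter> D\<close>; the product is therefore direct.\<close>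

lemma realizes_iso:
  assumes L: "realizes L T (carrier G) U" "L \<noteq> []"
    and D: "subgroup D G" "D \<subseteq> center G" and UD: "center G \<subseteq> U <#> D" "U \<inter> D \<subseteq> {\<one>}"
    and M: "group M" "M \<cong> G\<lparr>carrier := D\<rparr>"
  shows "G \<cong> central_product L \<times>\<times> M"
proof -
  have dec: "central_decomp L T" and cov: "carrier G \<subseteq> T <#> center G" and U: "T \<inter> center G = U"
    using L unfolding realizes_def by auto
  have T: "subgroup T G" using central_decomp_subgroup[OF dec] by simp
  have comm: "t \<otimes> d = d \<otimes> t" if "t \<in> T" "d \<in> D" for t d
    using commute_center[of d t] that D(2) subgroup.mem_carrier[OF T] by (auto simp: commute_def)
  have "carrier G \<subseteq> T <#> D"
  proof
    fix g assume "g \<in> carrier G"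
    then obtain t z where t: "t \<in> T" "z \<in> center G" "g = t \<otimes> z"
      using cov unfolding set_mult_def by blast
    then obtain u d where u: "u \<in> T" "d \<in> D" "z = u \<otimes> d"
      using UD(1) U unfolding set_mult_def by blast
    have "g = (t \<otimes> u) \<otimes> d"
      using t u subgroup.mem_carrier[OF T] subgroup.mem_carrier[OF D(1)] by (simp add: m_assoc)
    then show "g \<in> T <#> D"
      unfolding set_mult_def using subgroup.m_closed[OF T t(1) u(1)] u(2) by blast
  qed
  moreover have "T <#> D \<subseteq> carrier G"
    by (intro set_mult_closed subgroup.subset T D)
  ultimately have "T <#> D = carrier G" by blast
  then have eq: "G\<lparr>carrier := T <#> D\<rparr> = G" by simp
  have "G\<lparr>carrier := T\<rparr> \<times>\<times> G\<lparr>carrier := D\<rparr> \<cong> G"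
    using internal_product_iso[OF T D(1) comm] UD(2) U D(2) unfolding eq by blast
  moreover have "group (G\<lparr>carrier := T\<rparr> \<times>\<times> G\<lparr>carrier := D\<rparr>)"
    by (intro DirProd_group subgroup_imp_group T D)
  ultimately have "G \<cong> G\<lparr>carrier := T\<rparr> \<times>\<times> G\<lparr>carrier := D\<rparr>"
    by (rule group.iso_sym[rotated])
  also have "\<dots> \<cong> central_product L \<times>\<times> M"
    by (intro group.DirProd_iso_trans subgroup_imp_group T central_decomp_iso[OF dec L(2)]
        group.iso_sym[OF M])
  finally show ?thesis .
qed

end

section \<open>Exponents of squares\<close>

text \<open>The coordinates are integers, so equality of exponents only means congruence modulo the
  orders. \<open>square_coord\<close> is the trace of \<open>N\<close>: the quotient by
  \<open>N\<close> has exponent two, and hence squares have no component in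
  \<open>E\<close>.\<close>

locale center_coordinates = class_two +
  fixes z1 z2 E n m
  assumes fin: "finite (carrier G)" and m: "1 \<le> m" and mn: "m < n"
    and z1: "z1 \<in> center G" and z2: "z2 \<in> center G"
    and ord_z1: "ord z1 = 2 ^ n" and ord_z2: "ord z2 = 2 ^ m"
    and c_eq: "c = z2 [^] (2 ^ (m - 1) :: nat)"
    and E: "subgroup E G" "E \<subseteq> center G" and E_sq: "\<And>e. e \<in> E \<Longrightarrow> e \<otimes> e = \<one>"
    and center_coord: "\<And>z. z \<in> center G \<Longrightarrow> \<exists>(i::int) (j::int). \<exists>e \<in> E. z = z1 [^] i \<otimes> z2 [^] j \<otimes> e"
    and indep: "\<And>(i::int) (j::int) e. \<lbrakk>e \<in> E; z1 [^] i \<otimes> z2 [^] j \<otimes> e = \<one>\<rbrakk>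
      \<Longrightarrow> z1 [^] i = \<one> \<and> z2 [^] j = \<one> \<and> e = \<one>"
    and square_coord: "\<And>x. x \<in> carrier G \<Longrightarrow> \<exists>(i::int) (j::int). x \<otimes> x = z1 [^] i \<otimes> z2 [^] j"
    and nonabelian: "carrier G \<noteq> center G"
begin

definition coord :: "int \<Rightarrow> int \<Rightarrow> 'a" where
  "coord i j = z1 [^] i \<otimes> z2 [^] j"

lemma z_closed: "z1 \<in> carrier G" "z2 \<in> carrier G"
  using z1 z2 center_closed by auto

lemma coord_center: "coord i j \<in> center G"
  unfolding coord_def
  by (intro subgroup.m_closed[OF subgroup_center] subgroup_int_pow_closed[OF subgroup_center] z1 z2)

lemma coord_closed: "coord i j \<in> carrier G"
  by (rule center_closed[OF coord_center])

lemma coord_mult: "coord i j \<otimes> coord k l = coord (i + k) (j + l)"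
proof -
  have z1p: "z1 [^] k \<in> center G" by (rule subgroup_int_pow_closed[OF subgroup_center z1])
  have "commute (z1 [^] k) (z2 [^] j)"
    using commute_center[OF z1p int_pow_closed[OF z_closed(2)]] by blast
  then have comm: "z2 [^] j \<otimes> z1 [^] k = z1 [^] k \<otimes> z2 [^] j"
    unfolding commute_def by simp
  have "coord i j \<otimes> coord k l = z1 [^] i \<otimes> (z2 [^] j \<otimes> z1 [^] k) \<otimes> z2 [^] l"
    using z_closed by (simp add: coord_def m_assoc)
  also have "\<dots> = (z1 [^] i \<otimes> z1 [^] k) \<otimes> (z2 [^] j \<otimes> z2 [^] l)"
    unfolding comm using z_closed by (simp add: m_assoc)
  finally show ?thesis using z_closed by (simp add: coord_def int_pow_mult)
qed

lemma coord_eq_one_iff: "coord i j = \<one> \<longleftrightarrow> 2 ^ n dvd i \<and> 2 ^ m dvd j"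
proof -
  have "coord i j = \<one> \<longleftrightarrow> z1 [^] i = \<one> \<and> z2 [^] j = \<one>"
    using indep[OF subgroup.one_closed[OF E(1)], of i j] z_closed by (auto simp: coord_def)
  then show ?thesis using int_pow_eq_id z_closed ord_z1 ord_z2 by simp
qed

lemma coord_zero: "coord 0 0 = \<one>"
  by (simp add: coord_def)

lemma coord_eq_iff: "coord i j = coord k l \<longleftrightarrow> 2 ^ n dvd i - k \<and> 2 ^ m dvd j - l"
proof -
  have "coord i j = coord (i - k) (j - l) \<otimes> coord k l" by (simp add: coord_mult)
  then have "coord i j = coord k l \<longleftrightarrow> coord (i - k) (j - l) = \<one>"
    using coord_closed by simp
  then show ?thesis by (simp add: coord_eq_one_iff)
qed

lemma coord_inv: "inv (coord i j) = coord (- i) (- j)"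
  by (rule inv_equality) (simp_all add: coord_mult coord_zero coord_closed)

lemma coord_nat_pow: "coord i j [^] (k::nat) = coord (i * int k) (j * int k)"
  by (induction k) (simp_all add: coord_zero coord_mult algebra_simps)

lemma coord_int_pow: "coord i j [^] (k::int) = coord (i * k) (j * k)"
  by (simp add: int_pow_def2 coord_nat_pow coord_inv)

lemma c_coord: "c = coord 0 (2 ^ (m - 1))"
  using c_eq z_closed int_pow_int[of G z2 "2 ^ (m - 1)"] by (simp add: coord_def)

lemma z2_coord: "z2 = coord 0 1"
  using z_closed by (simp add: coord_def)

text \<open>The order \<open>2 ^ n\<close> is a multiple of the order of \<open>z2\<close>, since
  \<open>m < n\<close>. Hence multiplying \<open>z1\<close> by a power of \<open>z2\<close> does not
  change its order, and that power never has to be normalized away.\<close>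

lemma ord_coord_1: "ord (coord 1 l) = 2 ^ n"
proof -
  have "coord 1 l [^] k = \<one> \<longleftrightarrow> 2 ^ n dvd k" for k :: nat
  proof -
    have "(2::int) ^ m dvd l * int k" if "2 ^ n dvd k"
    proof -
      have "(2::int) ^ m dvd 2 ^ n" using mn by (simp add: le_imp_power_dvd)
      also have "2 ^ n dvd int k" using that by (metis of_nat_dvd_iff of_nat_numeral of_nat_power)
      finally show ?thesis by simp
    qed
    moreover have "(2::int) ^ n dvd int k \<longleftrightarrow> 2 ^ n dvd k"
      by (metis of_nat_dvd_iff of_nat_numeral of_nat_power)
    ultimately show ?thesis by (auto simp: coord_nat_pow coord_eq_one_iff)
  qed
  then show ?thesis using ord_unique[OF coord_closed] by blast
qed

text \<open>The cyclic groups of \<open>coord 1 l\<close> and \<open>z2\<close> meet trivially, so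
  \<open>coord 1 l\<close> may replace \<open>z1\<close> as a generator.\<close>

lemma power_of_coord_1:
  assumes "coord 1 l [^] (i::int) = coord 0 j"
  shows "coord 1 l [^] i = \<one>"
proof -
  have "2 ^ n dvd i" using assms by (simp add: coord_int_pow coord_eq_iff)
  then show ?thesis
    using int_pow_eq_id[OF coord_closed[of 1 l], of i] ord_coord_1 by simp
qed

text \<open>The exponent is only determined modulo a power of two; that this power is even, so that
  the parity does not depend on the representation, is the content of
  \<open>odd1_coord\<close>.\<close>

definition odd1 :: "'a \<Rightarrow> bool" where
  "odd1 g \<longleftrightarrow> (\<exists>i j. g = coord i j \<and> odd i)"

definition odd2 :: "'a \<Rightarrow> bool" where
  "odd2 g \<longleftrightarrow> (\<exists>i j. g = coord i j \<and> odd j)"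

lemma odd1_coord [simp]: "odd1 (coord i j) \<longleftrightarrow> odd i"
proof -
  have "(2::int) dvd 2 ^ n" using mn by simp
  then have "even i \<longleftrightarrow> even k" if "2 ^ n dvd i - k" for k
    using dvd_trans[OF _ that] by fastforce
  then have "odd i" if "odd1 (coord i j)"
    using that unfolding odd1_def coord_eq_iff by blast
  then show ?thesis unfolding odd1_def by blast
qed

lemma odd2_coord [simp]: "odd2 (coord i j) \<longleftrightarrow> odd j"
proof -
  have "(2::int) dvd 2 ^ m" using m by simp
  then have "even j \<longleftrightarrow> even k" if "2 ^ m dvd j - k" for k
    using dvd_trans[OF _ that] by fastforce
  then have "odd j" if "odd2 (coord i j)"
    using that unfolding odd2_def coord_eq_iff by blast
  then show ?thesis unfolding odd2_def by blast
qed

lemma square_coordE: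
  assumes "x \<in> carrier G"
  obtains i j where "x \<otimes> x = coord i j"
  using square_coord[OF assms] unfolding coord_def by blast

text \<open>The \<open>E\<close> component disappears on squaring. Consequently both parities vanish
  on squares of central elements, as a character modulo the centre requires.\<close>

lemma center_square:
  assumes "z \<in> center G"
  shows "\<exists>i j. z \<otimes> z = coord (2 * i) (2 * j)"
proof -
  obtain i j e where e: "e \<in> E" and z: "z = coord i j \<otimes> e"
    using center_coord[OF assms] unfolding coord_def by blast
  have "z \<otimes> z = coord i j \<otimes> coord i j \<otimes> (e \<otimes> e)"
    unfolding z using square_mult_center[OF coord_closed] e E(2) by blast
  then have "z \<otimes> z = coord (2 * i) (2 * j)"
    using E_sq[OF e] coord_closed by (simp add: coord_mult)
  then show ?thesis by blast
qed

lemma square_product_coord: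
  assumes "a \<in> carrier G" "b \<in> carrier G" "a \<otimes> a = coord i j" "b \<otimes> b = coord k l"
  shows "(a \<otimes> b) \<otimes> (a \<otimes> b) = coord (i + k) (j + l + (if commute a b then 0 else 2 ^ (m - 1)))"
  using square_mult[OF assms(1,2)] assms(3,4) coord_closed
  by (auto simp: coord_mult c_coord)

lemma odd1_square_mult:
  assumes "a \<in> carrier G" "b \<in> carrier G"
  shows "odd1 ((a \<otimes> b) \<otimes> (a \<otimes> b)) \<longleftrightarrow> odd1 (a \<otimes> a) \<noteq> odd1 (b \<otimes> b)"
proof -
  obtain i j where a: "a \<otimes> a = coord i j" using square_coordE[OF assms(1)] .
  obtain k l where b: "b \<otimes> b = coord k l" using square_coordE[OF assms(2)] .
  show ?thesis by (simp add: square_product_coord[OF assms a b] a b)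
qed

text \<open>The polarization term \<open>c\<close> adds \<open>2 ^ (m - 1)\<close> to the second
  exponent, which leaves the parity alone exactly when \<open>m\<close> is at least two.\<close>

lemma odd2_square_mult:
  assumes "a \<in> carrier G" "b \<in> carrier G" "2 \<le> m"
  shows "odd2 ((a \<otimes> b) \<otimes> (a \<otimes> b)) \<longleftrightarrow> odd2 (a \<otimes> a) \<noteq> odd2 (b \<otimes> b)"
proof -
  obtain i j where a: "a \<otimes> a = coord i j" using square_coordE[OF assms(1)] .
  obtain k l where b: "b \<otimes> b = coord k l" using square_coordE[OF assms(2)] .
  show ?thesis using assms(3) by (simp add: square_product_coord[OF assms(1,2) a b] a b)
qed

lemma odd_center_square:
  assumes "z \<in> center G"
  shows "\<not> odd1 (z \<otimes> z)" "\<not> odd2 (z \<otimes> z)"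
  using center_square[OF assms] by auto

lemma odd1_representation:
  obtains u where "u \<in> carrier G" "\<And>w. w \<in> carrier G \<Longrightarrow> odd1 (w \<otimes> w) \<longleftrightarrow> \<not> commute u w"
proof -
  have "\<exists>u \<in> carrier G. \<forall>w \<in> carrier G. odd1 (w \<otimes> w) \<longleftrightarrow> \<not> commute u w"
    by (rule character_representation[OF fin nondegenerate_carrier])
      (simp_all add: odd1_square_mult odd_center_square)
  then show ?thesis using that by blast
qed

lemma odd2_representation:
  assumes "nondegenerate H" "2 \<le> m"
  obtains u where "u \<in> H" "\<And>w. w \<in> H \<Longrightarrow> odd2 (w \<otimes> w) \<longleftrightarrow> \<not> commute u w"
proof -
  have "H \<subseteq> carrier G" using nondegenerate_closed[OF assms(1)] by blast
  then have "finite H" using fin finite_subset by blast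
  then have "\<exists>u \<in> H. \<forall>w \<in> H. odd2 (w \<otimes> w) \<longleftrightarrow> \<not> commute u w"
    by (rule character_representation[OF _ assms(1)])
      (simp_all add: odd2_square_mult[OF _ _ assms(2)] odd_center_square nondegenerate_closed[OF assms(1)])
  then show ?thesis using that by blast
qed

text \<open>A central multiplier changes the exponents of the square by even amounts and preserves
  all commutation relations, so squares may be reduced to their parities.\<close>

lemma normalize_square:
  assumes H: "nondegenerate H" and x: "x \<in> H" "x \<otimes> x = coord (2 * i + k) (2 * j + l)"
  obtains y where "y \<in> H" "y \<otimes> y = coord k l" "\<And>w. w \<in> carrier G \<Longrightarrow> commute y w \<longleftrightarrow> commute x w"
proof
  let ?z = "coord (- i) (- j)"
  have xc: "x \<in> carrier G" using nondegenerate_closed[OF H x(1)] .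
  show "x \<otimes> ?z \<in> H" using nondegenerate_mult[OF H x(1) nondegenerate_center[OF H coord_center]] .
  show "(x \<otimes> ?z) \<otimes> (x \<otimes> ?z) = coord k l"
    using square_mult_center[OF xc coord_center] x(2) by (simp add: coord_mult)
  show "commute (x \<otimes> ?z) w \<longleftrightarrow> commute x w" if "w \<in> carrier G" for w
    using commute_mult_center(1)[OF xc that coord_center] .
qed

text \<open>Even exponents are removed by a central multiplier with the negated halves as
  exponents.\<close>

lemma flatI:
  assumes H: "nondegenerate H" and 1: "\<And>x. x \<in> H \<Longrightarrow> \<not> odd1 (x \<otimes> x)"
    and 2: "\<And>x. \<lbrakk>x \<in> H; 2 \<le> m\<rbrakk> \<Longrightarrow> \<not> odd2 (x \<otimes> x)"
  shows "flat H"
  unfolding flat_def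
proof
  fix x assume x: "x \<in> H"
  have xc: "x \<in> carrier G" using nondegenerate_closed[OF H x] .
  obtain i j where ij: "x \<otimes> x = coord i j" using square_coordE[OF xc] .
  then obtain k where k: "i = 2 * k" using 1[OF x] by auto
  let ?z = "coord (- k) (- (j div 2))"
  have "(x \<otimes> ?z) \<otimes> (x \<otimes> ?z) = coord 0 (j mod 2)"
    using square_mult_center[OF xc coord_center] ij k
    by (simp add: coord_mult minus_div_mult_eq_mod algebra_simps flip: minus_mult_div_eq_mod)
  \<comment> \<open>An odd second exponent can only occur for \<open>m = 1\<close>, where
    \<open>z2\<close> is \<open>c\<close> and the remaining square is one of the permitted
    values.\<close>
  moreover have "coord 0 (j mod 2) \<in> {\<one>, c}"
  proof (cases "even j")
    case True
    then have "j mod 2 = 0" by presburger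
    then show ?thesis by (simp add: coord_zero)
  next
    case False
    then have "m = 1" using 2[OF x] ij m by force
    moreover have "j mod 2 = 1" using False by presburger
    ultimately show ?thesis by (simp add: c_coord)
  qed
  ultimately show "\<exists>z \<in> center G. (x \<otimes> z) \<otimes> (x \<otimes> z) \<in> {\<one>, c}"
    using coord_center by (intro bexI[of _ ?z]) auto
qed

text \<open>Let \<open>u\<close> represent the second parity on \<open>H\<close>. If
  \<open>u\<close> is central, \<open>H\<close> is flat. Otherwise \<open>u\<close> commutes with
  itself, so its square has even exponents and a central multiple \<open>y\<close> is an involution;
  a noncommuting partner has odd second exponent and can be given square \<open>z2\<close>. The
  centralizer of the pair commutes with \<open>u\<close>, so the parity vanishes there.\<close>

lemma flat_or_M2_pair:
  assumes H: "nondegenerate H" and not_odd1: "\<forall>x \<in> H. \<not> odd1 (x \<otimes> x)"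
  shows "flat H \<or> (\<exists>x \<in> H. \<exists>y \<in> H. \<not> commute x y \<and> x \<otimes> x = z2 \<and> y \<otimes> y = \<one> \<and>
    flat (pair_centralizer H x y))"
proof (cases "2 \<le> m \<and> \<not> flat H")
  case False
  then show ?thesis using flatI[OF H] not_odd1 by blast
next
  case True
  note cl = nondegenerate_closed[OF H]
  obtain u where u: "u \<in> H" and uw: "\<And>w. w \<in> H \<Longrightarrow> odd2 (w \<otimes> w) \<longleftrightarrow> \<not> commute u w"
    using odd2_representation[OF H] True by blast
  have "u \<notin> center G"
    using flatI[OF H] not_odd1 uw True commute_center cl by blast
  then obtain x' where x': "x' \<in> H" "\<not> commute u x'" using nondegenerate_partner[OF H u] by blast
  obtain i j where uu: "u \<otimes> u = coord i j" using square_coordE[OF cl[OF u]] .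
  have "even i" "even j" using not_odd1 u uw[OF u] uu by auto
  then obtain y where y: "y \<in> H" "y \<otimes> y = coord 0 0"
    and yu: "\<And>w. w \<in> carrier G \<Longrightarrow> commute y w \<longleftrightarrow> commute u w"
    using normalize_square[OF H u, of "i div 2" 0 "j div 2" 0] uu by auto
  obtain k l where xx: "x' \<otimes> x' = coord k l" using square_coordE[OF cl[OF x'(1)]] .
  have "even k" "odd l" using not_odd1 x'(1) uw[OF x'(1)] x'(2) xx by auto
  then obtain x where x: "x \<in> H" "x \<otimes> x = coord 0 1"
    and xx': "\<And>w. w \<in> carrier G \<Longrightarrow> commute x w \<longleftrightarrow> commute x' w"
    using normalize_square[OF H x'(1), of "k div 2" 0 "l div 2" 1] xx by auto
  have ncomm: "\<not> commute x y"
    using xx' yu x' y u cl commute_sym by metis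
  have "flat (pair_centralizer H x y)"
  proof (rule flatI[OF nondegenerate_pair_centralizer[OF H x(1) y(1) ncomm]])
    fix w assume w: "w \<in> pair_centralizer H x y"
    then have "w \<in> H" "commute u w"
      using yu[of w] cl commute_sym by (auto simp: pair_centralizer_def)
    then show "\<not> odd1 (w \<otimes> w)" "\<not> odd2 (w \<otimes> w)" using not_odd1 uw by blast+
  qed
  then show ?thesis
    using x y ncomm coord_zero z2_coord by metis
qed

section \<open>Splitting off the part of the centre that the central product does not absorb\<close>

lemma generate_z1: "generate G {z1} = range (\<lambda>i. coord i 0)"
  using generate_pow[OF z_closed(1)] z_closed by (auto simp: coord_def)

lemma generate_z2: "generate G {z2} = range (coord 0)"
  using generate_pow[OF z_closed(2)] z_closed by (auto simp: coord_def)

lemma z2_int_pow: "z2 [^] (j::int) = coord 0 j"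
  using z_closed by (simp add: coord_def)

lemma realizes_subgroup:
  assumes "realizes L T H U"
  shows "subgroup U G" "c \<in> U" "\<one> \<in> U"
  using assms central_decomp_subgroup[of L T] subgroup_center c_in_center
    subgroups_Inter_pair[of T "center G"] subgroup.one_closed[of U G] unfolding realizes_def by auto

lemma coord_in_E:
  assumes "coord i j \<in> E"
  shows "coord i j = \<one>"
proof -
  have "inv (coord i j) \<in> E" using assms E(1) by (rule subgroup.m_inv_closed[rotated])
  moreover have "z1 [^] i \<otimes> z2 [^] j \<otimes> inv (coord i j) = \<one>"
    using coord_closed by (simp flip: coord_def)
  ultimately have "inv (coord i j) = \<one>" using indep by blast
  then show ?thesis using coord_closed by (metis inv_inv inv_one)
qed

text \<open>Used when the nonabelian factors, with a possible cyclic one, absorb both large cyclic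
  factors of the centre. \<open>U\<close> is then the group of \<open>z1\<close> and
  \<open>z2\<close>, since \<open>coord 1 l\<close> and \<open>z2\<close> generate it, and
  \<open>E\<close> is a complement.\<close>

lemma realizes_iso_E:
  assumes L: "realizes L T (carrier G) U" "L \<noteq> []"
    and U: "U \<subseteq> range (case_prod coord)" "coord 1 l \<in> U" "z2 \<in> U"
    and s: "Z2_power s \<cong> G\<lparr>carrier := E\<rparr>"
  shows "G \<cong> central_product L \<times>\<times> Z2_power s"
proof (rule realizes_iso[OF L E _ _ group_Z2_power s])
  note sub = realizes_subgroup(1)[OF L(1)]
  show "center G \<subseteq> U <#> E"
  proof
    fix g assume "g \<in> center G"
    then obtain i j e where e: "e \<in> E" and g: "g = coord i j \<otimes> e"
      using center_coord unfolding coord_def by blast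
    have "coord i j = coord 1 l [^] i \<otimes> z2 [^] (j - l * i)"
      by (simp add: z2_int_pow coord_int_pow coord_mult)
    also have "\<dots> \<in> U"
      by (intro subgroup.m_closed[OF sub] subgroup_int_pow_closed[OF sub] U)
    finally show "g \<in> U <#> E" unfolding set_mult_def using e g by blast
  qed
  show "U \<inter> E \<subseteq> {\<one>}" using U(1) coord_in_E by auto
qed

text \<open>Used when no square has an odd exponent at \<open>z1\<close>. Then \<open>U\<close> is
  the group of \<open>z2\<close>, and its complement contributes a cyclic direct factor besides
  \<open>E\<close>.\<close>

lemma realizes_iso_z1_E:
  assumes L: "realizes L T (carrier G) U" "L \<noteq> []"
    and U: "U \<subseteq> range (coord 0)" "z2 \<in> U"
    and s: "Z2_power s \<cong> G\<lparr>carrier := E\<rparr>"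
  shows "G \<cong> central_product L \<times>\<times> integer_mod_group (2 ^ n) \<times>\<times> Z2_power s"
proof (rule realizes_iso[OF L])
  let ?Z = "generate G {z1}"
  note sub = realizes_subgroup(1)[OF L(1)]
  have Z: "subgroup ?Z G" using z_closed by (simp add: generate_is_subgroup)
  have Zc: "?Z \<subseteq> center G" using coord_center generate_z1 by auto
  have comm: "a \<otimes> d = d \<otimes> a" if "a \<in> ?Z" "d \<in> E" for a d
    using commute_center[of a d] that Zc E center_closed by (auto simp: commute_def)
  show D: "subgroup (?Z <#> E) G" by (rule subgroup_set_mult_commuting[OF Z E(1) comm])
  show "?Z <#> E \<subseteq> center G"
    unfolding set_mult_def using subgroup.m_closed[OF subgroup_center] Zc E by blast
  show "center G \<subseteq> U <#> (?Z <#> E)"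
  proof
    fix g assume "g \<in> center G"
    then obtain i j e where e: "e \<in> E" and g: "g = coord i j \<otimes> e"
      using center_coord unfolding coord_def by blast
    have "coord i j = z2 [^] j \<otimes> coord i 0"
      by (simp add: z2_int_pow coord_int_pow coord_mult)
    then have "g = z2 [^] j \<otimes> (coord i 0 \<otimes> e)"
      using g e E center_closed z_closed coord_closed by (simp add: m_assoc subsetD)
    moreover have "z2 [^] j \<in> U" by (rule subgroup_int_pow_closed[OF sub U(2)])
    moreover have "coord i 0 \<in> ?Z" unfolding generate_z1 by blast
    ultimately show "g \<in> U <#> (?Z <#> E)" unfolding set_mult_def using e by blast
  qed
  show "U \<inter> (?Z <#> E) \<subseteq> {\<one>}"
  proof
    fix g assume "g \<in> U \<inter> (?Z <#> E)"
    then obtain i j e where e: "e \<in> E" and g: "g = coord 0 j" "g = coord i 0 \<otimes> e"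
      using U(1) unfolding generate_z1 set_mult_def by blast
    \<comment> \<open>Moving the \<open>z1\<close> part to the other side exhibits the element of
      \<open>E\<close> in pure coordinates, hence it is trivial.\<close>
    have "coord (- i) j = coord (- i) 0 \<otimes> (coord i 0 \<otimes> e)"
      unfolding g(2)[symmetric] g(1) by (simp add: coord_mult)
    also have "\<dots> = e"
      using coord_closed e E center_closed by (simp add: coord_mult coord_zero subsetD flip: m_assoc)
    finally have "coord (- i) j = \<one>" using coord_in_E e by metis
    then show "g \<in> {\<one>}" using g(1) by (simp add: coord_eq_one_iff)
  qed
  show "group (integer_mod_group (2 ^ n) \<times>\<times> Z2_power s)"
    by (simp add: DirProd_group group_Z2_power)
  have int: "?Z \<inter> E \<subseteq> {\<one>}" using coord_in_E unfolding generate_z1 by auto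
  have "G\<lparr>carrier := ?Z\<rparr> \<times>\<times> G\<lparr>carrier := E\<rparr> \<cong> G\<lparr>carrier := ?Z <#> E\<rparr>"
    by (rule internal_product_iso[OF Z E(1) _ int]) (rule comm)
  moreover have "integer_mod_group (2 ^ n) \<times>\<times> Z2_power s \<cong> G\<lparr>carrier := ?Z\<rparr> \<times>\<times> G\<lparr>carrier := E\<rparr>"
    by (intro group.DirProd_iso_trans group_integer_mod_group s cyclic_subgroup_iso z_closed ord_z1) simp
  ultimately show "integer_mod_group (2 ^ n) \<times>\<times> Z2_power s \<cong> G\<lparr>carrier := ?Z <#> E\<rparr>"
    using iso_trans by blast
qed

lemma nondegenerate_finite: "nondegenerate H \<Longrightarrow> finite H"
  using fin finite_subset nondegenerate_closed by (metis subsetI)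

lemma flat_realizes_Nil:
  assumes "nondegenerate H" "flat H"
  shows "\<exists>j T. realizes (replicate j D8) T H {\<one>, c} \<or> realizes (Q8 # replicate j D8) T H {\<one>, c}"
  using flat_realizes[OF nondegenerate_finite[OF assms(1)] assms central_decomp.Nil]
    c_in_center subgroup.one_closed[OF subgroup_center] by auto

text \<open>Since no pair in \<open>H\<close> absorbs \<open>z2\<close>, its cyclic group enters as
  a central factor of its own, glued along \<open>c\<close>.\<close>

lemma flat_realizes_Cyc:
  assumes "nondegenerate H" "flat H"
  shows "\<exists>j T. (realizes (replicate j D8 @ [Cyc (2 ^ m)]) T H (range (coord 0)) \<and> (j = 0 \<longrightarrow> H = center G)) \<or>
    realizes (Q8 # replicate j D8 @ [Cyc (2 ^ m)]) T H (range (coord 0))"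
proof (rule flat_realizes[OF nondegenerate_finite[OF assms(1)] assms])
  show "range (coord 0) \<subseteq> center G" using coord_center by auto
  have "central_decomp [Cyc (2 ^ m)] (range (coord 0) <#> {\<one>, c})"
  proof (rule central_decomp.Cons[OF _ central_decomp.Nil])
    show "central_factor (Cyc (2 ^ m)) (range (coord 0))"
      using central_factor_Cyc[OF z_closed(2) m ord_z2 c_eq] by (simp add: generate_z2)
    show "a \<otimes> t = t \<otimes> a" if "a \<in> range (coord 0)" "t \<in> {\<one>, c}" for a t
      using that coord_closed c_comm by auto
  qed blast
  also have "range (coord 0) <#> {\<one>, c} = range (coord 0)"
  proof
    show "range (coord 0) <#> {\<one>, c} \<subseteq> range (coord 0)"
      unfolding set_mult_def using coord_closed by (auto simp: c_coord coord_mult)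
    show "range (coord 0) \<subseteq> range (coord 0) <#> {\<one>, c}"
      by (auto intro!: set_multI[of _ _ \<one>] simp: coord_closed)
  qed
  finally show "central_decomp [Cyc (2 ^ m)] (range (coord 0))" .
qed

section \<open>Pairs that absorb the large cyclic factors of the centre\<close>

lemma square_in_span:
  assumes "x \<in> carrier G" "y \<in> carrier G"
  shows "x \<otimes> x \<in> span x y \<inter> center G" "y \<otimes> y \<in> span x y \<inter> center G"
  using spanI[of x 2 y 0 0] spanI[of x 0 y 2 0] assms square_in_center
    int_pow_double[of x 1] int_pow_double[of y 1] by auto

lemma span_center_coord:
  assumes "x \<in> carrier G" "y \<in> carrier G" "\<not> commute x y"
    and "x \<otimes> x = coord a b" "y \<otimes> y = coord a' b'" and "g \<in> span x y \<inter> center G"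
  shows "\<exists>i j e. g = coord (a * i + a' * j) (b * i + b' * j + 2 ^ (m - 1) * e)"
proof -
  obtain i j e :: int where "g = (x \<otimes> x) [^] i \<otimes> (y \<otimes> y) [^] j \<otimes> c [^] e"
    using span_inter_center[OF assms(1-3), of g] commute_center[of g] assms by blast
  then have "g = coord (a * i + a' * j) (b * i + b' * j + 2 ^ (m - 1) * e)"
    by (simp add: assms c_coord coord_int_pow coord_mult)
  then show ?thesis by blast
qed

text \<open>The two conditions on \<open>U\<close> together say that this subgroup is the one
  generated by \<open>z2\<close>, the form needed both for a further factor in front and for the
  final splitting.\<close>

lemma realizes_M2:
  assumes H: "nondegenerate H" and xy: "x \<in> H" "y \<in> H" "\<not> commute x y"
    and sq: "x \<otimes> x = z2" "y \<otimes> y = \<one>"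
    and L: "realizes L T (pair_centralizer H x y) {\<one>, c}"
  shows "\<exists>T U. realizes (M2 (m + 1) 1 # L) T H U \<and> U \<subseteq> range (coord 0) \<and> z2 \<in> U"
proof -
  have xyc: "x \<in> carrier G" "y \<in> carrier G" using xy nondegenerate_closed[OF H] by auto
  have sq': "x \<otimes> x = coord 0 1" "y \<otimes> y = coord 0 0"
    unfolding sq by (rule z2_coord, rule coord_zero[symmetric])
  have "central_factor (M2 (m + 1) (0 + 1)) (span x y)"
    by (rule central_factor_M2)
      (use xyc xy(3) sq m ord_z2 c_eq in \<open>auto simp: commute_def\<close>)
  then have "realizes (M2 (m + 1) 1 # L) (span x y <#> T) H ((span x y \<inter> center G) <#> {\<one>, c})"
    using realizes_span[OF H xy _ L] by auto
  moreover have "(span x y \<inter> center G) <#> {\<one>, c} \<subseteq> range (coord 0)"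
  proof
    fix g assume "g \<in> (span x y \<inter> center G) <#> {\<one>, c}"
    then obtain s where s: "s \<in> span x y \<inter> center G" "g = s \<or> g = s \<otimes> c"
      unfolding set_mult_def using center_closed by auto
    have "\<exists>k. s = coord 0 k"
      using span_center_coord[OF xyc xy(3) sq'(1) sq'(2) s(1)] by auto
    then show "g \<in> range (coord 0)" using s(2) by (auto simp: c_coord coord_mult)
  qed
  moreover have "z2 \<in> (span x y \<inter> center G) <#> {\<one>, c}"
    by (rule set_multI[OF square_in_span(1)[OF xyc], of \<one>]) (simp_all add: sq z_closed)
  ultimately show ?thesis by blast
qed

lemma realizes_M2_11:
  assumes xy: "x \<in> carrier G" "y \<in> carrier G" "\<not> commute x y"
    and sq: "x \<otimes> x = coord 1 l" "y \<otimes> y = \<one>"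
    and L: "realizes L T (pair_centralizer (carrier G) x y) U" and U: "U \<subseteq> range (coord 0)" "z2 \<in> U"
  shows "\<exists>T U. realizes (M2_11 (n + 1) # L) T (carrier G) U \<and> U \<subseteq> range (case_prod coord) \<and>
    coord 1 l \<in> U \<and> z2 \<in> U"
proof -
  have "coord 1 l [^] i \<noteq> c" for i :: int
  proof
    assume eq: "coord 1 l [^] i = c"
    then have "coord 1 l [^] i = coord 0 (2 ^ (m - 1))" using c_coord by metis
    then show False using power_of_coord_1 eq c_not_one by metis
  qed
  then have "central_factor (M2_11 (n + 1)) (span x y)"
    by (intro central_factor_M2_11) (use xy sq ord_coord_1 in \<open>auto simp: commute_def\<close>)
  \<comment> \<open>A common element is a power of \<open>coord 1 l\<close> times a power of
    \<open>c\<close>, and also a power of \<open>z2\<close>; by independence the power of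
    \<open>coord 1 l\<close> is trivial.\<close>
  moreover have "span x y \<inter> center G \<inter> U \<subseteq> {\<one>, c}"
  proof
    fix g assume g: "g \<in> span x y \<inter> center G \<inter> U"
    then obtain i j e :: int where "g = (x \<otimes> x) [^] i \<otimes> (y \<otimes> y) [^] j \<otimes> c [^] e"
      using span_inter_center[OF xy, of g] commute_center[of g] xy by blast
    then have ge: "g = coord 1 l [^] i \<otimes> c [^] e" using coord_closed by (simp add: sq)
    obtain k where k: "g = coord 0 k" using g U by auto
    have "coord 1 l [^] i = g \<otimes> c [^] (- e)"
      unfolding ge using coord_closed by (simp add: m_assoc flip: int_pow_mult)
    also have "\<dots> = coord 0 (k + 2 ^ (m - 1) * - e)"
      by (simp add: k c_coord coord_int_pow coord_mult)
    finally have "coord 1 l [^] i = \<one>" by (rule power_of_coord_1)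
    then show "g \<in> {\<one>, c}" using ge by (simp add: c_int_pow)
  qed
  ultimately have "realizes (M2_11 (n + 1) # L) (span x y <#> T) (carrier G) ((span x y \<inter> center G) <#> U)"
    using realizes_span[OF nondegenerate_carrier xy _ L] by blast
  moreover have "(span x y \<inter> center G) <#> U \<subseteq> range (case_prod coord)"
  proof
    fix g assume "g \<in> (span x y \<inter> center G) <#> U"
    then obtain s u where s: "s \<in> span x y \<inter> center G" "u \<in> U" "g = s \<otimes> u"
      unfolding set_mult_def by blast
    obtain i j where "s = coord i j"
      using span_center_coord[OF xy, of 1 l 0 0 s] s(1) sq by (auto simp: coord_zero)
    moreover obtain k where "u = coord 0 k" using s(2) U by auto
    ultimately have "g = case_prod coord (i, j + k)" using s(3) by (simp add: coord_mult)
    then show "g \<in> range (case_prod coord)" by blast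
  qed
  moreover have "coord 1 l \<in> (span x y \<inter> center G) <#> U"
    by (rule set_multI[OF square_in_span(1)[OF xy(1,2)] realizes_subgroup(3)[OF L]])
      (simp add: sq coord_closed)
  moreover have "z2 \<in> (span x y \<inter> center G) <#> U"
    by (rule set_multI[OF square_in_span(2)[OF xy(1,2)] U(2)]) (simp add: sq z_closed)
  ultimately show ?thesis by blast
qed

text \<open>A single pair absorbs both cyclic factors. The independence of the two squares that
  \<open>M2\<close> requires comes from \<open>power_of_coord_1\<close>.\<close>

lemma realizes_M2_large:
  assumes xy: "x \<in> carrier G" "y \<in> carrier G" "\<not> commute x y"
    and sq: "x \<otimes> x = z2" "y \<otimes> y = coord 1 l"
    and L: "realizes L T (pair_centralizer (carrier G) x y) {\<one>, c}"
  shows "\<exists>T U. realizes (M2 (m + 1) (n + 1) # L) T (carrier G) U \<and> U \<subseteq> range (case_prod coord) \<and>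
    coord 1 l \<in> U \<and> z2 \<in> U"
proof -
  have sq': "x \<otimes> x = coord 0 1" "y \<otimes> y = coord 1 l"
    unfolding sq by (rule z2_coord, rule HOL.refl)
  have "z2 [^] i = \<one>" if "z2 [^] i = coord 1 l [^] j" for i j :: int
    using that power_of_coord_1[of l j i] z2_int_pow[of i] by metis
  then have "central_factor (M2 (m + 1) (n + 1)) (span x y)"
    by (intro central_factor_M2)
      (use xy sq m ord_z2 c_eq ord_coord_1 in \<open>auto simp: commute_def\<close>)
  then have "realizes (M2 (m + 1) (n + 1) # L) (span x y <#> T) (carrier G) ((span x y \<inter> center G) <#> {\<one>, c})"
    using realizes_span[OF nondegenerate_carrier xy _ L] by blast
  moreover have "(span x y \<inter> center G) <#> {\<one>, c} \<subseteq> range (case_prod coord)"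
  proof
    fix g assume "g \<in> (span x y \<inter> center G) <#> {\<one>, c}"
    then obtain s where s: "s \<in> span x y \<inter> center G" "g = s \<or> g = s \<otimes> c"
      unfolding set_mult_def using center_closed by auto
    obtain i j where "s = coord i j"
      using span_center_coord[OF xy sq' s(1)] by blast
    then have "g = case_prod coord (i, j) \<or> g = case_prod coord (i, j + 2 ^ (m - 1))"
      using s(2) by (simp add: c_coord coord_mult)
    then show "g \<in> range (case_prod coord)" by blast
  qed
  moreover have "g \<in> (span x y \<inter> center G) <#> {\<one>, c}" if "g \<in> span x y \<inter> center G" for g
    by (rule set_multI[OF that, of \<one>]) (use that center_closed in auto)
  then have "coord 1 l \<in> (span x y \<inter> center G) <#> {\<one>, c}" "z2 \<in> (span x y \<inter> center G) <#> {\<one>, c}"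
    using square_in_span[OF xy(1,2)] sq by auto
  ultimately show ?thesis by blast
qed

text \<open>Let \<open>u\<close> represent the parity of the exponent at \<open>z1\<close>. If
  \<open>u\<close> is central, \<open>z1\<close> splits off and only the second parity remains.
  Otherwise the parity \<open>\<epsilon>\<close> of the second exponent of the square of
  \<open>u\<close> decides: \<open>\<epsilon> = 0\<close> leads to a pair of type
  \<open>M2_11\<close>, and \<open>\<epsilon> = 1\<close> to one of type
  \<open>M2 (m + 1) (n + 1)\<close>.\<close>

theorem classification:
  assumes s: "Z2_power s \<cong> G\<lparr>carrier := E\<rparr>"
  shows "\<exists>j.
    G \<cong> central_product (M2 (m + 1) (n + 1) # replicate j D8) \<times>\<times> Z2_power s \<or>
    G \<cong> central_product (M2 (m + 1) (n + 1) # Q8 # replicate j D8) \<times>\<times> Z2_power s \<or>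
    G \<cong> central_product (M2_11 (n + 1) # M2 (m + 1) 1 # replicate j D8) \<times>\<times> Z2_power s \<or>
    G \<cong> central_product (M2_11 (n + 1) # M2 (m + 1) 1 # Q8 # replicate j D8) \<times>\<times> Z2_power s \<or>
    G \<cong> central_product (M2_11 (n + 1) # replicate j D8 @ [Cyc (2 ^ m)]) \<times>\<times> Z2_power s \<or>
    G \<cong> central_product (M2_11 (n + 1) # Q8 # replicate j D8 @ [Cyc (2 ^ m)]) \<times>\<times> Z2_power s \<or>
    G \<cong> central_product (M2 (m + 1) 1 # replicate j D8)
      \<times>\<times> integer_mod_group (2 ^ n) \<times>\<times> Z2_power s \<or>
    G \<cong> central_product (M2 (m + 1) 1 # Q8 # replicate j D8)
      \<times>\<times> integer_mod_group (2 ^ n) \<times>\<times> Z2_power s \<or>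
    1 \<le> j \<and> G \<cong> central_product (replicate j D8 @ [Cyc (2 ^ m)])
      \<times>\<times> integer_mod_group (2 ^ n) \<times>\<times> Z2_power s \<or>
    G \<cong> central_product (Q8 # replicate j D8 @ [Cyc (2 ^ m)])
      \<times>\<times> integer_mod_group (2 ^ n) \<times>\<times> Z2_power s"
proof -
  obtain u where u: "u \<in> carrier G" and uw: "\<And>w. w \<in> carrier G \<Longrightarrow> odd1 (w \<otimes> w) \<longleftrightarrow> \<not> commute u w"
    using odd1_representation by blast
  note nd = nondegenerate_carrier
  have z2R: "z2 \<in> range (coord 0)" by (rule range_eqI[of _ _ 1]) (rule z2_coord)
  show ?thesis
  proof (cases "u \<in> center G")
    case True
    then have no1: "\<forall>w \<in> carrier G. \<not> odd1 (w \<otimes> w)"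
      using uw commute_center by blast
    from flat_or_M2_pair[OF nd no1] show ?thesis
    proof (elim disjE bexE conjE)
      assume "flat (carrier G)"
      \<comment> \<open>\<open>j = 0\<close> would make \<open>G\<close> equal to its
        centre.\<close>
      then obtain j T where "(realizes (replicate j D8 @ [Cyc (2 ^ m)]) T (carrier G) (range (coord 0)) \<and> j \<noteq> 0) \<or>
          realizes (Q8 # replicate j D8 @ [Cyc (2 ^ m)]) T (carrier G) (range (coord 0))"
        using flat_realizes_Cyc[OF nd] nonabelian by blast
      then show ?thesis
        using realizes_iso_z1_E[OF _ _ subset_refl z2R s] by (intro exI[of _ j]) auto
    next
      fix x y assume xy: "x \<in> carrier G" "y \<in> carrier G" "\<not> commute x y"
        and sq: "x \<otimes> x = z2" "y \<otimes> y = \<one>" and flat: "flat (pair_centralizer (carrier G) x y)"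
      obtain j T where "realizes (replicate j D8) T (pair_centralizer (carrier G) x y) {\<one>, c} \<or>
          realizes (Q8 # replicate j D8) T (pair_centralizer (carrier G) x y) {\<one>, c}"
        using flat_realizes_Nil[OF nondegenerate_pair_centralizer[OF nd xy] flat] by blast
      then have "G \<cong> central_product (M2 (m + 1) 1 # replicate j D8) \<times>\<times> integer_mod_group (2 ^ n) \<times>\<times> Z2_power s \<or>
          G \<cong> central_product (M2 (m + 1) 1 # Q8 # replicate j D8) \<times>\<times> integer_mod_group (2 ^ n) \<times>\<times> Z2_power s"
        using realizes_M2[OF nd xy sq] realizes_iso_z1_E[OF _ _ _ _ s] by (metis list.distinct(1))
      then show ?thesis by blast
    qed
  next
    case False
    obtain i k where uu: "u \<otimes> u = coord i k" using square_coordE[OF u] .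
    \<comment> \<open>\<open>u\<close> commutes with itself, so its own square has even first
      exponent.\<close>
    have "even i" using uw[OF u] uu by simp
    define \<epsilon> where "\<epsilon> = k mod 2"
    have "u \<otimes> u = coord (2 * (i div 2) + 0) (2 * (k div 2) + \<epsilon>)"
      using uu \<open>even i\<close> by (simp add: \<epsilon>_def)
    then obtain y where y: "y \<in> carrier G" "y \<otimes> y = coord 0 \<epsilon>"
      and yu: "\<And>w. w \<in> carrier G \<Longrightarrow> commute y w \<longleftrightarrow> commute u w"
      using normalize_square[OF nd u] by blast
    have no1: "\<not> odd1 (w \<otimes> w)" if "w \<in> carrier G" "commute w y" for w
      using uw[OF that(1)] yu[OF that(1)] that commute_sym by blast
    \<comment> \<open>An element that does not commute with \<open>y\<close> has odd first exponent,
      which is normalized to 1; the second exponent \<open>l\<close> stays arbitrary.\<close>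
    have adjust: "\<exists>x l. x \<in> carrier G \<and> x \<otimes> x = coord 1 l \<and>
        (\<forall>w \<in> carrier G. commute x w \<longleftrightarrow> commute x' w)" if x': "x' \<in> carrier G" "\<not> commute x' y" for x'
    proof -
      obtain a b where ab: "x' \<otimes> x' = coord a b" using square_coordE[OF x'(1)] .
      have "odd a" using uw[OF x'(1)] yu[OF x'(1)] x' ab commute_sym by auto
      then have "x' \<otimes> x' = coord (2 * (a div 2) + 1) (2 * 0 + b)" using ab by simp
      then show ?thesis using normalize_square[OF nd x'(1)] by metis
    qed
    obtain x' where x': "x' \<in> carrier G" "\<not> commute u x'" using nondegenerate_partner[OF nd u False] by blast
    then have x'y: "\<not> commute x' y" using yu commute_sym by blast
    consider "\<epsilon> = 0" | "\<epsilon> = 1" unfolding \<epsilon>_def by linarith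
    then show ?thesis
    proof cases
      case 1
      obtain x l where x: "x \<in> carrier G" "x \<otimes> x = coord 1 l"
        and xw: "\<forall>w \<in> carrier G. commute x w \<longleftrightarrow> commute x' w" using adjust[OF x'(1) x'y] by blast
      have xy: "\<not> commute x y" using xw x'y y by blast
      have yy: "y \<otimes> y = \<one>" using y 1 coord_zero by simp
      let ?C = "pair_centralizer (carrier G) x y"
      have ndC: "nondegenerate ?C" by (rule nondegenerate_pair_centralizer[OF nd x(1) y(1) xy])
      have final: "G \<cong> central_product (M2_11 (n + 1) # L) \<times>\<times> Z2_power s"
        if "realizes L T ?C U" "U \<subseteq> range (coord 0)" "z2 \<in> U" for L T U
        using realizes_M2_11[OF x(1) y(1) xy x(2) yy that] realizes_iso_E[OF _ _ _ _ _ s] by blast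
      have "\<forall>w \<in> ?C. \<not> odd1 (w \<otimes> w)"
        using no1 by (auto simp: pair_centralizer_def)
      \<comment> \<open>The first pair has used up only the parity at \<open>z1\<close>; the parity
        at \<open>z2\<close> is treated again inside the centralizer.\<close>
      from flat_or_M2_pair[OF ndC this] show ?thesis
      proof (elim disjE bexE conjE)
        assume "flat ?C"
        then obtain j T where "realizes (replicate j D8 @ [Cyc (2 ^ m)]) T ?C (range (coord 0)) \<or>
            realizes (Q8 # replicate j D8 @ [Cyc (2 ^ m)]) T ?C (range (coord 0))"
          using flat_realizes_Cyc[OF ndC] by blast
        then show ?thesis using final[OF _ subset_refl z2R] by blast
      next
        fix v w assume vw: "v \<in> ?C" "w \<in> ?C" "\<not> commute v w"
          and sq: "v \<otimes> v = z2" "w \<otimes> w = \<one>" and flat: "flat (pair_centralizer ?C v w)"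
        obtain j T where "realizes (replicate j D8) T (pair_centralizer ?C v w) {\<one>, c} \<or>
            realizes (Q8 # replicate j D8) T (pair_centralizer ?C v w) {\<one>, c}"
          using flat_realizes_Nil[OF nondegenerate_pair_centralizer[OF ndC vw] flat] by blast
        then have "G \<cong> central_product (M2_11 (n + 1) # M2 (m + 1) 1 # replicate j D8) \<times>\<times> Z2_power s \<or>
            G \<cong> central_product (M2_11 (n + 1) # M2 (m + 1) 1 # Q8 # replicate j D8) \<times>\<times> Z2_power s"
          using realizes_M2[OF ndC vw sq] final by metis
        then show ?thesis by blast
      qed
    next
      case 2
      have yy: "y \<otimes> y = z2" unfolding y(2) 2 by (rule z2_coord[symmetric])
      \<comment> \<open>The partner of \<open>y\<close> must also control the second parity. For
        \<open>m \<ge> 2\<close> the representative of that parity serves: the square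
        \<open>z2\<close> of \<open>y\<close> has odd second exponent, so \<open>y\<close> does not
        commute with it. For \<open>m = 1\<close> any partner will do, as flatness then ignores this
        parity.\<close>
      have "\<exists>x'' \<in> carrier G. \<not> commute x'' y \<and>
          (2 \<le> m \<longrightarrow> (\<forall>w \<in> carrier G. commute x'' w \<longrightarrow> \<not> odd2 (w \<otimes> w)))"
      proof (cases "2 \<le> m")
        case True
        obtain v where v: "v \<in> carrier G" "\<And>w. w \<in> carrier G \<Longrightarrow> odd2 (w \<otimes> w) \<longleftrightarrow> \<not> commute v w"
          using odd2_representation[OF nd True] by blast
        have "odd2 (y \<otimes> y)" unfolding y(2) 2 by simp
        then show ?thesis using v y(1) by blast
      next
        case False
        then show ?thesis using x'(1) x'y by blast
      qed
      then obtain x'' where x'': "x'' \<in> carrier G" "\<not> commute x'' y"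
        and no2: "\<And>w. \<lbrakk>2 \<le> m; w \<in> carrier G; commute x'' w\<rbrakk> \<Longrightarrow> \<not> odd2 (w \<otimes> w)" by blast
      obtain x l where x: "x \<in> carrier G" "x \<otimes> x = coord 1 l"
        and xw: "\<forall>w \<in> carrier G. commute x w \<longleftrightarrow> commute x'' w" using adjust[OF x''] by blast
      have yx: "\<not> commute y x" using xw x'' y commute_sym by blast
      let ?C = "pair_centralizer (carrier G) y x"
      have ndC: "nondegenerate ?C" by (rule nondegenerate_pair_centralizer[OF nd y(1) x(1) yx])
      have "flat ?C"
      proof (rule flatI[OF ndC])
        fix w assume "w \<in> ?C"
        then have w: "w \<in> carrier G" "commute w y" "commute x'' w"
          using xw commute_sym by (auto simp: pair_centralizer_def)
        show "\<not> odd1 (w \<otimes> w)" using no1 w by blast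
        show "\<not> odd2 (w \<otimes> w)" if "2 \<le> m" using no2 that w by blast
      qed
      then obtain j T where "realizes (replicate j D8) T ?C {\<one>, c} \<or> realizes (Q8 # replicate j D8) T ?C {\<one>, c}"
        using flat_realizes_Nil[OF ndC] by blast
      then have "G \<cong> central_product (M2 (m + 1) (n + 1) # replicate j D8) \<times>\<times> Z2_power s \<or>
          G \<cong> central_product (M2 (m + 1) (n + 1) # Q8 # replicate j D8) \<times>\<times> Z2_power s"
        using realizes_M2_large[OF y(1) x(1) yx yy x(2)] realizes_iso_E[OF _ _ _ _ _ s]
        by (metis list.distinct(1))
      then show ?thesis by blast
    qed
  qed
qed

end

section \<open>The classification\<close>

lemma (in group) square_in_if_elementary_abelian:
  assumes "subgroup N G" "elementary_abelian 2 (G Mod N)" "x \<in> carrier G"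
  shows "x \<otimes> x \<in> N"
proof -
  have "N #> x \<in> carrier (G Mod N)"
    using assms by (auto simp: FactGroup_def RCOSETS_def)
  then have "(N #> x) [^]\<^bsub>G Mod N\<^esub> (2::nat) = N"
    using assms(2) by (simp add: elementary_abelian_def)
  \<comment> \<open>The leading \<open>N\<close> is the neutral element of the quotient, from which
    the recursion of the power starts.\<close>
  then have "N <#> (N #> x) <#> (N #> x) = N"
    by (simp add: numeral_eq_Suc)
  moreover have x: "x \<in> N #> x"
    using assms subgroup.one_closed[OF assms(1)] by (force simp: r_coset_def)
  have "x \<in> N <#> (N #> x)"
    by (rule set_multI[OF subgroup.one_closed[OF assms(1)] x]) (use assms in simp)
  then have "x \<otimes> x \<in> N <#> (N #> x) <#> (N #> x)"
    by (rule set_multI[OF _ x]) simp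
  ultimately show ?thesis by simp
qed

lemma (in group) internal_direct_productD:
  assumes "internal_direct_product G I H K" "i \<in> I" "J \<subseteq> I - {i}" "A \<subseteq> (\<Union>j\<in>J. H j)"
  shows "H i \<inter> generate G A \<subseteq> {\<one>}"
proof -
  have "A \<subseteq> (\<Union>j\<in>I - {i}. H j)" using assms(3,4) by (meson UN_mono order_refl subset_trans)
  then have "generate G A \<subseteq> generate G (\<Union>j\<in>I - {i}. H j)"
    by (rule mono_generate)
  moreover have "H i \<inter> generate G (\<Union>j\<in>I - {i}. H j) = {\<one>}"
    using assms(1,2) by (simp add: internal_direct_product_def)
  ultimately show ?thesis by (metis Int_mono order_refl)
qed

lemma (in group) generate_involutions:
  assumes "S \<subseteq> center G" "\<And>s. s \<in> S \<Longrightarrow> s \<otimes> s = \<one>" "g \<in> generate G S"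
  shows "g \<otimes> g = \<one>"
proof -
  have S: "S \<subseteq> carrier G" using assms(1) by (auto simp: center_def)
  show ?thesis
    using assms(3)
  proof induction
    case (inv h)
    then have "h \<in> carrier G" "h \<otimes> h = \<one>" using S assms(2) by auto
    then show ?case by (simp add: inv_equality)
  next
    case (eng g h)
    have gh: "g \<in> carrier G" "h \<in> carrier G" using eng generate_in_carrier[OF S] by auto
    have "h \<otimes> g = g \<otimes> h"
      using generate_commute[OF S gh(1) _ eng.hyps(2)] generate_commute[OF S gh(2) _ eng.hyps(1)]
        generate_commute[OF S _ _ eng.hyps(1)] assms(1) gh by (auto simp: center_def subset_iff)
    then have "g \<otimes> h \<otimes> (g \<otimes> h) = g \<otimes> (g \<otimes> h) \<otimes> h" using gh by (metis m_assoc m_closed)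
    also have "\<dots> = (g \<otimes> g) \<otimes> (h \<otimes> h)" using gh by (simp add: m_assoc)
    finally show ?case using eng.IH by simp
  qed (use assms(2) in auto)
qed

theorem theorem3p8:
  fixes G :: "('a, 'b) monoid_scheme" (structure)
    and N :: "'a set" and c :: 'a and z :: "nat \<Rightarrow> 'a" and n m r :: nat
  assumes "1 \<le> m" and "m < n"
    and "group G" and "finite (carrier G)" and "\<not> comm_group G"
    and "\<exists>e. order G = 2 ^ e"
    and "subgroup N G" and "N \<subseteq> center G"
    and "G\<lparr>carrier := N\<rparr> \<cong> integer_mod_group (2 ^ n) \<times>\<times> integer_mod_group (2 ^ m)"
    and "elementary_abelian 2 (G Mod N)"
    and "c \<in> carrier G" and "group.ord G c = 2"
    and "derived G (carrier G) = generate G {c}"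
    and "2 \<le> r"
    and "\<And>i. i \<in> {1..r} \<Longrightarrow> z i \<in> carrier G"
    and "group.ord G (z 1) = 2 ^ n" and "group.ord G (z 2) = 2 ^ m"
    and "\<And>i. i \<in> {3..r} \<Longrightarrow> group.ord G (z i) = 2"
    and "internal_direct_product G {1..r} (\<lambda>i. generate G {z i}) (center G)"
    and "internal_direct_product G {1, 2} (\<lambda>i. generate G {z i}) N"
    and "c \<in> generate G {z 2}"
  shows "\<exists>k::nat.
     (1 \<le> k \<and> G \<cong>
        central_product (M2 (m+1) (n+1) # replicate (k-1) D8)
          \<times>\<times> Z2_power (r-2)) \<or>
     (2 \<le> k \<and> G \<cong>
        central_product (M2 (m+1) (n+1) # Q8 # replicate (k-2) D8)
          \<times>\<times> Z2_power (r-2)) \<or>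
     (2 \<le> k \<and> G \<cong>
        central_product (M2_11 (n+1) # M2 (m+1) 1 # replicate (k-2) D8)
          \<times>\<times> Z2_power (r-2)) \<or>
     (3 \<le> k \<and> G \<cong>
        central_product (M2_11 (n+1) # M2 (m+1) 1 # Q8 # replicate (k-3) D8)
          \<times>\<times> Z2_power (r-2)) \<or>
     (1 \<le> k \<and> G \<cong>
        central_product (M2_11 (n+1) # replicate (k-1) D8 @ [Cyc (2 ^ m)])
          \<times>\<times> Z2_power (r-2)) \<or>
     (2 \<le> k \<and> G \<cong>
        central_product (M2_11 (n+1) # Q8 # replicate (k-2) D8 @ [Cyc (2 ^ m)])
          \<times>\<times> Z2_power (r-2)) \<or>
     (1 \<le> k \<and> G \<cong>
        central_product (M2 (m+1) 1 # replicate (k-1) D8)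
          \<times>\<times> integer_mod_group (2 ^ n) \<times>\<times> Z2_power (r-2)) \<or>
     (2 \<le> k \<and> G \<cong>
        central_product (M2 (m+1) 1 # Q8 # replicate (k-2) D8)
          \<times>\<times> integer_mod_group (2 ^ n) \<times>\<times> Z2_power (r-2)) \<or>
     (1 \<le> k \<and> G \<cong>
        central_product (replicate k D8 @ [Cyc (2 ^ m)])
          \<times>\<times> integer_mod_group (2 ^ n) \<times>\<times> Z2_power (r-2)) \<or>
     (1 \<le> k \<and> G \<cong>
        central_product (Q8 # replicate (k-1) D8 @ [Cyc (2 ^ m)])
          \<times>\<times> integer_mod_group (2 ^ n) \<times>\<times> Z2_power (r-2))"
proof -
  interpret group G by fact
  have r: "2 \<le> r" by fact
  \<comment> \<open>The generators of order two begin at index 3; the shift matches the index set of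
    \<open>Z2_power (r - 2)\<close>.\<close>
  define e where "e i = z (i + 3)" for i
  define E where "E = generate G (e ` {..<r - 2})"
  note IDP = \<open>internal_direct_product G {1..r} (\<lambda>i. generate G {z i}) (center G)\<close>
  note zc = \<open>\<And>i. i \<in> {1..r} \<Longrightarrow> z i \<in> carrier G\<close>
  have z1c: "z 1 \<in> carrier G" and z2c: "z 2 \<in> carrier G" using zc r by auto
  have center: "center G = generate G (\<Union>i\<in>{1..r}. generate G {z i})"
    using IDP unfolding internal_direct_product_def by blast
  have zcen: "z i \<in> center G" if "i \<in> {1..r}" for i
    unfolding center using that by (intro generate.incl UN_I[of i]) (auto intro: generate.incl)
  have ei: "e i \<in> center G \<and> e i \<in> carrier G \<and> ord (e i) = 2" if "i < r - 2" for i
    using that zcen[of "i + 3"] zc[of "i + 3"] \<open>\<And>i. i \<in> {3..r} \<Longrightarrow> ord (z i) = 2\<close>[of "i + 3"]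
    by (simp add: e_def)
  have eC: "e ` {..<r - 2} \<subseteq> carrier G" "e ` {..<r - 2} \<subseteq> center G" using ei by auto
  have cent_sub: "subgroup (center G) G"
    unfolding center by (rule generate_is_subgroup) (use zc generate_incl in blast)
  have E: "subgroup E G" "E \<subseteq> center G"
    unfolding E_def using generate_is_subgroup[OF eC(1)] generate_subgroup_incl[OF eC(2) cent_sub] by auto
  have commute: "a \<otimes> b = b \<otimes> a" if "a \<in> center G" "b \<in> carrier G" for a b
    using that by (simp add: center_def)
  have e_UN: "e ` {..<k} \<subseteq> (\<Union>j\<in>{3..<k + 3}. generate G {z j})" for k
    by (auto simp: e_def intro!: generate.incl bexI[of _ "_ + 3"])
  have gen_z2_center: "generate G {z 2} \<subseteq> center G"
    using zcen[of 2] r by (intro generate_subgroup_incl cent_sub) auto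
  have c: "c \<in> carrier G" "ord c = 2" by fact+
  have "c [^] (2::nat) = \<one>" using pow_ord_eq_1[OF c(1)] c(2) by simp
  then have cc: "c \<otimes> c = \<one>" using c by (simp add: numeral_eq_Suc)
  have c1: "c \<noteq> \<one>" using c(2) ord_id by auto
  have ccen: "c \<in> center G" using \<open>c \<in> generate G {z 2}\<close> gen_z2_center by blast
  have "subgroup {\<one>, c} G" by (rule subgroupI) (use c cc in \<open>auto simp: inv_equality\<close>)
  then have derived: "derived G (carrier G) \<subseteq> {\<one>, c}"
    unfolding \<open>derived G (carrier G) = generate G {c}\<close> by (intro generate_subgroup_incl) auto
  have class2: "class_two G c"
  proof unfold_locales
    fix x y assume xy: "x \<in> carrier G" "y \<in> carrier G"
    have "x \<otimes> y \<otimes> inv x \<otimes> inv y \<in> derived G (carrier G)"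
      unfolding derived_def using xy by (intro generate.incl) blast
    then have "x \<otimes> y \<otimes> inv x \<otimes> inv y \<in> {\<one>, c}" using derived by blast
    moreover have "x \<otimes> y = (x \<otimes> y \<otimes> inv x \<otimes> inv y) \<otimes> (y \<otimes> x)"
      using xy by (simp add: m_assoc)
    ultimately have "x \<otimes> y = \<one> \<otimes> (y \<otimes> x) \<or> x \<otimes> y = c \<otimes> (y \<otimes> x)" by auto
    then show "x \<otimes> y = y \<otimes> x \<or> x \<otimes> y = y \<otimes> x \<otimes> c"
      using xy commute[OF ccen, of "y \<otimes> x"] by auto
  next
    show "c \<otimes> x = x \<otimes> c" if "x \<in> carrier G" for x using commute[OF ccen that] .
  qed (rule c cc c1)+
  have int1: "generate G {z 1} \<inter> generate G A \<subseteq> {\<one>}" if "A \<subseteq> (\<Union>j\<in>{2..r}. generate G {z j})" for A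
    by (rule internal_direct_productD[OF IDP, of 1 "{2..r}"]) (use r that in auto)
  have int2: "generate G {z 2} \<inter> generate G A \<subseteq> {\<one>}" if "A \<subseteq> (\<Union>j\<in>{3..r}. generate G {z j})" for A
    by (rule internal_direct_productD[OF IDP, of 2 "{3..r}"]) (use r that in auto)
  have gens: "e ` {..<r - 2} \<subseteq> (\<Union>j\<in>{3..r}. generate G {z j})"
    by (rule order_trans[OF e_UN UN_mono]) (use r in auto)
  have W: "subgroup (generate G {z 1} <#> generate G {z 2}) G"
    "subgroup (generate G {z 1} <#> generate G {z 2} <#> E) G"
  proof -
    show *: "subgroup (generate G {z 1} <#> generate G {z 2}) G"
    proof (intro subgroup_set_mult_commuting generate_is_subgroup)
      fix a b assume "a \<in> generate G {z 1}" "b \<in> generate G {z 2}"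
      then show "a \<otimes> b = b \<otimes> a"
        using commute[of b a] generate_in_carrier[of "{z 1}" a] gen_z2_center z1c by auto
    qed (use z1c z2c in auto)
    show "subgroup (generate G {z 1} <#> generate G {z 2} <#> E) G"
    proof (rule subgroup_set_mult_commuting[OF * E(1)])
      fix a b assume "a \<in> generate G {z 1} <#> generate G {z 2}" "b \<in> E"
      then show "a \<otimes> b = b \<otimes> a"
        using commute[of b a] subgroup.mem_carrier[OF *, of a] E(2) by auto
    qed
  qed
  interpret center_coordinates G c "z 1" "z 2" E n m
  proof (rule center_coordinates.intro[OF class2 center_coordinates_axioms.intro])
    show "finite (carrier G)" "1 \<le> m" "m < n" "ord (z 1) = 2 ^ n" "ord (z 2) = 2 ^ m" by fact+
    show "z 1 \<in> center G" "z 2 \<in> center G" using zcen r by auto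
    show "subgroup E G" "E \<subseteq> center G" by fact+
    show "carrier G \<noteq> center G"
    proof
      assume "carrier G = center G"
      then have "comm_group G" using commute by (intro group_comm_groupI) auto
      then show False using \<open>\<not> comm_group G\<close> by simp
    qed
    show "c = z 2 [^] (2 ^ (m - 1) :: nat)"
    proof -
      \<comment> \<open>The involution of a cyclic 2-group is unique: \<open>k\<close> is
        \<open>2 ^ (m - 1)\<close> times an integer, which is odd because \<open>c\<close> is
        nontrivial, and odd multiples of \<open>2 ^ (m - 1)\<close> agree modulo
        \<open>2 ^ m\<close>.\<close>
      obtain k :: int where k: "c = z 2 [^] k"
        using \<open>c \<in> generate G {z 2}\<close> generate_pow[OF z2c] by auto
      have ord2: "ord (z 2) = 2 ^ m" by fact
      have "z 2 [^] (2 * k) = \<one>"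
        using cc int_pow_mult[OF z2c, of k k] unfolding k by simp
      then have "2 ^ m dvd 2 * k" using int_pow_eq_id[OF z2c] ord2 by simp
      moreover have m: "2 ^ m = 2 * (2::int) ^ (m - 1)" using \<open>1 \<le> m\<close> by (cases m) auto
      ultimately obtain l where l: "k = 2 ^ (m - 1) * l" by (auto simp: dvd_def)
      have "odd l"
      proof
        assume "even l"
        then have "2 ^ m dvd k" unfolding l m by (auto simp: mult_ac)
        then have "z 2 [^] k = \<one>" using int_pow_eq_id[OF z2c] ord2 by simp
        then show False using k c1 by simp
      qed
      then have "2 ^ m dvd k - 2 ^ (m - 1)"
        unfolding l m by (auto elim!: oddE simp: algebra_simps)
      then have "z 2 [^] k = z 2 [^] (2 ^ (m - 1) :: int)"
        using int_pow_eq[OF z2c] ord2 by (simp add: dvd_diff_commute)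
      then show ?thesis using k int_pow_int[of G "z 2" "2 ^ (m - 1)"] by simp
    qed
    show "x \<otimes> x = \<one>" if "x \<in> E" for x
    proof (rule generate_involutions[OF eC(2) _ that[unfolded E_def]])
      fix s assume "s \<in> e ` {..<r - 2}"
      then have "s \<in> carrier G" "ord s = 2" using ei by auto
      then show "s \<otimes> s = \<one>" using pow_ord_eq_1[of s] by (simp add: numeral_eq_Suc)
    qed
    show "\<exists>(i::int) (j::int). \<exists>e\<in>E. w = z 1 [^] i \<otimes> z 2 [^] j \<otimes> e" if "w \<in> center G" for w
    proof -
      let ?W = "generate G {z 1} <#> generate G {z 2} <#> E"
      have "z i \<in> ?W" if i: "i \<in> {1..r}" for i
      proof -
        consider "i = 1" | "i = 2" | "3 \<le> i" using i by fastforce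
        then show ?thesis
        proof cases
          case 1
          have "z 1 \<in> generate G {z 1} <#> generate G {z 2}"
            by (rule set_multI[OF generate.incl generate.one]) (use z1c in auto)
          then show ?thesis
            unfolding 1 by (rule set_multI[OF _ subgroup.one_closed[OF E(1)]]) (use z1c in auto)
        next
          case 2
          have "z 2 \<in> generate G {z 1} <#> generate G {z 2}"
            by (rule set_multI[OF generate.one generate.incl]) (use z2c in auto)
          then show ?thesis
            unfolding 2 by (rule set_multI[OF _ subgroup.one_closed[OF E(1)]]) (use z2c in auto)
        next
          case 3
          then have "z i = e (i - 3)" "i - 3 < r - 2" using i by (auto simp: e_def)
          then have "z i \<in> E" unfolding E_def by (intro generate.incl) auto
          then show ?thesis
            by (rule set_multI[OF subgroup.one_closed[OF W(1)]]) (use zc[OF i] in auto)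
        qed
      qed
      then have "generate G {z i} \<subseteq> ?W" if "i \<in> {1..r}" for i
        using that by (intro generate_subgroup_incl W) auto
      then have "center G \<subseteq> ?W"
        unfolding center by (rule generate_subgroup_incl[OF UN_least W(2)])
      then have "w \<in> ?W" using that by blast
      then show ?thesis
        unfolding set_mult_def generate_pow[OF z1c] generate_pow[OF z2c] by blast
    qed
    show "z 1 [^] i = \<one> \<and> z 2 [^] j = \<one> \<and> x = \<one>"
      if x: "x \<in> E" and one: "z 1 [^] i \<otimes> z 2 [^] j \<otimes> x = \<one>" for i j :: int and x
    proof -
      have xc: "x \<in> carrier G" using x subgroup.mem_carrier[OF E(1)] by blast
      have zi: "z 1 [^] i \<in> generate G {z 1}" and zj: "z 2 [^] j \<in> generate G {z 2}"
        using generate_pow[OF z1c] generate_pow[OF z2c] by auto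
      \<comment> \<open>The components are separated one by one: first \<open>z 1\<close> against
        all remaining generators, then \<open>z 2\<close> against \<open>E\<close>.\<close>
      let ?A = "generate G {z 2} \<union> e ` {..<r - 2}"
      have A: "?A \<subseteq> carrier G" using eC(1) generate_incl[of "{z 2}"] z2c by auto
      have "z 2 [^] j \<in> generate G ?A" using zj by (intro generate.incl) simp
      moreover have "x \<in> generate G ?A"
        using x mono_generate[of "e ` {..<r - 2}" ?A] unfolding E_def by blast
      ultimately have "inv (z 2 [^] j \<otimes> x) \<in> generate G ?A"
        by (intro generate_m_inv_closed[OF A] generate.eng)
      moreover have "inv (z 2 [^] j \<otimes> x) = z 1 [^] i"
        by (rule inv_equality) (use one z1c z2c xc in \<open>simp_all add: m_assoc\<close>)
      moreover have "?A \<subseteq> (\<Union>j\<in>{2..r}. generate G {z j})"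
        using gens r by fastforce
      ultimately have 1: "z 1 [^] i = \<one>" using int1[of ?A] zi by auto
      then have "z 2 [^] j \<otimes> x = \<one>" using one z2c xc by simp
      then have "inv x = z 2 [^] j" by (rule inv_equality) (use z2c xc in auto)
      moreover have "inv x \<in> E" using x E(1) by (simp add: subgroup.m_inv_closed)
      ultimately have 2: "z 2 [^] j = \<one>"
        using int2[OF gens] zj unfolding E_def by auto
      then show ?thesis using 1 one xc by simp
    qed
    show "\<exists>(i::int) (j::int). x \<otimes> x = z 1 [^] i \<otimes> z 2 [^] j" if "x \<in> carrier G" for x
    proof -
      have "N = generate G (\<Union>i\<in>{1, 2}. generate G {z i})"
        using \<open>internal_direct_product G {1, 2} (\<lambda>i. generate G {z i}) N\<close>
        unfolding internal_direct_product_def by blast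
      also have "\<dots> \<subseteq> generate G {z 1} <#> generate G {z 2}"
      proof (rule generate_subgroup_incl[OF _ W(1)])
        have "generate G {z 1} \<subseteq> generate G {z 1} <#> generate G {z 2}"
          using generate_in_carrier[of "{z 1}"] z1c
          by (auto intro!: set_multI[OF _ generate.one])
        moreover have "generate G {z 2} \<subseteq> generate G {z 1} <#> generate G {z 2}"
          using generate_in_carrier[of "{z 2}"] z2c
          by (auto intro!: set_multI[OF generate.one])
        ultimately show "(\<Union>i\<in>{1, 2}. generate G {z i}) \<subseteq> generate G {z 1} <#> generate G {z 2}" by simp
      qed
      finally have "x \<otimes> x \<in> generate G {z 1} <#> generate G {z 2}"
        using square_in_if_elementary_abelian[OF \<open>subgroup N G\<close> \<open>elementary_abelian 2 (G Mod N)\<close> that] by blast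
      then show ?thesis
        unfolding set_mult_def generate_pow[OF z1c] generate_pow[OF z2c] by blast
    qed
  qed
  have "Z2_power (r - 2) \<cong> G\<lparr>carrier := E\<rparr>"
    unfolding E_def
  proof (rule elementary_abelian_iso)
    show "e i \<in> carrier G \<and> ord (e i) = 2" if "i < r - 2" for i using ei[OF that] by simp
    show "e i \<otimes> e j = e j \<otimes> e i" if "i < r - 2" "j < r - 2" for i j
      using commute ei[OF that(1)] ei[OF that(2)] by blast
    show "generate G {e i} \<inter> generate G (e ` {..<i}) \<subseteq> {\<one>}" if "i < r - 2" for i
      unfolding e_def[of i]
      by (rule internal_direct_productD[OF IDP, of "i + 3" "{3..<i + 3}"]) (use that e_UN[of i] in auto)
  qed
  \<comment> \<open>\<open>j\<close> counts further \<open>D8\<close> factors, whereas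
    \<open>k\<close> counts all nonabelian factors, that is half the dimension of
    \<open>G / center G\<close>; the offsets below account for the other nonabelian factors.\<close>
  from classification[OF this] show ?thesis
  proof (elim exE disjE, goal_cases)
    case (1 j)
    then show ?case by (intro exI[of _ "j + 1"]) (simp add: numeral_eq_Suc)
  next
    case (2 j)
    then show ?case by (intro exI[of _ "j + 2"]) (simp add: numeral_eq_Suc)
  next
    case (3 j)
    then show ?case by (intro exI[of _ "j + 2"]) (simp add: numeral_eq_Suc)
  next
    case (4 j)
    then show ?case by (intro exI[of _ "j + 3"]) (simp add: numeral_eq_Suc)
  next
    case (5 j)
    then show ?case by (intro exI[of _ "j + 1"]) (simp add: numeral_eq_Suc)
  next
    case (6 j)
    then show ?case by (intro exI[of _ "j + 2"]) (simp add: numeral_eq_Suc)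
  next
    case (7 j)
    then show ?case by (intro exI[of _ "j + 1"]) (simp add: numeral_eq_Suc)
  next
    case (8 j)
    then show ?case by (intro exI[of _ "j + 2"]) (simp add: numeral_eq_Suc)
  next
    case (9 j)
    then show ?case by (intro exI[of _ "j"]) (simp add: numeral_eq_Suc)
  next
    case (10 j)
    then show ?case by (intro exI[of _ "j + 1"]) (simp add: numeral_eq_Suc)
  qed
qed

end
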